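(* Let $(X_n)_{n\ge 0}$ be an excited random walk on $\mathbb{Z}$ whose cookie environment law $\mathbb{P}$ satisfies (IID), (WEL) and (BD$_M$) for some $M\in\mathbb{N}_0$, let $\delta=\mathbb{E}\big[\sum_{i=1}^M(2\omega(0,i)-1)\big]$ and let $R=\inf\{n\ge1: X_n=X_0\}$. Then $$E_0\big[R\,\mathbf{1}_{\{R<\infty\}}\big]<\infty\quad\text{if and only if}\quad |\delta|>3.$$
   Context: Excited random walk (ERW): Let $\Omega=[0,1]^{\mathbb{Z}\times\mathbb{N}}$ with its product Borel $\sigma$-field; elements $\omega=(\omega(z,i))_{z\in\mathbb{Z},i\ge1}$ are called cookie environments. Given $\omega\in\Omega$ and $x\in\mathbb{Z}$, under the quenched measure $P_{x,\omega}$ the nearest-neighbour process $(X_n)_{n\ge0}$ on $\mathbb{Z}$ satisfies $X_0=x$ a.s. and, for all $n\ge 0$, $$P_{x,\omega}[X_{n+1}=X_n+1\mid (X_i)_{0\le i\le n}]=\omega\big(X_n,\#\{i\le n: X_i=X_n\}\big),$$ $$P_{x,\omega}[X_{n+1}=X_n-1\mid (X_i)_{0\le i\le n}]=1-\omega\big(X_n,\#\{i\le n: X_i=X_n\}\big).$$ The environment $\omega$ is random with law $\mathbb{P}$ on $\Omega$ (expectation $\mathbb{E}$), and the averaged measure is $P_x[\cdot]=\mathbb{E}[P_{x,\omega}[\cdot]]$, with expectation $E_x$. Assumptions on $\mathbb{P}$: (IID) The family $(\omega(z,\cdot))_{z\in\mathbb{Z}}$ is i.i.d. under $\mathbb{P}$.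 (WEL) For all $z\in\mathbb{Z}$: $\mathbb{P}[\forall i\in\mathbb{N}:\omega(z,i)>0]>0$ and $\mathbb{P}[\forall i\in\mathbb{N}:\omega(z,i)<1]>0$. (BD$_M$) $\mathbb{P}$-a.s. $\omega(z,i)=1/2$ for all $z\in\mathbb{Z}$ and $i>M$, where $M\in\mathbb{N}_0=\mathbb{N}\cup\{0\}$ is non-random. Convention: $\inf\emptyset=\infty$. *)

theory Defs
  imports "HOL-Probability.Probability"
begin

type_synonym cookie_env = "int \<times> nat \<Rightarrow> real"

text \<open>Cookies are numbered from 1, so environments are extensional functions on
  \<open>UNIV \<times> {1..}\<close>.\<close>

definition unit_borel :: "real measure" where
  "unit_borel = restrict_space borel {0..1}"

definition cookie_space :: "cookie_env measure" where
  "cookie_space = (\<Pi>\<^sub>M _ \<in> UNIV \<times> {1..}. unit_borel)"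

definition stack_space :: "(nat \<Rightarrow> real) measure" where
  "stack_space = (\<Pi>\<^sub>M _ \<in> {1..}. unit_borel)"

definition stack :: "int \<Rightarrow> cookie_env \<Rightarrow> nat \<Rightarrow> real" where
  "stack z \<omega> = (\<lambda>i\<in>{1..}. \<omega> (z, i))"

definition env_law :: "cookie_env measure \<Rightarrow> bool" where
  "env_law P \<longleftrightarrow> prob_space P \<and> sets P = sets cookie_space"

definition IID :: "cookie_env measure \<Rightarrow> bool" where
  "IID P \<longleftrightarrow> prob_space.indep_vars P (\<lambda>_. stack_space) stack UNIV \<and>
     (\<forall>z z'. distr P stack_space (stack z) = distr P stack_space (stack z'))"

definition WEL :: "cookie_env measure \<Rightarrow> bool" where
  "WEL P \<longleftrightarrow> (\<forall>z. measure P {\<omega> \<in> space P. \<forall>i\<ge>1. \<omega> (z, i) > 0} > 0 \<and>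
                 measure P {\<omega> \<in> space P. \<forall>i\<ge>1. \<omega> (z, i) < 1} > 0)"

definition BD :: "nat \<Rightarrow> cookie_env measure \<Rightarrow> bool" where
  "BD M P \<longleftrightarrow> (AE \<omega> in P. \<forall>z. \<forall>i>M. \<omega> (z, i) = 1 / 2)"

definition mean_drift :: "nat \<Rightarrow> cookie_env measure \<Rightarrow> real" where
  "mean_drift M P = (\<integral>\<omega>. (\<Sum>i = 1..M. 2 * \<omega> (0, i) - 1) \<partial>P)"

definition past :: "'s measure \<Rightarrow> (nat \<Rightarrow> 's \<Rightarrow> int) \<Rightarrow> nat \<Rightarrow> 's measure" where
  "past Q X n = vimage_algebra (space Q) (\<lambda>s. \<lambda>i\<in>{..n}. X i s)
                  (\<Pi>\<^sub>M _ \<in> {..n}. count_space UNIV)"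

definition visits :: "(nat \<Rightarrow> 's \<Rightarrow> int) \<Rightarrow> nat \<Rightarrow> 's \<Rightarrow> nat" where
  "visits X n s = card {i. i \<le> n \<and> X i s = X n s}"

definition quenched_ERW ::
  "int \<Rightarrow> cookie_env \<Rightarrow> 's measure \<Rightarrow> (nat \<Rightarrow> 's \<Rightarrow> int) \<Rightarrow> bool" where
  "quenched_ERW x \<omega> Q X \<longleftrightarrow>
     prob_space Q \<and> (\<forall>n. X n \<in> measurable Q (count_space UNIV)) \<and>
     (AE s in Q. X 0 s = x) \<and>
     (\<forall>n. AE s in Q.
        real_cond_exp Q (past Q X n) (indicator {s \<in> space Q. X (Suc n) s = X n s + 1}) s
          = \<omega> (X n s, visits X n s)) \<and>
     (\<forall>n. AE s in Q.
        real_cond_exp Q (past Q X n) (indicator {s \<in> space Q. X (Suc n) s = X n s - 1}) s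
          = 1 - \<omega> (X n s, visits X n s))"

text \<open>\<open>Q \<omega>\<close> is the quenched measure, on an arbitrary measurable space \<open>S\<close> carrying the
  walk. Measurability of \<open>Q\<close> is what makes the averaged measure
  \<open>A \<mapsto> \<integral> Q \<omega> A dP(\<omega>)\<close>, i.e. \<open>P \<bind> Q\<close>, well defined.\<close>

definition ERW ::
  "int \<Rightarrow> 's measure \<Rightarrow> (cookie_env \<Rightarrow> 's measure) \<Rightarrow> (nat \<Rightarrow> 's \<Rightarrow> int) \<Rightarrow> bool" where
  "ERW x S Q X \<longleftrightarrow> Q \<in> measurable cookie_space (prob_algebra S) \<and>
     (\<forall>\<omega> \<in> space cookie_space. quenched_ERW x \<omega> (Q \<omega>) X)"

definition return_time :: "(nat \<Rightarrow> 's \<Rightarrow> int) \<Rightarrow> 's \<Rightarrow> enat" where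
  "return_time X s = Inf {enat n | n. n \<ge> 1 \<and> X n s = X 0 s}"

end

theory Submission
  imports Defs "HOL-Real_Asymp.Real_Asymp"
begin

text \<open>
  Suppose that the walk steps to the right first and then returns. The number \<open>V\<^sub>k\<close> of steps from
  \<open>k\<close> to \<open>k + 1\<close> satisfies \<open>V\<^sub>0 = 1\<close>, and \<open>V\<^sub>k\<^sub>+\<^sub>1\<close> is the number of right steps from \<open>k + 1\<close>
  before the \<open>V\<^sub>k\<close>-th left step. Averaged over the environment this is a Markov chain absorbed at 0;
  the walk returns iff the chain dies out, and then \<open>R\<close> is twice its total progeny.

  Since all but \<open>M\<close> cookies are fair, a martingale argument gives, for \<open>n > M\<close>, the generating function
  \<open>E[t^V\<^sub>k\<^sub>+\<^sub>1 | V\<^sub>k = n] = G(1 - t) / (2 - t)^n\<close> with \<open>G(y) = 1 - \<delta> y + O(y\<^sup>2)\<close>, and likewise the mean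
  \<open>n + \<delta>\<close> and a variance \<open>2 n + O(1)\<close>. The chain thus resembles the diffusion with generator
  \<open>v f'' + \<delta> f'\<close>: its extinction probability is of order \<open>n\<close> to the power \<open>1 - \<delta>\<close> if \<open>\<delta> > 1\<close>, and
  Lyapunov functions show that the progeny on the event of extinction has finite mean iff \<open>\<delta> < -1\<close> or
  \<open>\<delta> > 3\<close>. Reflection replaces \<open>\<delta>\<close> by \<open>-\<delta>\<close>, and both conditions together say \<open>\<bar>\<delta>\<bar> > 3\<close>.
\<close>

text \<open>Write e(v) for the extinction probability from v. The mean progeny on extinction is the
  sum over k of E[V_k e(V_k)]. If extinction is certain, the generator sends v^2 to 2 (1 + \<delta>)
  v, which is the source of the threshold -1. If e(v) is of order v^(1 - \<delta>), conditioning on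
  extinction is an h-transform that replaces \<delta> by 2 - \<delta>, and 2 - \<delta> < -1 is the
  threshold 3. The exact order of e is replaced by one-sided bounds: an upper bound for \<delta> > 3
  and a lower bound of order 1/v^2 for \<delta> \<le> 3. The obstacle is that powers of m have no
  explicit image under the kernel, while at \<delta> = -1 and \<delta> = 3 the leading terms cancel
  and the next order decides. Functions t^m do have an explicit image, so the test functions are
  built from m and t^m. The infinite cases are separated by whether extinction is certain, not by
  the value of \<delta>. Sums live in \<open>ennreal\<close>: inequalities are arranged without
  subtraction, and a term is cancelled only once it is known to be finite.\<close>

lemma ennreal_add_cancel_leD:
  fixes a b e :: ennreal
  assumes "e + a \<le> e + b" "e < \<infinity>"
  shows "a \<le> b"
  using assms by (auto simp: ennreal_add_left_cancel_le)

lemma ennreal_add_right_cancel_leD: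
  fixes a b e :: ennreal
  assumes "a + e \<le> b + e" "e < \<infinity>"
  shows "a \<le> b"
  using assms by (auto simp: ennreal_add_left_cancel_le add.commute[of _ e])

lemma ennreal_suminf_tendsto_0:
  fixes f :: "nat \<Rightarrow> ennreal"
  assumes "suminf f < \<infinity>"
  shows "f \<longlonglongrightarrow> 0"
proof -
  have f: "f i = ennreal (enn2real (f i))" for i
    using ennreal_suminf_lessD[OF assms, of i] by (simp add: less_top)
  then have "(\<Sum>i. ennreal (enn2real (f i))) \<noteq> top" using assms by (simp add: less_top flip: f)
  then have "summable (\<lambda>i. enn2real (f i))" by (intro summable_suminf_not_top) auto
  then have "(\<lambda>i. ennreal (enn2real (f i))) \<longlonglongrightarrow> ennreal 0"
    by (intro tendsto_ennrealI summable_LIMSEQ_zero)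
  then show ?thesis by (simp flip: f)
qed

section \<open>Markov chains on the naturals absorbed at zero\<close>

locale absorbed_chain =
  fixes K :: "nat \<Rightarrow> nat pmf"
  assumes K_0 [simp]: "K 0 = return_pmf 0"
begin

primrec iter :: "nat \<Rightarrow> nat \<Rightarrow> nat pmf" where
  "iter 0 n = return_pmf n"
| "iter (Suc k) n = bind_pmf (iter k n) K"

text \<open>The state 0 is absorbing, so the value of f there is counted infinitely often after
  extinction; finiteness is of interest for f vanishing at 0.\<close>

definition green :: "nat \<Rightarrow> (nat \<Rightarrow> ennreal) \<Rightarrow> ennreal" where
  "green n f = (\<Sum>k. \<integral>\<^sup>+m. f m \<partial>iter k n)"

lemma iter_Suc_first: "iter (Suc k) n = bind_pmf (K n) (iter k)"
proof (induction k arbitrary: n)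
  case 0
  have "iter 0 = return_pmf" by (rule ext) simp
  then show ?case by (simp add: bind_return_pmf bind_return_pmf')
next
  case (Suc k)
  have "iter (Suc k) = (\<lambda>m. bind_pmf (iter k m) K)" by (rule ext) simp
  then show ?case using Suc[of n] by (simp add: bind_assoc_pmf)
qed

lemma green_mono: "(\<And>m. f m \<le> g m) \<Longrightarrow> green n f \<le> green n g"
  unfolding green_def by (intro suminf_le nn_integral_mono) auto

lemma green_add: "green n (\<lambda>m. f m + g m) = green n f + green n g"
  unfolding green_def by (simp add: nn_integral_add suminf_add)

lemma green_cmult: "green n (\<lambda>m. c * f m) = c * green n f"
  unfolding green_def by (simp add: nn_integral_cmult)

lemma green_SUP:
  assumes "incseq F"
  shows "green n (\<lambda>m. SUP i. F i m) = (SUP i::nat. green n (F i))"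
proof -
  have "green n (\<lambda>m. SUP i. F i m) = (\<Sum>k. SUP i. \<integral>\<^sup>+m. F i m \<partial>iter k n)"
    unfolding green_def using assms by (subst nn_integral_monotone_convergence_SUP) auto
  also have "\<dots> = (SUP i. green n (F i))"
    unfolding green_def
    by (intro ennreal_suminf_SUP_eq)
       (auto intro!: nn_integral_mono incseq_SucI simp: incseq_SucD[OF assms, THEN le_funD])
  finally show ?thesis .
qed

lemma green_first_step: "green n f = f n + green n (\<lambda>m. \<integral>\<^sup>+j. f j \<partial>K m)"
proof -
  have "green n f = (\<Sum>k. \<integral>\<^sup>+m. f m \<partial>iter (Suc k) n) + (\<integral>\<^sup>+m. f m \<partial>iter 0 n)"
    unfolding green_def by (subst suminf_offset[of _ 1]) auto
  then show ?thesis by (simp add: green_def add.commute)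
qed

lemma green_one_step: "f n + (\<integral>\<^sup>+m. green m f \<partial>K n) = green n f"
proof -
  have "green n f = (\<Sum>k. \<integral>\<^sup>+m. f m \<partial>iter (Suc k) n) + (\<integral>\<^sup>+m. f m \<partial>iter 0 n)"
    unfolding green_def by (subst suminf_offset[of _ 1]) auto
  also have "(\<Sum>k. \<integral>\<^sup>+m. f m \<partial>iter (Suc k) n) = (\<integral>\<^sup>+m. green m f \<partial>K n)"
    unfolding iter_Suc_first nn_integral_bind_pmf green_def by (subst nn_integral_suminf) auto
  finally show ?thesis by (simp add: add.commute)
qed

text \<open>Dynkin's formula up to time J. The error \<open>\<xi>\<close> stands on the right so
  that nothing is subtracted; the terminal expectation of \<open>\<phi>\<close> is kept because the
  logarithm of a surviving chain is estimated through it.\<close>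

lemma lyapunov_partial:
  assumes "\<And>m. (\<integral>\<^sup>+j. \<phi> j \<partial>K m) + \<psi> m \<le> \<phi> m + \<xi> m"
  shows "(\<integral>\<^sup>+m. \<phi> m \<partial>iter J n) + (\<Sum>k<J. \<integral>\<^sup>+m. \<psi> m \<partial>iter k n)
    \<le> \<phi> n + (\<Sum>k<J. \<integral>\<^sup>+m. \<xi> m \<partial>iter k n)"
proof (induction J)
  case (Suc J)
  have "(\<integral>\<^sup>+m. \<phi> m \<partial>iter (Suc J) n) + (\<integral>\<^sup>+m. \<psi> m \<partial>iter J n)
      = (\<integral>\<^sup>+m. ((\<integral>\<^sup>+j. \<phi> j \<partial>K m) + \<psi> m) \<partial>iter J n)"
    by (simp add: nn_integral_add)
  also have "\<dots> \<le> (\<integral>\<^sup>+m. (\<phi> m + \<xi> m) \<partial>iter J n)"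
    by (intro nn_integral_mono assms)
  also have "\<dots> = (\<integral>\<^sup>+m. \<phi> m \<partial>iter J n) + (\<integral>\<^sup>+m. \<xi> m \<partial>iter J n)"
    by (simp add: nn_integral_add)
  finally have step: "(\<integral>\<^sup>+m. \<phi> m \<partial>iter (Suc J) n) + (\<integral>\<^sup>+m. \<psi> m \<partial>iter J n)
     \<le> (\<integral>\<^sup>+m. \<phi> m \<partial>iter J n) + (\<integral>\<^sup>+m. \<xi> m \<partial>iter J n)" .
  have "a + (s + b) \<le> c + (t + d)" if "a + b \<le> e + d" "e + s \<le> c + t" for a b c d e s t :: ennreal
  proof -
    have "a + (s + b) \<le> (e + d) + s" using add_right_mono[OF that(1), of s] by (simp add: ac_simps)
    also have "\<dots> \<le> c + (t + d)" using add_right_mono[OF that(2), of d] by (simp add: ac_simps)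
    finally show ?thesis .
  qed
  from this[OF step Suc.IH] show ?case by simp
qed simp

lemma lyapunov:
  assumes "\<And>m. (\<integral>\<^sup>+j. \<phi> j \<partial>K m) + \<psi> m \<le> \<phi> m + \<xi> m"
  shows "green n \<psi> \<le> \<phi> n + green n \<xi>"
  unfolding green_def[of n \<psi>]
proof (rule suminf_le_const)
  fix J
  have "(\<Sum>k<J. \<integral>\<^sup>+m. \<psi> m \<partial>iter k n) \<le> (\<integral>\<^sup>+m. \<phi> m \<partial>iter J n) + (\<Sum>k<J. \<integral>\<^sup>+m. \<psi> m \<partial>iter k n)"
    by simp
  also have "\<dots> \<le> \<phi> n + (\<Sum>k<J. \<integral>\<^sup>+m. \<xi> m \<partial>iter k n)"
    by (rule lyapunov_partial[OF assms])
  also have "\<dots> \<le> \<phi> n + green n \<xi>"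
    unfolding green_def by (intro add_left_mono sum_le_suminf) auto
  finally show "(\<Sum>k<J. \<integral>\<^sup>+m. \<psi> m \<partial>iter k n) \<le> \<phi> n + green n \<xi>" .
qed simp

text \<open>Each visit to {1..L} is followed by absorption with probability at least p, and
  absorption happens only once. Hence p times the mean number of visits is at most a probability,
  uniformly in the start.\<close>

lemma green_finite_set:
  assumes p: "0 < p" and "\<And>m. 1 \<le> m \<Longrightarrow> m \<le> L \<Longrightarrow> p \<le> pmf (K m) 0"
  shows "green n (\<lambda>m. indicator {1..L} m) \<le> ennreal (1 / p)"
proof -
  have "ennreal p * green n (\<lambda>m. indicator {1..L} m) \<le> 1"
    unfolding green_def ennreal_suminf_cmult[symmetric]
  proof (rule suminf_le_const)
    fix J
    have "(\<Sum>k<J. ennreal p * \<integral>\<^sup>+m. indicator {1..L} m \<partial>iter k n) \<le> emeasure (iter J n) {0}"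
    proof (induction J)
      case (Suc J)
      have "(\<Sum>k<Suc J. ennreal p * \<integral>\<^sup>+m. indicator {1..L} m \<partial>iter k n)
          \<le> emeasure (iter J n) {0} + ennreal p * (\<integral>\<^sup>+m. indicator {1..L} m \<partial>iter J n)"
        using Suc by (simp add: add_right_mono)
      also have "\<dots> = (\<integral>\<^sup>+m. indicator {0} m + ennreal p * indicator {1..L} m \<partial>iter J n)"
        by (subst nn_integral_add) (simp_all add: nn_integral_cmult)
      also have "\<dots> \<le> (\<integral>\<^sup>+m. emeasure (K m) {0} \<partial>iter J n)"
        using assms by (intro nn_integral_mono)
          (auto simp: emeasure_pmf_single indicator_def intro!: ennreal_leI)
      also have "\<dots> = emeasure (iter (Suc J) n) {0}"
        by simp
      finally show ?case .
    qed simp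
    also have "\<dots> \<le> 1" by (simp add: measure_pmf.emeasure_le_1)
    finally show "(\<Sum>k<J. ennreal p * \<integral>\<^sup>+m. indicator {1..L} m \<partial>iter k n) \<le> 1" .
  qed simp
  then have "ennreal (1/p) * (ennreal p * green n (\<lambda>m. indicator {1..L} m)) \<le> ennreal (1/p) * 1"
    by (intro mult_left_mono) auto
  moreover have "ennreal (1/p) * ennreal p = 1"
    using p by (simp flip: ennreal_mult)
  ultimately show ?thesis by (simp flip: mult.assoc)
qed

subsection \<open>Extinction and total progeny\<close>

text \<open>The probability that the chain started at n dies out with V_0 + V_1 + ... = l. The
  recursion removes the current generation from l, which decreases as long as n > 0; so no measure
  on trajectories is involved.\<close>

function progeny :: "nat \<Rightarrow> nat \<Rightarrow> ennreal" where
  "progeny n l = (if n = 0 then of_bool (l = 0) else if l < n then 0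
     else \<integral>\<^sup>+m. progeny m (l - n) \<partial>K n)"
  by auto
termination by (relation "Wellfounded.measure snd") auto

declare progeny.simps [simp del]

lemma progeny_0: "progeny 0 l = of_bool (l = 0)"
  by (simp add: progeny.simps)

lemma progeny_less: "l < n \<Longrightarrow> progeny n l = 0"
  by (simp add: progeny.simps)

lemma progeny_add: "0 < n \<Longrightarrow> progeny n (l + n) = (\<integral>\<^sup>+m. progeny m l \<partial>K n)"
  by (subst progeny.simps) simp

text \<open>Each generation before extinction has at least one member, so dying out and having
  finite total progeny are the same event.\<close>

definition extinct :: "nat \<Rightarrow> ennreal" where
  "extinct n = (\<Sum>l. progeny n l)"

definition mean_progeny :: "nat \<Rightarrow> ennreal" where
  "mean_progeny n = (\<Sum>l. of_nat l * progeny n l)"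

lemma extinct_0 [simp]: "extinct 0 = 1"
proof -
  have "extinct 0 = (\<Sum>l\<in>{0}. progeny 0 l)"
    unfolding extinct_def by (rule suminf_finite) (auto simp: progeny_0)
  then show ?thesis by (simp add: progeny_0)
qed

lemma mean_progeny_0 [simp]: "mean_progeny 0 = 0"
proof -
  have "(\<lambda>l. of_nat l * progeny 0 l) = (\<lambda>_. 0)" by (auto simp: progeny_0)
  then show ?thesis by (simp only: mean_progeny_def suminf_zero)
qed

lemma extinct_harmonic: "(\<integral>\<^sup>+m. extinct m \<partial>K n) = extinct n"
proof (cases "n = 0")
  case False
  have "extinct n = (\<Sum>l. progeny n (l + n))"
    unfolding extinct_def by (subst suminf_offset[of _ n]) (auto simp: progeny_less)
  then show ?thesis using False
    by (simp add: progeny_add extinct_def nn_integral_suminf)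
qed simp

lemma mean_progeny_first_step:
  "mean_progeny n = of_nat n * extinct n + (\<integral>\<^sup>+m. mean_progeny m \<partial>K n)"
proof (cases "n = 0")
  case False
  have "mean_progeny n = (\<Sum>l. of_nat (l + n) * progeny n (l + n))"
    unfolding mean_progeny_def by (subst suminf_offset[of _ n]) (auto simp: progeny_less)
  also have "\<dots> = (\<Sum>l. of_nat n * progeny n (l + n) + (\<integral>\<^sup>+m. of_nat l * progeny m l \<partial>K n))"
    using False by (simp add: progeny_add nn_integral_cmult algebra_simps)
  also have "\<dots> = of_nat n * (\<Sum>l. progeny n (l + n)) + (\<integral>\<^sup>+m. mean_progeny m \<partial>K n)"
    unfolding mean_progeny_def by (subst suminf_add[symmetric]) (auto simp: nn_integral_suminf)
  also have "(\<Sum>l. progeny n (l + n)) = extinct n"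
    unfolding extinct_def by (subst (2) suminf_offset[of _ n]) (auto simp: progeny_less)
  finally show ?thesis .
qed simp

text \<open>Minimality of the extinction probability among superharmonic functions that are at least
  1 at 0. The induction runs over the cut-off L of the total progeny, which drops by n with the
  first generation.\<close>

lemma extinct_le:
  assumes "1 \<le> \<phi> 0" and "\<And>m. 0 < m \<Longrightarrow> (\<integral>\<^sup>+j. \<phi> j \<partial>K m) \<le> \<phi> m"
  shows "extinct n \<le> \<phi> n"
proof -
  have "(\<Sum>l<L. progeny n l) \<le> \<phi> n" for L
  proof (induction L arbitrary: n rule: less_induct)
    case (less L)
    consider "n = 0" | "0 < n" "L \<le> n" | "0 < n" "n < L" by linarith
    then show ?case
    proof cases
      case 1
      have "(\<Sum>l<L. progeny 0 l) \<le> extinct 0"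
        unfolding extinct_def by (intro sum_le_suminf) auto
      then show ?thesis using 1 assms(1) by (auto intro: order_trans)
    next
      case 2
      then show ?thesis by (simp add: progeny_less)
    next
      case 3
      have "(\<Sum>l<L. progeny n l) = (\<Sum>l<L-n. progeny n (l + n))"
      proof -
        have "(\<Sum>l<L. progeny n l) = (\<Sum>l=n..<L. progeny n l)"
          by (intro sum.mono_neutral_right) (auto simp: progeny_less)
        also have "\<dots> = (\<Sum>l=0..<L-n. progeny n (l + n))"
          using 3 sum.shift_bounds_nat_ivl[of "progeny n" 0 n "L-n"] by simp
        finally show ?thesis by (simp add: atLeast0LessThan)
      qed
      also have "\<dots> = (\<integral>\<^sup>+m. (\<Sum>l<L-n. progeny m l) \<partial>K n)"
        using 3 by (simp add: progeny_add nn_integral_sum)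
      also have "\<dots> \<le> (\<integral>\<^sup>+m. \<phi> m \<partial>K n)"
        using 3 by (intro nn_integral_mono less) auto
      also have "\<dots> \<le> \<phi> n" by (rule assms(2)) (use 3 in simp)
      finally show ?thesis .
    qed
  qed
  then show ?thesis unfolding extinct_def by (intro suminf_le_const) auto
qed

lemma extinct_le_1: "extinct n \<le> 1"
  by (rule extinct_le) simp_all

lemma iter_0_le_extinct: "emeasure (iter k n) {0} \<le> extinct n"
proof (induction k arbitrary: n)
  case (Suc k)
  have "emeasure (iter (Suc k) n) {0} = (\<integral>\<^sup>+m. emeasure (iter k m) {0} \<partial>K n)"
    unfolding iter_Suc_first by simp
  also have "\<dots> \<le> (\<integral>\<^sup>+m. extinct m \<partial>K n)" by (intro nn_integral_mono Suc)
  finally show ?case by (simp add: extinct_harmonic)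
qed (auto simp: indicator_def)

lemma pmf_K_0_le_extinct: "ennreal (pmf (K n) 0) \<le> extinct n"
  using iter_0_le_extinct[of "Suc 0" n] by (simp add: bind_return_pmf emeasure_pmf_single del: nn_integral_bind_pmf)

lemma mean_progeny_le:
  assumes "\<And>m. 0 < m \<Longrightarrow> of_nat m * extinct m + (\<integral>\<^sup>+j. \<phi> j \<partial>K m) \<le> \<phi> m"
  shows "mean_progeny n \<le> \<phi> n"
proof -
  have "(\<Sum>l<L. of_nat l * progeny n l) \<le> \<phi> n" for L
  proof (induction L arbitrary: n rule: less_induct)
    case (less L)
    consider "n = 0" | "0 < n" "L \<le> n" | "0 < n" "n < L" by linarith
    then show ?case
    proof cases
      case 1
      have "(\<Sum>l<L. of_nat l * progeny n l) = 0"
        using 1 by (intro sum.neutral) (auto simp: progeny_0)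
      then show ?thesis by (simp only: zero_le)
    next
      case 2
      have "(\<Sum>l<L. of_nat l * progeny n l) = 0"
        using 2 by (intro sum.neutral) (auto simp: progeny_less)
      then show ?thesis by (simp only: zero_le)
    next
      case 3
      have "(\<Sum>l<L. of_nat l * progeny n l) = (\<Sum>l<L-n. of_nat (l + n) * progeny n (l + n))"
      proof -
        have "(\<Sum>l<L. of_nat l * progeny n l) = (\<Sum>l=n..<L. of_nat l * progeny n l)"
          by (intro sum.mono_neutral_right) (auto simp: progeny_less)
        also have "\<dots> = (\<Sum>l=0..<L-n. of_nat (l + n) * progeny n (l + n))"
          using 3 sum.shift_bounds_nat_ivl[of "\<lambda>l. of_nat l * progeny n l" 0 n "L-n"] by simp
        finally show ?thesis by (simp add: atLeast0LessThan)
      qed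
      also have "\<dots> = of_nat n * (\<Sum>l<L-n. progeny n (l + n))
          + (\<integral>\<^sup>+m. (\<Sum>l<L-n. of_nat l * progeny m l) \<partial>K n)"
        using 3 by (simp add: progeny_add nn_integral_sum nn_integral_cmult sum.distrib
            sum_distrib_left algebra_simps)
      also have "\<dots> \<le> of_nat n * extinct n + (\<integral>\<^sup>+m. \<phi> m \<partial>K n)"
      proof (intro add_mono mult_left_mono nn_integral_mono less)
        have "extinct n = (\<Sum>l. progeny n (l + n))"
          unfolding extinct_def by (subst suminf_offset[of _ n]) (auto simp: progeny_less)
        then show "(\<Sum>l<L-n. progeny n (l + n)) \<le> extinct n"
          by (simp add: sum_le_suminf)
      qed (use 3 in auto)
      finally show ?thesis using assms 3 by (metis order_trans)
    qed
  qed
  then show ?thesis unfolding mean_progeny_def by (intro suminf_le_const) auto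
qed

text \<open>Markov property: the members of generation k count only if the chain dies out later,
  which has conditional probability \<open>extinct\<close> of the current state. One inequality is
  minimality of the mean progeny, the other is \<open>lyapunov\<close>.\<close>

lemma mean_progeny_eq_green: "mean_progeny n = green n (\<lambda>m. of_nat m * extinct m)"
proof (rule antisym)
  show "mean_progeny n \<le> green n (\<lambda>m. of_nat m * extinct m)"
  proof (rule mean_progeny_le)
    fix m
    show "of_nat m * extinct m + (\<integral>\<^sup>+j. green j (\<lambda>m. of_nat m * extinct m) \<partial>K m)
        \<le> green m (\<lambda>m. of_nat m * extinct m)"
      by (subst (2) green_one_step[symmetric]) simp
  qed
  have "green n (\<lambda>m. of_nat m * extinct m) \<le> mean_progeny n + green n (\<lambda>_. 0)"
  proof (rule lyapunov)
    fix m
    show "(\<integral>\<^sup>+j. mean_progeny j \<partial>K m) + of_nat m * extinct m \<le> mean_progeny m + 0"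
      by (subst (2) mean_progeny_first_step) (simp add: add.commute)
  qed
  then show "green n (\<lambda>m. of_nat m * extinct m) \<le> mean_progeny n"
    by (simp add: green_def)
qed

end

text \<open>All that the analysis of the chain uses of the averaged environment. The formulas are
  for n > M, when all cookies at a site are consumed before its n-th left step. One constant C
  bounds the errors of the variance and of the expansion of G. The two positivity conditions reflect
  stacks that allow only left steps, or only right steps, as long as required.\<close>

locale excursion_chain = absorbed_chain K for K :: "nat \<Rightarrow> nat pmf" +
  fixes M :: nat and \<delta> C :: real and G :: "real \<Rightarrow> real"
  assumes pmf_0_pos: "0 < pmf (K n) 0"
    and pmf_1_pos: "M \<le> m \<Longrightarrow> 0 < pmf (K 1) m"
    and moment2_finite: "(\<integral>\<^sup>+m. ennreal (real m ^ 2) \<partial>K n) < \<infinity>"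
    and pgf: "M < n \<Longrightarrow> 0 \<le> t \<Longrightarrow> t \<le> 1 \<Longrightarrow>
      (\<integral>\<^sup>+m. ennreal (t ^ m) \<partial>K n) = ennreal (G (1 - t) / (2 - t) ^ n)"
    and mean: "M < n \<Longrightarrow> (\<integral>\<^sup>+m. ennreal (real m) \<partial>K n) = ennreal (real n + \<delta>)"
    and variance: "M < n \<Longrightarrow>
      (\<integral>\<^sup>+m. ennreal ((real m - real n)\<^sup>2) \<partial>K n) \<le> ennreal (2 * real n + C)"
    and delta_bound: "\<bar>\<delta>\<bar> \<le> real M"
    and G_nonneg: "0 \<le> y \<Longrightarrow> y \<le> 1 \<Longrightarrow> 0 \<le> G y"
    and G_expansion: "0 \<le> y \<Longrightarrow> y \<le> 1 \<Longrightarrow> \<bar>G y - (1 - \<delta> * y)\<bar> \<le> C * y\<^sup>2"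
    and C_nonneg: "0 \<le> C"
begin

section \<open>Lyapunov bounds outside finite sets, and finite mean for \<delta> < -1\<close>

lemma green_finite:
  obtains B :: real where "0 \<le> B" "\<And>n. green n (\<lambda>m. indicator {1..L} m) \<le> ennreal B"
proof -
  define p where "p = Min ((\<lambda>m. pmf (K m) 0) ` {0..L})"
  have "0 < p" unfolding p_def by (subst Min_gr_iff) (auto simp: pmf_0_pos)
  moreover have "p \<le> pmf (K m) 0" if "m \<le> L" for m
    unfolding p_def using that by (intro Min_le) auto
  ultimately show ?thesis using green_finite_set[of p L] by (intro that[of "1 / p"]) auto
qed

text \<open>A Lyapunov function only has to be controlled outside a finite set, because the chain
  spends a bounded mean time in every finite set of positive states.\<close>

lemma green_lyapunov_finite:
  assumes "\<And>m. L < m \<Longrightarrow> (\<integral>\<^sup>+j. \<phi> j \<partial>K m) + \<psi> m \<le> \<phi> m"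
    and "\<And>m. m \<le> L \<Longrightarrow> (\<integral>\<^sup>+j. \<phi> j \<partial>K m) + \<psi> m < \<infinity>"
    and "\<psi> 0 = 0"
  obtains B :: real where "0 \<le> B" "\<And>n. green n \<psi> \<le> \<phi> n + ennreal B"
proof -
  define D where "D = (\<Sum>m\<le>L. (\<integral>\<^sup>+j. \<phi> j \<partial>K m) + \<psi> m)"
  have "D < \<infinity>" unfolding D_def using assms(2) by (auto simp: less_top)
  then obtain d where d: "D = ennreal d" "0 \<le> d" by (cases D) auto
  obtain B where B: "0 \<le> B" "\<And>n. green n (\<lambda>m. indicator {1..L} m) \<le> ennreal B"
    using green_finite[of L] by blast
  have "green n \<psi> \<le> \<phi> n + ennreal (d * B)" for n
  proof -
    have "(\<integral>\<^sup>+j. \<phi> j \<partial>K m) + \<psi> m \<le> \<phi> m + D * indicator {1..L} m" for m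
    proof -
      consider "m = 0" | "L < m" | "1 \<le> m" "m \<le> L" by linarith
      then show ?thesis
      proof cases
        case 3
        have "(\<integral>\<^sup>+j. \<phi> j \<partial>K m) + \<psi> m \<le> D"
          unfolding D_def using 3 by (intro sum_nonneg_leq_bound[OF _ _ refl]) auto
        then show ?thesis using 3 by (simp add: add_increasing)
      qed (use assms in auto)
    qed
    from lyapunov[OF this, of n] have "green n \<psi> \<le> \<phi> n + green n (\<lambda>m. D * indicator {1..L} m)" .
    also have "\<dots> \<le> \<phi> n + ennreal d * ennreal B"
      unfolding green_cmult d(1) using B by (intro add_left_mono mult_left_mono) auto
    finally show ?thesis using d B by (simp add: ennreal_mult)
  qed
  then show ?thesis using d B by (intro that[of "d * B"]) auto
qed

lemma mean_moment_finite: "(\<integral>\<^sup>+m. ennreal (real m) \<partial>K n) < \<infinity>"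
proof -
  have "real m \<le> real m ^ 2" for m by (cases m) (auto simp: power2_eq_square)
  then have "(\<integral>\<^sup>+m. ennreal (real m) \<partial>K n) \<le> (\<integral>\<^sup>+m. ennreal (real m ^ 2) \<partial>K n)"
    by (intro nn_integral_mono ennreal_leI)
  then show ?thesis using moment2_finite[of n] by (auto intro: le_less_trans)
qed

lemma moment2_le:
  assumes "M < n"
  obtains I where "(\<integral>\<^sup>+m. ennreal (real m ^ 2) \<partial>K n) = ennreal I" "0 \<le> I"
    "I \<le> real n ^ 2 + 2 * (1 + \<delta>) * real n + C"
proof -
  obtain I where I: "(\<integral>\<^sup>+m. ennreal (real m ^ 2) \<partial>K n) = ennreal I" "0 \<le> I"
    using moment2_finite[of n] by (cases "\<integral>\<^sup>+m. ennreal (real m ^ 2) \<partial>K n") auto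
  have pos: "0 \<le> real n + \<delta>" using delta_bound assms by linarith
  \<comment> \<open>The identity m^2 + n^2 = (m - n)^2 + 2 n m expands the square without
    subtraction.\<close>
  have "ennreal (I + real n ^ 2) = (\<integral>\<^sup>+m. ennreal (real m ^ 2) + ennreal (real n ^ 2) \<partial>K n)"
    using I by (simp add: nn_integral_add)
  also have "\<dots> = (\<integral>\<^sup>+m. ennreal ((real m - real n)\<^sup>2) + ennreal (2 * real n) * ennreal (real m) \<partial>K n)"
    by (intro nn_integral_cong)
       (simp flip: ennreal_plus ennreal_mult, simp add: power2_eq_square algebra_simps)
  also have "\<dots> = (\<integral>\<^sup>+m. ennreal ((real m - real n)\<^sup>2) \<partial>K n) + ennreal (2 * real n) * ennreal (real n + \<delta>)"
    using assms by (simp add: nn_integral_add nn_integral_cmult mean)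
  also have "\<dots> \<le> ennreal (2 * real n + C) + ennreal (2 * real n) * ennreal (real n + \<delta>)"
    by (intro add_right_mono variance assms)
  also have "\<dots> = ennreal (2 * real n + C + 2 * real n * (real n + \<delta>))"
    using pos C_nonneg by (simp flip: ennreal_plus ennreal_mult)
  finally have "I + real n ^ 2 \<le> 2 * real n + C + 2 * real n * (real n + \<delta>)"
    using pos C_nonneg by (subst (asm) ennreal_le_iff) auto
  then show ?thesis using I by (intro that[of I]) (auto simp: algebra_simps power2_eq_square)
qed

lemma mean_progeny_finite_low:
  assumes "\<delta> < -1"
  shows "mean_progeny n < \<infinity>"
proof -
  \<comment> \<open>With this A the drift of A m^2 is at most -2 m + A C, hence at most -m as soon
    as m \<ge> A C.\<close>
  define A where "A = 1 / (- 1 - \<delta>)"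
  have A: "0 < A" "A * (1 + \<delta>) = -1" using assms by (auto simp: A_def field_simps)
  define L where "L = max M (nat \<lceil>A * C\<rceil>)"
  obtain B where B: "0 \<le> B" "\<And>n. green n (\<lambda>m. ennreal (real m)) \<le> ennreal (A * real n ^ 2) + ennreal B"
  proof (rule green_lyapunov_finite[of L "\<lambda>m. ennreal (A * real m ^ 2)" "\<lambda>m. ennreal (real m)"])
    fix m assume "L < m"
    then have m: "M < m" "A * C \<le> real m" unfolding L_def by linarith+
    obtain I where I: "(\<integral>\<^sup>+m. ennreal (real m ^ 2) \<partial>K m) = ennreal I" "0 \<le> I"
      "I \<le> real m ^ 2 + 2 * (1 + \<delta>) * real m + C"
      using moment2_le[OF m(1)] by blast
    have "(\<integral>\<^sup>+j. ennreal (A * real j ^ 2) \<partial>K m) + ennreal (real m) = ennreal (A * I + real m)"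
      using A I by (simp add: ennreal_mult nn_integral_cmult)
    also have "A * I + real m \<le> A * (real m ^ 2 + 2 * (1 + \<delta>) * real m + C) + real m"
      using A I by (intro add_right_mono mult_left_mono) auto
    also have "A * (real m ^ 2 + 2 * (1 + \<delta>) * real m + C) + real m
      = A * real m ^ 2 + 2 * (A * (1 + \<delta>)) * real m + A * C + real m" by (simp add: algebra_simps)
    also have "\<dots> \<le> A * real m ^ 2" unfolding A(2) using m by simp
    finally show "(\<integral>\<^sup>+j. ennreal (A * real j ^ 2) \<partial>K m) + ennreal (real m) \<le> ennreal (A * real m ^ 2)"
      by (simp add: ennreal_leI)
  next
    fix m show "(\<integral>\<^sup>+j. ennreal (A * real j ^ 2) \<partial>K m) + ennreal (real m) < \<infinity>"
      using moment2_finite[of m] A by (simp add: ennreal_mult nn_integral_cmult ennreal_mult_less_top)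
  qed auto
  have "mean_progeny n \<le> green n (\<lambda>m. ennreal (real m))"
    unfolding mean_progeny_eq_green
    by (intro green_mono) (simp add: ennreal_of_nat_eq_real_of_nat mult_left_le extinct_le_1)
  also have "\<dots> < \<infinity>" using B(2)[of n] by (auto intro: le_less_trans simp flip: ennreal_plus)
  finally show ?thesis .
qed

subsection \<open>Infinite mean when extinction is certain\<close>

text \<open>At t = 1 - y, a sum of n fair geometric variables has generating function 1 / (1 + y)^n.
  The factor 1 + n y^2 is the second order effect of its variance 2 n; it is found by multiplying
  with (1 + y)^n and using Bernoulli's inequality for y^2.\<close>

lemma neg_bin_bounds:
  fixes y :: real assumes "0 < y" "y < 1"
  shows "(1 - y) ^ n * (1 + real n * y\<^sup>2) \<le> 1 / (1 + y) ^ n" "1 - real n * y \<le> 1 / (1 + y) ^ n"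
    "1 / (1 + y) ^ n \<le> 1"
proof -
  have y2: "0 \<le> y\<^sup>2" "y\<^sup>2 \<le> 1" using assms by (auto simp: power_le_one)
  have "(1 - y) ^ n * (1 + real n * y\<^sup>2) * (1 + y) ^ n = (1 - y\<^sup>2) ^ n * (1 + real n * y\<^sup>2)"
    using power_mult_distrib[of "1 - y" "1 + y" n] by (simp add: power2_eq_square algebra_simps)
  also have "\<dots> \<le> (1 - y\<^sup>2) ^ n * (1 + y\<^sup>2) ^ n"
    using y2 Bernoulli_inequality[of "y\<^sup>2" n] order_trans[of "-1" 0 "y\<^sup>2"] by (intro mult_left_mono) auto
  also have "\<dots> = ((1 - y\<^sup>2) * (1 + y\<^sup>2)) ^ n" by (rule power_mult_distrib[symmetric])
  also have "\<dots> \<le> 1"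
  proof (rule power_le_one)
    show "0 \<le> (1 - y\<^sup>2) * (1 + y\<^sup>2)" using y2 by simp
    show "(1 - y\<^sup>2) * (1 + y\<^sup>2) \<le> 1" by (simp add: algebra_simps)
  qed
  finally show "(1 - y) ^ n * (1 + real n * y\<^sup>2) \<le> 1 / (1 + y) ^ n"
    using assms by (simp add: pos_le_divide_eq)
  have "1 - real n * y \<le> (1 - y) ^ n" using Bernoulli_inequality[of "-y" n] assms by simp
  also have "\<dots> \<le> (1 - y) ^ n * (1 + real n * y\<^sup>2)" using assms by (simp add: algebra_simps)
  also have "\<dots> \<le> 1 / (1 + y) ^ n" by fact
  finally show "1 - real n * y \<le> 1 / (1 + y) ^ n" .
  show "1 / (1 + y) ^ n \<le> 1" using assms by (simp add: one_le_power)
qed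

text \<open>A truncation of \<open>m (m - 1) / 2\<close> that grows only linearly.\<close>

definition trunc_binom :: "real \<Rightarrow> nat \<Rightarrow> real" where
  "trunc_binom t m = (\<Sum>i<m. \<Sum>j<i. t ^ j)"

lemma trunc_binom_nonneg: "0 \<le> t \<Longrightarrow> 0 \<le> trunc_binom t m"
  unfolding trunc_binom_def by (intro sum_nonneg) auto

text \<open>This is the point of the truncation: it is a combination of 1, m and t^m, so its
  expectation follows from the mean and the generating function alone.\<close>

lemma trunc_binom_eq: "(1 - t)\<^sup>2 * trunc_binom t m + 1 = (1 - t) * real m + t ^ m"
proof (induction m)
  case (Suc m)
  have "(1 - t)\<^sup>2 * trunc_binom t (Suc m) + 1
      = ((1 - t)\<^sup>2 * trunc_binom t m + 1) + (1 - t) * ((1 - t) * (\<Sum>j<m. t ^ j))"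
    by (simp add: trunc_binom_def algebra_simps power2_eq_square)
  also have "(1 - t) * (\<Sum>j<m. t ^ j) = 1 - t ^ m"
    by (simp add: one_diff_power_eq)
  finally show ?case unfolding Suc.IH by (simp add: algebra_simps)
qed (simp add: trunc_binom_def)

lemma trunc_binom_le: "0 \<le> t \<Longrightarrow> t \<le> 1 \<Longrightarrow> trunc_binom t m \<le> real m ^ 2"
proof -
  assume t: "0 \<le> t" "t \<le> 1"
  have "trunc_binom t m \<le> (\<Sum>i<m. \<Sum>j<m. 1)"
    unfolding trunc_binom_def
  proof (intro sum_mono)
    fix i assume "i \<in> {..<m}"
    have "(\<Sum>j<i. t ^ j) \<le> (\<Sum>j<i. 1)" using t by (intro sum_mono power_le_one) auto
    also have "\<dots> \<le> (\<Sum>j<m. 1)" using \<open>i \<in> _\<close> by simp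
    finally show "(\<Sum>j<i. t ^ j) \<le> (\<Sum>j<m. 1)" .
  qed
  then show ?thesis by (simp add: power2_eq_square)
qed

lemma trunc_binom_ge:
  assumes "0 \<le> t" "t \<le> 1"
  shows "t ^ m * (real m * (real m - 1) / 2) \<le> trunc_binom t m"
proof -
  have "(\<Sum>i<m. \<Sum>j<i. t ^ m) \<le> trunc_binom t m"
    unfolding trunc_binom_def using assms by (intro sum_mono power_decreasing) auto
  moreover have "(\<Sum>i<m. \<Sum>j<i. t ^ m) = t ^ m * (real m * (real m - 1) / 2)"
  proof -
    have "(\<Sum>i<m. real i) = real m * (real m - 1) / 2"
      by (induction m) (auto simp: field_simps)
    then show ?thesis by (simp flip: sum_distrib_right)
  qed
  ultimately show ?thesis by simp
qed

text \<open>In the limit t -> 1 the claim is that m (m - 1) / 2 loses at most C per step, because (1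
  + \<delta>) n \<ge> 0. For t < 1 the variance contributes n t^n and the drift at least -n; these
  are kept apart since they cancel only in the limit.\<close>

lemma trunc_binom_drift:
  assumes n: "M < n" and t: "0 < t" "t < 1" and d: "-1 \<le> \<delta>"
  shows "ennreal (trunc_binom t n) + ennreal (real n * t ^ n)
    \<le> (\<integral>\<^sup>+m. ennreal (trunc_binom t m) \<partial>K n) + ennreal (real n + C)"
proof -
  define y where "y = 1 - t"
  have y: "0 < y" "y < 1" "t = 1 - y" using t by (auto simp: y_def)
  have pos: "0 \<le> real n + \<delta>" using delta_bound n by linarith
  have "(\<integral>\<^sup>+m. ennreal (trunc_binom t m) \<partial>K n) \<le> (\<integral>\<^sup>+m. ennreal (real m ^ 2) \<partial>K n)"
    using t by (intro nn_integral_mono ennreal_leI trunc_binom_le) auto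
  then obtain I where I: "(\<integral>\<^sup>+m. ennreal (trunc_binom t m) \<partial>K n) = ennreal I" "0 \<le> I"
    using moment2_finite[of n] by (cases "\<integral>\<^sup>+m. ennreal (trunc_binom t m) \<partial>K n") (auto simp: top_unique)
  have "ennreal (y\<^sup>2 * I + 1) = (\<integral>\<^sup>+m. ennreal (y\<^sup>2) * ennreal (trunc_binom t m) + 1 \<partial>K n)"
    using I by (simp add: nn_integral_add nn_integral_cmult ennreal_mult)
  also have "\<dots> = (\<integral>\<^sup>+m. ennreal y * ennreal (real m) + ennreal (t ^ m) \<partial>K n)"
  proof (intro nn_integral_cong)
    fix m
    have "ennreal (y\<^sup>2) * ennreal (trunc_binom t m) + 1 = ennreal (y\<^sup>2 * trunc_binom t m + 1)"
      using trunc_binom_nonneg[of t m] t by (simp add: ennreal_mult)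
    also have "y\<^sup>2 * trunc_binom t m + 1 = y * real m + t ^ m" unfolding y_def by (rule trunc_binom_eq)
    also have "ennreal \<dots> = ennreal y * ennreal (real m) + ennreal (t ^ m)"
      using y t by (simp add: ennreal_mult)
    finally show "ennreal (y\<^sup>2) * ennreal (trunc_binom t m) + 1 = ennreal y * ennreal (real m) + ennreal (t ^ m)" .
  qed
  also have "\<dots> = ennreal y * ennreal (real n + \<delta>) + ennreal (G y / (1 + y) ^ n)"
    using n t pgf[of n t] by (simp add: nn_integral_add nn_integral_cmult mean y_def)
  also have "\<dots> = ennreal (y * (real n + \<delta>) + G y / (1 + y) ^ n)"
    using y pos G_nonneg[of y] by (simp add: ennreal_mult)
  finally have eq: "y\<^sup>2 * I + 1 = y * (real n + \<delta>) + G y / (1 + y) ^ n"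
    using y pos G_nonneg[of y] I by (subst (asm) ennreal_inj) auto
  define u where "u = 1 / (1 + y) ^ n"
  note u = neg_bin_bounds[OF y(1,2), of n, folded u_def]
  have u0: "0 \<le> u" using y by (simp add: u_def)
  have "(1 - \<delta> * y - C * y\<^sup>2) * u \<le> G y * u"
    using G_expansion[of y] y u0 by (intro mult_right_mono) auto
  moreover have "C * y\<^sup>2 * u \<le> C * y\<^sup>2" using u(3) C_nonneg by (simp add: mult_left_le)
  moreover have "\<delta> * y * (1 - u) \<ge> - (real n * y) * y"
  proof -
    have "(-1) * (y * (1 - u)) \<le> \<delta> * (y * (1 - u))" using d y u by (intro mult_right_mono) auto
    moreover have "y * (1 - u) \<le> y * (real n * y)" using u y by (intro mult_left_mono) auto
    ultimately show ?thesis by (simp add: algebra_simps)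
  qed
  ultimately have "y\<^sup>2 * I + 1 \<ge> y * real n + (1 - y) ^ n * (1 + real n * y\<^sup>2) - real n * y * y - C * y\<^sup>2"
    using u(1) unfolding eq by (simp add: u_def algebra_simps)
  moreover have "y\<^sup>2 * trunc_binom t n + 1 = y * real n + (1 - y) ^ n"
    using trunc_binom_eq[of t n] unfolding y(3) by simp
  ultimately have "y\<^sup>2 * (trunc_binom t n + real n * t ^ n) \<le> y\<^sup>2 * (I + real n + C)"
    unfolding y(3) by (simp add: algebra_simps power2_eq_square)
  then have "trunc_binom t n + real n * t ^ n \<le> I + real n + C" using y by simp
  then show ?thesis
    unfolding I using I C_nonneg t trunc_binom_nonneg[of t n]
    by (simp flip: ennreal_plus add: ennreal_leI)
qed

text \<open>The chain jumps from 1 to v in one step with positive probability, so the mean progeny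
  of v enters that of 1 with a positive weight.\<close>

lemma mean_progeny_reach:
  assumes "mean_progeny 1 < \<infinity>" "M \<le> v"
  shows "mean_progeny v < \<infinity>"
proof -
  have "mean_progeny v * ennreal (pmf (K 1) v) = (\<integral>\<^sup>+m. mean_progeny m * indicator {v} m \<partial>K 1)"
    by (simp add: nn_integral_indicator_singleton emeasure_pmf_single)
  also have "\<dots> \<le> (\<integral>\<^sup>+m. mean_progeny m \<partial>K 1)"
    by (intro nn_integral_mono) (auto simp: indicator_def)
  also have "\<dots> \<le> mean_progeny 1" by (subst (2) mean_progeny_first_step) simp
  also have "\<dots> < \<infinity>" by fact
  finally show ?thesis using pmf_1_pos[OF assms(2)]
    by (auto simp: ennreal_mult_less_top ennreal_eq_0_iff less_top)
qed

lemma eventually_quadratic_gt: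
  "\<exists>v>N. a + b * real v < real v * (real v - 1) / 2"
proof -
  have "eventually (\<lambda>v::nat. a + b * real v < real v * (real v - 1) / 2) sequentially"
    by real_asymp
  then obtain N' where "\<And>v. N' \<le> v \<Longrightarrow> a + b * real v < real v * (real v - 1) / 2"
    unfolding eventually_sequentially by blast
  then show ?thesis by (intro exI[of _ "max N' (Suc N)"]) auto
qed

text \<open>Under \<open>\<delta> < 0\<close> the linear Lyapunov function bounds the mean extinction time linearly, while
  a finite mean progeny forces it to be at least quadratic; under \<open>\<delta> \<ge> 0\<close> already the linear
  function is contradictory.\<close>

lemma mean_progeny_infinite_recurrent:
  assumes d: "-1 \<le> \<delta>" and ext: "\<And>v. M < v \<Longrightarrow> extinct v = 1"
  shows "mean_progeny 1 = \<infinity>"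
proof (rule ccontr)
  assume "mean_progeny 1 \<noteq> \<infinity>"
  then have fin1: "mean_progeny 1 < \<infinity>" by (simp add: less_top)
  obtain B where B: "0 \<le> B" "\<And>n. green n (\<lambda>m. indicator {1..M} m) \<le> ennreal B"
    using green_finite[of M] by blast
  define id' where "id' = (\<lambda>m. ennreal (real m))"
  define big :: "nat \<Rightarrow> ennreal" where "big = indicator {M<..}"
  define small :: "nat \<Rightarrow> ennreal" where "small = indicator {1..M}"
  have small: "green n small \<le> ennreal B" for n using B by (simp add: small_def)
  have fin: "green v (\<lambda>m. id' m * big m) < \<infinity>" if v: "M < v" for v
  proof -
    have "green v (\<lambda>m. id' m * big m) \<le> green v (\<lambda>m. of_nat m * extinct m)"
      by (intro green_mono) (auto simp: id'_def big_def indicator_def ext ennreal_of_nat_eq_real_of_nat)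
    also have "\<dots> < \<infinity>" using mean_progeny_reach[OF fin1, of v] v by (simp add: mean_progeny_eq_green)
    finally show ?thesis .
  qed
  show False
  proof (cases "0 \<le> \<delta>")
    case True
    \<comment> \<open>Above M the identity has nonnegative drift, so a finite Green function would
      force v \<le> M * B; v is chosen to violate this.\<close>
    define v where "v = Suc (max M (nat \<lceil>real M * B\<rceil>))"
    have v: "M < v" "real M * B < real v" unfolding v_def by linarith+
    have "id' v + green v (\<lambda>m. id' m * big m) \<le> id' v + green v (\<lambda>m. \<integral>\<^sup>+j. id' j \<partial>K m)"
    proof (intro add_left_mono green_mono)
      fix m show "id' m * big m \<le> (\<integral>\<^sup>+j. id' j \<partial>K m)"
        using True by (auto simp: big_def id'_def mean indicator_def intro!: ennreal_leI)
    qed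
    also have "\<dots> = green v id'" by (rule green_first_step[symmetric])
    also have "\<dots> \<le> green v (\<lambda>m. ennreal (real M) * small m + id' m * big m)"
      by (intro green_mono) (auto simp: id'_def big_def small_def indicator_def intro!: ennreal_leI)
    also have "\<dots> \<le> ennreal (real M * B) + green v (\<lambda>m. id' m * big m)"
      unfolding green_add green_cmult using small[of v] B
      by (intro add_right_mono) (simp add: ennreal_mult mult_left_mono)
    finally have "id' v \<le> ennreal (real M * B)"
      by (rule ennreal_add_right_cancel_leD[OF _ fin[OF v(1)]])
    then have "real v \<le> real M * B" unfolding id'_def using B by (subst (asm) ennreal_le_iff) auto
    then show False using v by simp
  next
    case False
    then have neg: "0 < - \<delta>" by simp
    obtain D where D: "0 \<le> D" "\<And>n. green n (\<lambda>m. ennreal (- \<delta>) * big m) \<le> id' n + ennreal D"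
    proof (rule green_lyapunov_finite[of M id' "\<lambda>m. ennreal (- \<delta>) * big m"])
      fix m assume "M < m"
      then show "(\<integral>\<^sup>+j. id' j \<partial>K m) + ennreal (- \<delta>) * big m \<le> id' m"
        using neg delta_bound by (simp add: id'_def big_def mean flip: ennreal_plus)
    next
      fix m show "(\<integral>\<^sup>+j. id' j \<partial>K m) + ennreal (- \<delta>) * big m < \<infinity>"
        using mean_moment_finite[of m] by (simp add: id'_def big_def indicator_def ennreal_mult_less_top)
    qed (auto simp: big_def)
    have big: "green n big \<le> ennreal ((real n + D) / (- \<delta>))" for n
    proof -
      have "ennreal (1 / (-\<delta>)) * (ennreal (-\<delta>) * green n big) \<le> ennreal (1 / (-\<delta>)) * (id' n + ennreal D)"
        using D(2)[of n] by (intro mult_left_mono) (auto simp: green_cmult)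
      moreover have "ennreal (1 / (-\<delta>)) * ennreal (-\<delta>) = 1"
        using neg by (subst ennreal_mult[symmetric]) auto
      moreover have "ennreal (1 / (-\<delta>)) * (id' n + ennreal D) = ennreal ((real n + D) / (- \<delta>))"
        unfolding id'_def using neg D by (subst ennreal_plus[symmetric], simp, simp, subst ennreal_mult[symmetric]) auto
      ultimately show ?thesis by (simp add: mult.assoc[symmetric])
    qed
    \<comment> \<open>The constant part of the final bound: visits to {1..M} cost at most M^2 each,
      and the loss C per step is charged to the mean time above M, at most (v + D) /
      (-\<delta>).\<close>
    define a where "a = (real M)\<^sup>2 * B + C * D / (- \<delta>)"
    obtain v where v: "M < v" "a + C / (-\<delta>) * real v < real v * (real v - 1) / 2"
      using eventually_quadratic_gt[of M a "C / (-\<delta>)"] by blast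
    \<comment> \<open>Any sequence in (0, 1) increasing to 1 serves; the cut-off is removed by
      monotone convergence.\<close>
    define t where "t i = 1 - 1 / (real i + 2)" for i :: nat
    have t: "0 < t i" "t i < 1" for i by (auto simp: t_def)
    have incseq_t: "incseq t" unfolding t_def by (intro incseq_SucI) (simp add: frac_le)
    have lim_t: "t \<longlonglongrightarrow> 1" unfolding t_def by real_asymp
    define F where "F i m = ennreal (real m * t i ^ m) * big m" for i m
    define E where "E = green v (\<lambda>m. id' m * big m)"
    have bound: "ennreal (trunc_binom (t i) v) + green v (F i) \<le> ennreal (a + C / (-\<delta>) * real v) + E" for i
    proof -
      define q where "q m = ennreal (trunc_binom (t i) m)" for m
      \<comment> \<open>For fixed t < 1 the truncation grows only linearly, so its Green function
        above M is finite by assumption and can be cancelled below. For the quadratic itself this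
        would not follow.\<close>
      have q_le: "trunc_binom (t i) m \<le> real m * (1 / (1 - t i))" for m
      proof -
        have "(1 - t i) * ((1 - t i) * trunc_binom (t i) m) \<le> (1 - t i) * real m"
          using trunc_binom_eq[of "t i" m] power_le_one[of "t i" m] t[of i]
          unfolding power2_eq_square mult.assoc by linarith
        then have "(1 - t i) * trunc_binom (t i) m \<le> real m"
          using t[of i] by (subst (asm) mult_le_cancel_left_pos) auto
        then show ?thesis using t[of i] by (simp add: pos_le_divide_eq mult.commute)
      qed
      have "green v (\<lambda>m. q m * big m) \<le> green v (\<lambda>m. ennreal (1 / (1 - t i)) * (id' m * big m))"
        using q_le t[of i]
        by (intro green_mono) (auto simp: q_def id'_def big_def indicator_def intro!: ennreal_leI
            simp flip: ennreal_mult simp: mult.commute)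
      also have "\<dots> < \<infinity>" using fin[OF v(1)] by (simp add: green_cmult ennreal_mult_less_top)
      finally have q_fin: "green v (\<lambda>m. q m * big m) < \<infinity>" .
      have "green v (\<lambda>m. q m * big m) + (q v + green v (F i))
         = q v + green v (\<lambda>m. q m * big m + F i m)" by (simp add: green_add ac_simps)
      also have "\<dots> \<le> q v + green v (\<lambda>m. (\<integral>\<^sup>+j. q j \<partial>K m) + (id' m * big m + ennreal C * big m))"
      proof (intro add_left_mono green_mono)
        fix m show "q m * big m + F i m \<le> (\<integral>\<^sup>+j. q j \<partial>K m) + (id' m * big m + ennreal C * big m)"
          using trunc_binom_drift[of m "t i"] t[of i] d C_nonneg
          by (cases "M < m") (auto simp: q_def F_def big_def id'_def)
      qed
      also have "\<dots> = green v q + (E + ennreal C * green v big)"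
        unfolding E_def by (subst (2) green_first_step) (simp add: green_add green_cmult ac_simps)
      also have "\<dots> \<le> green v (\<lambda>m. ennreal ((real M)\<^sup>2) * small m + q m * big m) + (E + ennreal C * green v big)"
      proof (intro add_right_mono green_mono)
        fix m
        have "trunc_binom (t i) m \<le> (real M)\<^sup>2" if "m \<le> M"
          using order_trans[OF trunc_binom_le[of "t i" m] power_mono[of "real m" "real M" 2]] t[of i] that by simp
        moreover have "trunc_binom (t i) 0 = 0" by (simp add: trunc_binom_def)
        ultimately show "q m \<le> ennreal ((real M)\<^sup>2) * small m + q m * big m"
          by (cases "m = 0") (auto simp: q_def small_def big_def indicator_def intro: ennreal_leI)
      qed
      also have "\<dots> \<le> ennreal ((real M)\<^sup>2) * ennreal B + green v (\<lambda>m. q m * big m)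
          + (E + ennreal C * ennreal ((real v + D) / (- \<delta>)))"
        unfolding green_add green_cmult
        by (intro add_mono mult_left_mono small big order_refl) auto
      also have "\<dots> = green v (\<lambda>m. q m * big m) + (ennreal (a + C / (-\<delta>) * real v) + E)"
      proof -
        have "ennreal (a + C / (-\<delta>) * real v) = ennreal ((real M)\<^sup>2) * ennreal B + ennreal C * ennreal ((real v + D) / (- \<delta>))"
        proof -
          define w where "w = (real v + D) / (- \<delta>)"
          have "0 \<le> w" unfolding w_def using D neg by (intro divide_nonneg_pos) auto
          moreover have "a + C / (-\<delta>) * real v = (real M)\<^sup>2 * B + C * w"
            using neg unfolding a_def w_def by (simp add: field_simps)
          ultimately show ?thesis using B C_nonneg unfolding w_def[symmetric] by (simp add: ennreal_mult)
        qed
        then show ?thesis by (simp add: ac_simps)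
      qed
      finally show ?thesis unfolding q_def[of v, symmetric] by (rule ennreal_add_cancel_leD[OF _ q_fin])
    qed
    have "incseq F"
      unfolding incseq_def le_fun_def
    proof (intro allI impI)
      fix i j :: nat and m assume "i \<le> j"
      then have "t i ^ m \<le> t j ^ m" using t[of i] incseq_t by (intro power_mono) (auto simp: incseq_def)
      then show "F i m \<le> F j m" unfolding F_def by (intro mult_right_mono ennreal_leI mult_left_mono) auto
    qed
    \<comment> \<open>As t -> 1 the gain n t^n increases to n, so its Green function tends to the
      same E that appears as a loss, and E cancels.\<close>
    have SUP_F: "(SUP i. F i m) = id' m * big m" for m
    proof -
      have "(\<lambda>i. F i m) \<longlonglongrightarrow> ennreal (real m * 1 ^ m) * big m"
        unfolding F_def by (intro tendsto_mult_ennreal tendsto_ennrealI tendsto_intros lim_t)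
          (auto simp: big_def indicator_def)
      moreover have "(\<lambda>i. F i m) \<longlonglongrightarrow> (SUP i. F i m)"
        using \<open>incseq F\<close> by (intro LIMSEQ_SUP) (auto simp: incseq_def le_fun_def)
      ultimately show ?thesis using LIMSEQ_unique by (fastforce simp: id'_def)
    qed
    have "(\<lambda>i. green v (F i)) \<longlonglongrightarrow> (SUP i. green v (F i))"
      using \<open>incseq F\<close> by (intro LIMSEQ_SUP) (auto simp: incseq_def le_fun_def intro!: green_mono)
    also have "(SUP i. green v (F i)) = E"
      unfolding E_def green_SUP[OF \<open>incseq F\<close>, symmetric] SUP_F ..
    finally have lim_F: "(\<lambda>i. green v (F i)) \<longlonglongrightarrow> E" .
    have "(\<lambda>i. ennreal (t i ^ v * (real v * (real v - 1) / 2)) + green v (F i))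
        \<longlonglongrightarrow> ennreal (1 ^ v * (real v * (real v - 1) / 2)) + E"
      by (intro tendsto_add tendsto_ennrealI tendsto_mult tendsto_power lim_t lim_F tendsto_const)
    then have "ennreal (1 ^ v * (real v * (real v - 1) / 2)) + E \<le> ennreal (a + C / (-\<delta>) * real v) + E"
    proof (rule LIMSEQ_le_const2, intro exI allI impI)
      fix i
      have "ennreal (t i ^ v * (real v * (real v - 1) / 2)) + green v (F i) \<le> ennreal (trunc_binom (t i) v) + green v (F i)"
        using t[of i] by (intro add_right_mono ennreal_leI trunc_binom_ge) auto
      then show "ennreal (t i ^ v * (real v * (real v - 1) / 2)) + green v (F i) \<le> ennreal (a + C / (-\<delta>) * real v) + E"
        using bound[of i] by (rule order_trans)
    qed
    then have "ennreal (real v * (real v - 1) / 2) \<le> ennreal (a + C / (-\<delta>) * real v)"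
      unfolding power_one mult_1 by (rule ennreal_add_right_cancel_leD[OF _ fin[OF v(1), folded E_def]])
    moreover have "0 \<le> a + C / (-\<delta>) * real v"
      using B D C_nonneg neg unfolding a_def by (intro add_nonneg_nonneg mult_nonneg_nonneg divide_nonneg_pos) auto
    ultimately show False using v by (simp add: ennreal_le_iff)
  qed
qed

subsection \<open>Mixtures of geometric test functions\<close>

text \<open>The points \<open>1 - 1/x\<close> are permuted by the Moebius map \<open>t \<mapsto> 1 / (2 - t)\<close> of the generating
  function: \<open>x\<close> is moved to \<open>x + 1\<close>. Hence the kernel acts on the mixtures below by shifting the
  weights and multiplying them by \<open>G (1/x) = 1 - \<delta>/x + O(1/x\<^sup>2)\<close>.\<close>

definition mix :: "(nat \<Rightarrow> real) \<Rightarrow> nat \<Rightarrow> nat \<Rightarrow> ennreal" where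
  "mix w x0 n = (\<Sum>i. ennreal (w (i + x0) * (1 - 1 / real (i + x0)) ^ n))"

lemma nn_integral_mix:
  assumes "M < n" "1 \<le> x0" and w: "\<And>x. x0 \<le> x \<Longrightarrow> 0 \<le> w x"
  shows "(\<integral>\<^sup>+m. mix w x0 m \<partial>K n)
    = (\<Sum>i. ennreal (w (i + x0) * G (1 / real (i + x0)) * (1 - 1 / real (i + x0 + 1)) ^ n))"
proof -
  have "(\<integral>\<^sup>+m. mix w x0 m \<partial>K n)
      = (\<Sum>i. \<integral>\<^sup>+m. ennreal (w (i + x0)) * ennreal ((1 - 1 / real (i + x0)) ^ m) \<partial>K n)"
    unfolding mix_def using assms by (subst nn_integral_suminf) (auto simp: ennreal_mult)
  also have "\<dots> = (\<Sum>i. ennreal (w (i + x0) * G (1 / real (i + x0)) * (1 - 1 / real (i + x0 + 1)) ^ n))"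
  proof (intro suminf_cong)
    fix i
    define x where "x = real (i + x0)"
    have x: "1 \<le> x" using assms(2) by (simp add: x_def)
    have "(\<integral>\<^sup>+m. ennreal (w (i + x0)) * ennreal ((1 - 1 / x) ^ m) \<partial>K n)
        = ennreal (w (i + x0)) * ennreal (G (1 / x) / (1 + 1 / x) ^ n)"
      using x pgf[OF assms(1), of "1 - 1 / x"] by (simp add: nn_integral_cmult)
    also have "1 + 1 / x = 1 / (1 - 1 / (x + 1))" using x by (simp add: field_simps)
    also have "G (1 / x) / (1 / (1 - 1 / (x + 1))) ^ n = G (1 / x) * (1 - 1 / (x + 1)) ^ n"
      by (simp add: power_one_over)
    finally show "(\<integral>\<^sup>+m. ennreal (w (i + x0)) * ennreal ((1 - 1 / real (i + x0)) ^ m) \<partial>K n)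
        = ennreal (w (i + x0) * G (1 / real (i + x0)) * (1 - 1 / real (i + x0 + 1)) ^ n)"
      using w[of "i + x0"] G_nonneg[of "1 / x"] x
      by (simp add: x_def mult.assoc add.commute flip: ennreal_mult)
  qed
  finally show ?thesis .
qed

lemma mix_antimono:
  assumes "1 \<le> x0" "\<And>x. x0 \<le> x \<Longrightarrow> 0 \<le> w x" "m \<le> n"
  shows "mix w x0 n \<le> mix w x0 m"
  unfolding mix_def using assms
  by (intro suminf_le ennreal_leI mult_left_mono power_decreasing) auto

lemma mix_Suc: "mix w x0 n = ennreal (w x0 * (1 - 1 / real x0) ^ n) + mix w (Suc x0) n"
  unfolding mix_def by (subst suminf_offset[of _ 1]) (auto simp: add.commute)

lemma G_inverse_bounds:
  assumes "1 \<le> x"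
  shows "G (1 / x) \<le> 1 - \<delta> / x + C / x\<^sup>2" "1 - \<delta> / x - C / x\<^sup>2 \<le> G (1 / x)" "0 \<le> G (1 / x)"
  using G_expansion[of "1 / x"] G_nonneg[of "1 / x"] assms by (auto simp: power_divide abs_le_iff)

lemma powr_step:
  fixes x s :: real
  assumes "1 \<le> x" "0 < s"
  shows "x powr (-s) * (1 - s / x) \<le> (x + 1) powr (-s)"
proof -
  have "1 - s / x \<le> 1 - s * ln (1 + 1 / x)"
    using assms ln_add_one_self_le_self[of "1 / x"] mult_left_mono[of "ln (1 + 1 / x)" "1 / x" s] by simp
  also have "\<dots> \<le> exp (- s * ln (1 + 1 / x))"
    using exp_ge_add_one_self[of "- s * ln (1 + 1 / x)"] by simp
  also have "\<dots> = (1 + 1 / x) powr (-s)" using assms add_pos_nonneg[of 1 "1 / x"] by (simp add: powr_def)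
  finally have "x powr (-s) * (1 - s / x) \<le> x powr (-s) * (1 + 1 / x) powr (-s)"
    by (intro mult_left_mono) auto
  also have "\<dots> = (x * (1 + 1 / x)) powr (-s)" using assms by (subst powr_mult) auto
  also have "x * (1 + 1 / x) = x + 1" using assms by (simp add: field_simps)
  finally show ?thesis .
qed

text \<open>The margin 2 \<epsilon> is spent in halves: one \<epsilon> / x absorbs the error C /
  x^2, the other remains as the strict gain.\<close>

lemma powr_weight_decreases:
  assumes "1 \<le> x" "0 < r" "0 < \<epsilon>" "r + 2 * \<epsilon> \<le> \<delta>" "C \<le> \<epsilon> * x"
  shows "x powr (-r) * G (1 / x) + \<epsilon> * x powr (- r - 1) \<le> (x + 1) powr (-r)"
proof -
  have "C / x\<^sup>2 \<le> \<epsilon> / x" using assms by (simp add: field_simps power2_eq_square)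
  moreover have "(r + 2 * \<epsilon>) / x \<le> \<delta> / x" using assms by (intro divide_right_mono) auto
  ultimately have "G (1 / x) + \<epsilon> / x \<le> 1 - r / x"
    using G_inverse_bounds(1)[OF assms(1)] by (simp add: add_divide_distrib)
  then have "x powr (-r) * (G (1 / x) + \<epsilon> / x) \<le> x powr (-r) * (1 - r / x)"
    by (intro mult_left_mono) auto
  also have "\<dots> \<le> (x + 1) powr (-r)" using assms by (intro powr_step) auto
  finally show ?thesis using assms by (simp add: powr_diff distrib_left mult.commute)
qed

text \<open>For r > 1 the mixture is of order n^(1 - r) and the gain of order n^(-r), in line with
  the generator, which sends v^(1 - r) to (1 - r) (\<delta> - r) v^(-r). The shift also loses the
  term at x0, which helps in this direction.\<close>

lemma mix_powr_drift:
  assumes "M < n" "1 \<le> x0" "0 < r" "0 < \<epsilon>" "r + 2 * \<epsilon> \<le> \<delta>" "C \<le> \<epsilon> * real x0"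
  shows "(\<integral>\<^sup>+m. mix (\<lambda>x. real x powr (-r)) x0 m \<partial>K n)
      + ennreal \<epsilon> * (\<Sum>i. ennreal (real (i + x0) powr (- r - 1) * (1 - 1 / real (i + x0 + 1)) ^ n))
    \<le> mix (\<lambda>x. real x powr (-r)) x0 n"
proof -
  have "(\<integral>\<^sup>+m. mix (\<lambda>x. real x powr (-r)) x0 m \<partial>K n)
      + ennreal \<epsilon> * (\<Sum>i. ennreal (real (i + x0) powr (- r - 1) * (1 - 1 / real (i + x0 + 1)) ^ n))
    = (\<Sum>i. ennreal (real (i + x0) powr (-r) * G (1 / real (i + x0)) * (1 - 1 / real (i + x0 + 1)) ^ n)
        + ennreal \<epsilon> * ennreal (real (i + x0) powr (- r - 1) * (1 - 1 / real (i + x0 + 1)) ^ n))"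
    using assms by (subst nn_integral_mix) (auto simp: suminf_add[symmetric])
  also have "\<dots> \<le> mix (\<lambda>x. real x powr (-r)) (Suc x0) n"
    unfolding mix_def
  proof (intro suminf_le)
    fix i
    define x where "x = real (i + x0)"
    have x: "1 \<le> x" "C \<le> \<epsilon> * x"
      using assms order_trans[OF assms(6), of "\<epsilon> * x"] by (auto simp: x_def)
    have "(x powr (-r) * G (1 / x) + \<epsilon> * x powr (- r - 1)) * (1 - 1 / (x + 1)) ^ n
        \<le> (x + 1) powr (-r) * (1 - 1 / (x + 1)) ^ n"
      using x assms by (intro mult_right_mono powr_weight_decreases zero_le_power) auto
    then show "ennreal (real (i + x0) powr (-r) * G (1 / real (i + x0)) * (1 - 1 / real (i + x0 + 1)) ^ n)
        + ennreal \<epsilon> * ennreal (real (i + x0) powr (- r - 1) * (1 - 1 / real (i + x0 + 1)) ^ n)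
      \<le> ennreal (real (i + Suc x0) powr (-r) * (1 - 1 / real (i + Suc x0)) ^ n)"
      using x assms G_inverse_bounds(3)[of x]
      by (simp add: x_def algebra_simps ennreal_leI flip: ennreal_mult ennreal_plus)
  qed auto
  also have "\<dots> \<le> mix (\<lambda>x. real x powr (-r)) x0 n" by (subst (2) mix_Suc) simp
  finally show ?thesis .
qed

lemma mix_powr_finite:
  assumes "1 < r" "1 \<le> x0"
  shows "mix (\<lambda>x. real x powr (-r)) x0 n < \<infinity>"
proof -
  have "mix (\<lambda>x. real x powr (-r)) x0 n \<le> mix (\<lambda>x. real x powr (-r)) x0 0"
    using assms by (intro mix_antimono) auto
  also have "\<dots> = ennreal (\<Sum>i. real (i + x0) powr (-r))"
    unfolding mix_def using assms summable_real_powr_iff[of "-r"]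
    by (simp add: suminf_ennreal2 summable_iff_shift[of "\<lambda>i. real i powr (-r)"] del: of_nat_add)
  finally show ?thesis by (auto intro: le_less_trans)
qed

lemma power_diff_ge:
  fixes a b :: real
  assumes "0 \<le> b" "b \<le> a" "a \<le> 1"
  shows "real n * b ^ n * (a - b) \<le> a ^ n - b ^ n"
proof (induction n)
  case (Suc n)
  have "real (Suc n) * b ^ Suc n * (a - b) = b * (real n * b ^ n * (a - b)) + b * (b ^ n * (a - b))"
    by (simp add: algebra_simps)
  also have "\<dots> \<le> a * (a ^ n - b ^ n) + 1 * (b ^ n * (a - b))"
  proof (intro add_mono mult_right_mono)
    have "b * (real n * b ^ n * (a - b)) \<le> a * (real n * b ^ n * (a - b))"
      using assms by (intro mult_right_mono) auto
    also have "\<dots> \<le> a * (a ^ n - b ^ n)" using assms Suc by (intro mult_left_mono) auto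
    finally show "b * (real n * b ^ n * (a - b)) \<le> a * (a ^ n - b ^ n)" .
  qed (use assms in auto)
  finally show ?case by (simp add: algebra_simps)
qed simp

text \<open>Summation by parts in \<open>x\<close>.\<close>

lemma mix_powr_times_n:
  assumes "1 < s" "1 \<le> x0"
  shows "of_nat n * mix (\<lambda>x. real x powr (- s - 2)) x0 n
    \<le> ennreal (2 * s) * (\<Sum>i. ennreal (real (i + x0) powr (- s - 1) * (1 - 1 / real (i + x0 + 1)) ^ n))"
    (is "_ \<le> _ * ?D")
proof -
  let ?F = "mix (\<lambda>x. real x powr (-s)) x0 n"
  have "2 * ?F + of_nat n * mix (\<lambda>x. real x powr (- s - 2)) x0 n
     = (\<Sum>i. 2 * ennreal (real (i + x0) powr (-s) * (1 - 1 / real (i + x0)) ^ n)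
         + of_nat n * ennreal (real (i + x0) powr (- s - 2) * (1 - 1 / real (i + x0)) ^ n))"
    unfolding mix_def by (simp add: suminf_add[symmetric])
  also have "\<dots> \<le> (\<Sum>i. 2 * ennreal (real (i + Suc x0) powr (-s) * (1 - 1 / real (i + Suc x0)) ^ n)
         + ennreal (2 * s) * ennreal (real (i + x0) powr (- s - 1) * (1 - 1 / real (i + x0 + 1)) ^ n))"
  proof (intro suminf_le)
    fix i
    define x where "x = real (i + x0)"
    have x: "1 \<le> x" using assms by (auto simp: x_def)
    define a where "a = 1 - 1 / (x + 1)"
    define b where "b = 1 - 1 / x"
    have ab: "0 \<le> b" "b \<le> a" "a \<le> 1" using x by (auto simp: a_def b_def frac_le)
    \<comment> \<open>Consecutive points differ by at least 1 / (2 x^2). So n b^n is at most 2 x^2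
      times the increment of the n-th powers, which turns a factor n into a difference in x at the
      price of two powers of x.\<close>
    have "a - b = 1 / (x * (x + 1))" using x by (simp add: a_def b_def field_simps)
    then have "2 * x\<^sup>2 * (a - b) = 2 * x / (x + 1)" using x by (simp add: power2_eq_square)
    then have "1 \<le> 2 * x\<^sup>2 * (a - b)" using x by simp
    then have "real n * b ^ n * 1 \<le> real n * b ^ n * (2 * x\<^sup>2 * (a - b))"
      using ab by (intro mult_left_mono) auto
    also have "\<dots> \<le> 2 * x\<^sup>2 * (a ^ n - b ^ n)"
      using mult_left_mono[OF power_diff_ge[OF ab, of n], of "2 * x\<^sup>2"] by (simp add: algebra_simps)
    finally have "x powr (- s - 2) * (real n * b ^ n) \<le> x powr (- s - 2) * (2 * x\<^sup>2 * (a ^ n - b ^ n))"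
      by (intro mult_left_mono) auto
    also have "\<dots> = 2 * x powr (-s) * (a ^ n - b ^ n)" using x by (simp add: powr_diff powr_numeral)
    finally have 1: "2 * x powr (-s) * b ^ n + real n * (x powr (- s - 2) * b ^ n) \<le> 2 * x powr (-s) * a ^ n"
      by (simp add: algebra_simps)
    have "x powr (-s) * (1 - s / x) * a ^ n \<le> (x + 1) powr (-s) * a ^ n"
      using powr_step[of x s] x assms ab by (intro mult_right_mono) auto
    then have "x powr (-s) * a ^ n \<le> (x + 1) powr (-s) * a ^ n + s * (x powr (-s - 1) * a ^ n)"
      using x by (simp add: powr_diff algebra_simps)
    with 1 have 2: "2 * (x powr (-s) * b ^ n) + real n * (x powr (- s - 2) * b ^ n)
        \<le> 2 * ((x + 1) powr (-s) * a ^ n) + 2 * s * (x powr (-s - 1) * a ^ n)"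
      by simp
    have "2 * ennreal (x powr (-s) * b ^ n) + of_nat n * ennreal (x powr (- s - 2) * b ^ n)
        = ennreal (2 * (x powr (-s) * b ^ n) + real n * (x powr (- s - 2) * b ^ n))"
      using ab by (simp add: ennreal_mult ennreal_of_nat_eq_real_of_nat)
    also have "\<dots> \<le> ennreal (2 * ((x + 1) powr (-s) * a ^ n) + 2 * s * (x powr (-s - 1) * a ^ n))"
      by (rule ennreal_leI[OF 2])
    also have "\<dots> = 2 * ennreal ((x + 1) powr (-s) * a ^ n) + ennreal (2 * s) * ennreal (x powr (-s - 1) * a ^ n)"
      using ab assms by (simp add: ennreal_mult)
    finally show "2 * ennreal (real (i + x0) powr (-s) * (1 - 1 / real (i + x0)) ^ n)
         + of_nat n * ennreal (real (i + x0) powr (- s - 2) * (1 - 1 / real (i + x0)) ^ n)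
       \<le> 2 * ennreal (real (i + Suc x0) powr (-s) * (1 - 1 / real (i + Suc x0)) ^ n)
         + ennreal (2 * s) * ennreal (real (i + x0) powr (- s - 1) * (1 - 1 / real (i + x0 + 1)) ^ n)"
      by (simp add: a_def b_def x_def add.commute)
  qed auto
  also have "\<dots> = 2 * mix (\<lambda>x. real x powr (-s)) (Suc x0) n + ennreal (2 * s) * ?D"
    unfolding mix_def by (simp add: suminf_add[symmetric])
  also have "\<dots> \<le> 2 * ?F + ennreal (2 * s) * ?D"
    by (subst (2) mix_Suc) (simp add: distrib_left)
  finally show ?thesis
    by (rule ennreal_add_cancel_leD) (use mix_powr_finite[OF assms, of n] in \<open>simp add: ennreal_mult_less_top\<close>)
qed

lemma mean_progeny_finite_high:
  assumes "3 < \<delta>"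
  shows "mean_progeny n < \<infinity>"
proof -
  \<comment> \<open>The exponent s > 1 makes F finite, and s + 2 + 2 \<epsilon> = \<delta> lets the
    drift bound apply to exponent s + 2 as well. Then H, of order n^(-1-s), bounds the extinction
    probability, and n H is of the order n^(-s) of the drift of F.\<close>
  define \<epsilon> where "\<epsilon> = (\<delta> - 3) / 4"
  define s where "s = 1 + 2 * \<epsilon>"
  have \<epsilon>: "0 < \<epsilon>" "1 < s" "s + 2 + 2 * \<epsilon> \<le> \<delta>" using assms by (auto simp: \<epsilon>_def s_def field_simps)
  define x0 where "x0 = max 2 (nat \<lceil>C / \<epsilon>\<rceil>)"
  have x0: "2 \<le> x0" "C / \<epsilon> \<le> real x0" unfolding x0_def by linarith+
  have C: "C \<le> \<epsilon> * real x0" using x0 \<epsilon> by (simp add: field_simps)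
  define D where "D m = (\<Sum>i. ennreal (real (i + x0) powr (- s - 1) * (1 - 1 / real (i + x0 + 1)) ^ m))" for m
  define F where "F = mix (\<lambda>x. real x powr (-s)) x0"
  define H where "H = mix (\<lambda>x. real x powr (- (s + 2))) x0"
  have H_eq: "H = mix (\<lambda>x. real x powr (- s - 2)) x0" by (simp add: H_def)
  have F_fin: "F m < \<infinity>" for m unfolding F_def using \<epsilon> x0 by (intro mix_powr_finite) auto
  have H_fin: "H m < \<infinity>" for m
    unfolding H_def using \<epsilon> x0 by (intro mix_powr_finite) auto
  have F_drift: "(\<integral>\<^sup>+j. F j \<partial>K m) + ennreal \<epsilon> * D m \<le> F m" if "M < m" for m
    unfolding F_def D_def using that \<epsilon> x0 C by (intro mix_powr_drift) auto
  have H_drift: "(\<integral>\<^sup>+j. H j \<partial>K m) \<le> H m" if "M < m" for m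
    unfolding H_def
    by (rule order_trans[OF _ mix_powr_drift[of m x0 "s + 2" \<epsilon>]]) (use that \<epsilon> x0 C in auto)
  have H_anti: "i \<le> j \<Longrightarrow> H j \<le> H i" for i j
    unfolding H_def using x0 by (intro mix_antimono) auto
  obtain f0 where f0: "H M = ennreal f0" "0 \<le> f0" using H_fin[of M] by (cases "H M") auto
  have "0 < real x0 powr (- (s + 2)) * (1 - 1 / real x0) ^ M" using x0 by simp
  then have "0 < H M" unfolding H_def by (subst mix_Suc) (simp add: add_pos_nonneg)
  then have f0_pos: "0 < f0" using f0 by simp
  have ext: "extinct m \<le> ennreal (1 / f0) * H m" for m
  proof -
    \<comment> \<open>The drift of H is known only above M. Since H decreases and is normalised by
      its value at M, the minimum with 1 is constant on {0..M}, where superharmonicity becomes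
      trivial.\<close>
    define \<phi> where "\<phi> m = min 1 (ennreal (1 / f0) * H m)" for m
    have \<phi>_1: "\<phi> m = 1" if "m \<le> M" for m
    proof -
      have "1 = ennreal (1 / f0) * H M" using f0 f0_pos by (simp flip: ennreal_mult)
      also have "\<dots> \<le> ennreal (1 / f0) * H m" using H_anti[OF that] by (intro mult_left_mono) auto
      finally show ?thesis by (simp add: \<phi>_def)
    qed
    have "extinct m \<le> \<phi> m"
    proof (rule extinct_le)
      show "1 \<le> \<phi> 0" using \<phi>_1[of 0] by simp
      fix j :: nat
      have le1: "(\<integral>\<^sup>+i. \<phi> i \<partial>K j) \<le> (\<integral>\<^sup>+i. 1 \<partial>K j)" by (intro nn_integral_mono) (simp add: \<phi>_def)
      show "(\<integral>\<^sup>+i. \<phi> i \<partial>K j) \<le> \<phi> j"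
      proof (cases "j \<le> M")
        case False
        have "(\<integral>\<^sup>+i. \<phi> i \<partial>K j) \<le> (\<integral>\<^sup>+i. ennreal (1 / f0) * H i \<partial>K j)"
          by (intro nn_integral_mono) (simp add: \<phi>_def)
        also have "\<dots> \<le> ennreal (1 / f0) * H j"
          using H_drift[of j] False by (simp add: nn_integral_cmult mult_left_mono)
        finally show ?thesis using le1 by (simp add: \<phi>_def)
      qed (use le1 \<phi>_1 in simp)
    qed
    then show ?thesis by (simp add: \<phi>_def)
  qed
  define A where "A = 2 * s / (\<epsilon> * f0)"
  have A: "0 \<le> A" using \<epsilon> f0_pos by (simp add: A_def)
  obtain B where B: "0 \<le> B" "\<And>n. green n (\<lambda>m. of_nat m * extinct m) \<le> ennreal A * F n + ennreal B"
  proof (rule green_lyapunov_finite[of M "\<lambda>m. ennreal A * F m" "\<lambda>m. of_nat m * extinct m"])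
    fix m assume m: "M < m"
    have "of_nat m * extinct m \<le> of_nat m * (ennreal (1 / f0) * H m)"
      by (intro mult_left_mono ext) auto
    also have "\<dots> = ennreal (1 / f0) * (of_nat m * H m)" by (simp add: ac_simps)
    also have "\<dots> \<le> ennreal (1 / f0) * (ennreal (2 * s) * D m)"
      unfolding H_eq D_def using \<epsilon> x0 by (intro mult_left_mono mix_powr_times_n) auto
    also have "\<dots> = ennreal A * (ennreal \<epsilon> * D m)"
    proof -
      have "ennreal (1 / f0) * ennreal (2 * s) = ennreal A * ennreal \<epsilon>"
        using \<epsilon> f0_pos A by (simp add: A_def flip: ennreal_mult)
      then show ?thesis by (simp flip: mult.assoc)
    qed
    finally have "(\<integral>\<^sup>+j. ennreal A * F j \<partial>K m) + of_nat m * extinct m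
       \<le> ennreal A * ((\<integral>\<^sup>+j. F j \<partial>K m) + ennreal \<epsilon> * D m)"
      by (simp add: nn_integral_cmult distrib_left)
    also have "\<dots> \<le> ennreal A * F m" by (intro mult_left_mono F_drift m) auto
    finally show "(\<integral>\<^sup>+j. ennreal A * F j \<partial>K m) + of_nat m * extinct m \<le> ennreal A * F m" .
  next
    fix m
    have "(\<integral>\<^sup>+j. F j \<partial>K m) \<le> (\<integral>\<^sup>+j. F 0 \<partial>K m)"
      unfolding F_def using x0 by (intro nn_integral_mono mix_antimono) auto
    then have "(\<integral>\<^sup>+j. F j \<partial>K m) < \<infinity>" using F_fin[of 0] by (auto intro: le_less_trans)
    moreover have "of_nat m * extinct m \<le> of_nat m * 1" by (intro mult_left_mono extinct_le_1) auto
    then have "of_nat m * extinct m < \<infinity>" by (rule le_less_trans) (simp add: ennreal_of_nat_eq_real_of_nat)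
    ultimately show "(\<integral>\<^sup>+j. ennreal A * F j \<partial>K m) + of_nat m * extinct m < \<infinity>"
      by (simp add: nn_integral_cmult ennreal_mult_less_top)
  qed auto
  have "mean_progeny n \<le> ennreal A * F n + ennreal B" using B(2) by (simp add: mean_progeny_eq_green)
  also have "\<dots> < \<infinity>" using F_fin[of n] by (simp add: ennreal_mult_less_top)
  finally show ?thesis .
qed

subsection \<open>Infinite mean when survival is possible\<close>

text \<open>At the critical \<delta> = 3 the weight x^(-3) is balanced to first order, and the error
  C / x^2 could decide the sign. With u = x - b, the shift gains 3/u - 3/x = 3 b / (u x), and b = 2
  C + 4 makes this outweigh the error and the cross term 9 / (u x).\<close>

lemma cubic_weight_increases:
  fixes x b :: real
  assumes "\<delta> \<le> 3" "b = 2 * C + 4" "b + 1 \<le> x"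
  shows "1 / (x + 1 - b) ^ 3 < 1 / (x - b) ^ 3 * G (1 / x)"
proof -
  define u where "u = x - b"
  have u: "1 \<le> u" "x = u + b" using assms by (auto simp: u_def)
  have x: "C + 4 \<le> x" "1 \<le> x" using assms C_nonneg by auto
  have "(C + 4) * x \<le> x * x" using x by (intro mult_right_mono) auto
  then have "3 * x + C \<le> x * x" using x C_nonneg mult_left_mono[of 1 x C] by (simp add: algebra_simps)
  have quot: "1 - 3 / x - C / x\<^sup>2 = (x\<^sup>2 - 3 * x - C) / x\<^sup>2"
    using x by (simp add: diff_divide_distrib power2_eq_square)
  have g0: "0 \<le> 1 - 3 / x - C / x\<^sup>2"
    unfolding quot using \<open>3 * x + C \<le> x * x\<close> by (intro divide_nonneg_nonneg) (auto simp: power2_eq_square)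
  have "1 - 3 / x - C / x\<^sup>2 \<le> 1 - \<delta> / x - C / x\<^sup>2"
    using assms x by (simp add: divide_right_mono)
  also have "\<dots> \<le> G (1 / x)" by (rule G_inverse_bounds) fact
  finally have G: "1 - 3 / x - C / x\<^sup>2 \<le> G (1 / x)" .
  have "(u + 3) * (x\<^sup>2 - 3 * x - C) - u * x\<^sup>2 = 3 * b * x - 9 * x - 3 * C - C * u"
    by (simp add: u(2) power2_eq_square algebra_simps)
  also have "\<dots> = (6 * C + 3) * x - 3 * C - C * u" using assms by (simp add: algebra_simps)
  also have "\<dots> > 0"
  proof -
    have "C * u \<le> C * x" using u assms C_nonneg by (intro mult_left_mono) auto
    moreover have "C * 1 \<le> C * x" using C_nonneg x by (intro mult_left_mono) auto
    moreover have "(6 * C + 3) * x = 6 * (C * x) + 3 * x" by (simp add: algebra_simps)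
    ultimately show ?thesis using x C_nonneg by linarith
  qed
  finally have "u * x\<^sup>2 < (u + 3) * (x\<^sup>2 - 3 * x - C)" by simp
  then have "1 < ((u + 3) * (x\<^sup>2 - 3 * x - C)) / (u * x\<^sup>2)" using u x by simp
  also have "\<dots> = (1 + 3 / u) * (1 - 3 / x - C / x\<^sup>2)"
    unfolding quot using u(1) by (simp add: add_divide_distrib distrib_right)
  finally have "1 < (1 + 3 / u) * (1 - 3 / x - C / x\<^sup>2)" .
  also have "\<dots> \<le> (1 + 1 / u) ^ 3 * (1 - 3 / x - C / x\<^sup>2)"
    using g0 Bernoulli_inequality[of "1 / u" 3] order_trans[of "-1" 0 "1 / u"] u(1)
    by (intro mult_right_mono) auto
  also have "\<dots> \<le> (1 + 1 / u) ^ 3 * G (1 / x)"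
    using G u by (intro mult_left_mono) auto
  also have "(1 + 1 / u) = (u + 1) / u" using u by (simp add: field_simps)
  finally have "1 < (u + 1) ^ 3 / u ^ 3 * G (1 / x)" by (simp add: power_divide)
  then have "1 / (u + 1) ^ 3 < 1 / u ^ 3 * G (1 / x)" using u by (simp add: field_simps)
  then show ?thesis by (simp add: u_def algebra_simps)
qed

text \<open>Of the sum only 2 N \<le> x < 4 N is used, with N > n: there (1 - 1/x)^n \<ge> 1/2 and
  the weight is at least 1 / (64 N^3). These 2 N terms give order N^(-2).\<close>

lemma mix_cubic_lower:
  assumes "0 \<le> b" "b + 1 \<le> real x0"
  shows "ennreal (1 / (64 * (real x0 + 1)\<^sup>2) / (real n + 1)\<^sup>2) \<le> mix (\<lambda>x. 1 / (real x - b) ^ 3) x0 n"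
proof -
  define N where "N = n + x0 + 1"
  have x0: "1 \<le> x0" using assms by auto
  have N: "0 < real N" by (simp add: N_def)
  have "1 / (64 * (real x0 + 1)\<^sup>2) / (real n + 1)\<^sup>2 \<le> 1 / (64 * (real N)\<^sup>2)"
  proof -
    have "real N \<le> (real x0 + 1) * (real n + 1)" by (simp add: N_def algebra_simps)
    then have "(real N)\<^sup>2 \<le> ((real x0 + 1) * (real n + 1))\<^sup>2" by (intro power_mono) auto
    then have "64 * (real N)\<^sup>2 \<le> 64 * (real x0 + 1)\<^sup>2 * (real n + 1)\<^sup>2"
      by (simp add: power_mult_distrib)
    then have "1 / (64 * (real x0 + 1)\<^sup>2 * (real n + 1)\<^sup>2) \<le> 1 / (64 * (real N)\<^sup>2)"
      using N by (intro divide_left_mono) auto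
    then show ?thesis by simp
  qed
  also have "\<dots> = (\<Sum>i\<in>{2*N-x0..<4*N-x0}. 1 / (128 * real N ^ 3))"
  proof -
    have "card {2*N-x0..<4*N-x0} = 2 * N" by (simp add: N_def)
    then show ?thesis using N by (simp add: power2_eq_square power3_eq_cube)
  qed
  also have "\<dots> \<le> (\<Sum>i\<in>{2*N-x0..<4*N-x0}. 1 / (real (i + x0) - b) ^ 3 * (1 - 1 / real (i + x0)) ^ n)"
  proof (intro sum_mono)
    fix i assume i: "i \<in> {2*N-x0..<4*N-x0}"
    define x where "x = real (i + x0)"
    have x: "2 * real N \<le> x" "x \<le> 4 * real N" "b + 1 \<le> x" using i assms by (auto simp: x_def)
    have "1 / 2 \<le> 1 - real n / x"
      using x N by (simp add: N_def field_simps)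
    also have "\<dots> \<le> (1 - 1 / x) ^ n"
      using Bernoulli_inequality[of "- 1 / x" n] x N by (simp add: field_simps N_def)
    finally have 1: "1 / 2 \<le> (1 - 1 / x) ^ n" .
    have "(x - b) ^ 3 \<le> (4 * real N) ^ 3" using x assms by (intro power_mono) auto
    then have 2: "1 / (64 * real N ^ 3) \<le> 1 / (x - b) ^ 3"
      using x assms N by (intro divide_left_mono) (auto simp: power_mult_distrib)
    show "1 / (128 * real N ^ 3) \<le> 1 / (real (i + x0) - b) ^ 3 * (1 - 1 / real (i + x0)) ^ n"
      using mult_mono[OF 2 1] x assms unfolding x_def[symmetric] by simp
  qed
  finally have "ennreal (1 / (64 * (real x0 + 1)\<^sup>2) / (real n + 1)\<^sup>2)
    \<le> (\<Sum>i\<in>{2*N-x0..<4*N-x0}. ennreal (1 / (real (i + x0) - b) ^ 3 * (1 - 1 / real (i + x0)) ^ n))"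
    using assms x0 by (subst sum_ennreal) (auto intro!: ennreal_leI)
  also have "\<dots> \<le> mix (\<lambda>x. 1 / (real x - b) ^ 3) x0 n"
    unfolding mix_def by (intro sum_le_suminf) auto
  finally show ?thesis .
qed

text \<open>Since (1 - 1/x)^n \<le> x / n, one power of x is traded for decay in n, and x^(-2) is
  still summable. The rate 1/n is cruder than the true n^(-2), but boundedness and decay at infinity
  are all that \<open>extinct_lower\<close> draws from it.\<close>

lemma mix_cubic_upper:
  assumes "0 \<le> b" "b + 1 \<le> real x0"
  obtains S :: real where "0 \<le> S" "\<And>n. 0 < n \<Longrightarrow> mix (\<lambda>x. 1 / (real x - b) ^ 3) x0 n \<le> ennreal (S / real n)"
    "\<And>n. mix (\<lambda>x. 1 / (real x - b) ^ 3) x0 n \<le> ennreal S"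
proof -
  define s where "s i = (1 + b) / (real i + 1)\<^sup>2" for i :: nat
  have x0: "1 \<le> x0" using assms by auto
  have "summable (\<lambda>i. inverse (real (Suc i) ^ 2))"
    by (subst summable_Suc_iff) (rule inverse_power_summable, simp)
  then have summ: "summable s"
    unfolding s_def by (simp add: divide_inverse summable_mult add.commute)
  have s0: "0 \<le> s i" for i using assms by (simp add: s_def)
  have w: "real (i + x0) * (1 / (real (i + x0) - b) ^ 3) \<le> s i" for i
  proof -
    define u where "u = real (i + x0) - b"
    have u: "real i + 1 \<le> u" using assms by (simp add: u_def)
    have "real (i + x0) \<le> (1 + b) * u" using u assms mult_left_mono[of 1 u b] by (simp add: u_def algebra_simps)
    then have "real (i + x0) * (1 / u ^ 3) \<le> (1 + b) * u * (1 / u ^ 3)"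
      using u by (intro mult_right_mono) auto
    also have "\<dots> = (1 + b) / u\<^sup>2" using u by (simp add: power2_eq_square power3_eq_cube)
    also have "\<dots> \<le> s i" unfolding s_def using u assms by (intro divide_left_mono power_mono) auto
    finally show ?thesis by (simp add: u_def)
  qed
  have 1: "mix (\<lambda>x. 1 / (real x - b) ^ 3) x0 n \<le> ennreal (suminf s * c)"
    if c: "0 \<le> c" "\<And>i. (1 - 1 / real (i + x0)) ^ n \<le> real (i + x0) * c" for n c
  proof -
    have "mix (\<lambda>x. 1 / (real x - b) ^ 3) x0 n \<le> (\<Sum>i. ennreal (s i * c))"
      unfolding mix_def
    proof (intro suminf_le ennreal_leI)
      fix i
      have "1 / (real (i + x0) - b) ^ 3 * (1 - 1 / real (i + x0)) ^ n
        \<le> 1 / (real (i + x0) - b) ^ 3 * (real (i + x0) * c)"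
        using c assms by (intro mult_left_mono) auto
      also have "\<dots> = (real (i + x0) * (1 / (real (i + x0) - b) ^ 3)) * c" by simp
      also have "\<dots> \<le> s i * c" using w[of i] c by (intro mult_right_mono) auto
      finally show "1 / (real (i + x0) - b) ^ 3 * (1 - 1 / real (i + x0)) ^ n \<le> s i * c" .
    qed auto
    also have "\<dots> = ennreal (suminf s * c)"
      using summ s0 c by (subst suminf_ennreal2) (auto simp: summable_mult2 suminf_mult2)
    finally show ?thesis .
  qed
  show ?thesis
  proof (rule that[of "suminf s"])
    show "0 \<le> suminf s" using summ s0 by (intro suminf_nonneg)
    show "mix (\<lambda>x. 1 / (real x - b) ^ 3) x0 n \<le> ennreal (suminf s)" for n
    proof -
      have "(1 - 1 / real (i + x0)) ^ n \<le> real (i + x0) * 1" for i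
        using x0 by (intro order_trans[OF power_le_one]) auto
      then show ?thesis using 1[of 1 n] by simp
    qed
    fix n :: nat assume n: "0 < n"
    have "(1 - 1 / real (i + x0)) ^ n \<le> real (i + x0) * (1 / real n)" for i
    proof -
      define x where "x = real (i + x0)"
      have x: "1 \<le> x" using x0 by (simp add: x_def)
      have "(1 - 1 / x) ^ n * (1 + real n * (1 / x)) \<le> (1 - 1 / x) ^ n * (1 + 1 / x) ^ n"
        using x by (intro mult_left_mono Bernoulli_inequality) (auto intro: order_trans[of _ 0])
      also have "\<dots> = ((1 - 1 / x) * (1 + 1 / x)) ^ n" by (rule power_mult_distrib[symmetric])
      also have "\<dots> \<le> 1" using x mult_mono[OF x x] by (intro power_le_one) (auto simp: field_simps)
      finally have "(1 - 1 / x) ^ n * (1 + real n / x) \<le> 1" by simp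
      moreover have "(1 - 1 / x) ^ n * (real n / x) \<le> (1 - 1 / x) ^ n * (1 + real n / x)"
        using x by (intro mult_left_mono) auto
      ultimately have "(1 - 1 / x) ^ n * (real n / x) \<le> 1" by simp
      then show ?thesis using x n unfolding x_def[symmetric] by (simp add: field_simps)
    qed
    then show "mix (\<lambda>x. 1 / (real x - b) ^ 3) x0 n \<le> ennreal (suminf s / real n)"
      using 1[of "1 / real n" n] by simp
  qed
qed

text \<open>A maximum principle. The cubic mixture f is subharmonic off a finite set, at most a
  multiple of \<open>extinct\<close> on that set, and tends to 0 at infinity. The chain leaves every
  finite set of positive states, so f is at most that multiple everywhere.\<close>

lemma extinct_lower:
  assumes "\<delta> \<le> 3"
  obtains c where "0 < c" "\<And>n. ennreal (c / (real n + 1)\<^sup>2) \<le> extinct n"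
proof -
  define b where "b = 2 * C + 4"
  define x0 where "x0 = nat \<lceil>b + 1\<rceil>"
  have b: "0 \<le> b" "b + 1 \<le> real x0" using C_nonneg unfolding x0_def b_def by (simp, linarith)
  have x0: "5 \<le> x0" using b C_nonneg unfolding b_def by linarith
  define w where "w x = 1 / (real x - b) ^ 3" for x :: nat
  define f where "f = mix w x0"
  have w0: "0 < w x" if "x0 \<le> x" for x using b that by (simp add: w_def)
  have inc: "w (Suc x) < w x * G (1 / real x)" if "x0 \<le> x" for x
    using cubic_weight_increases[OF assms, of b "real x"] that b by (simp add: w_def b_def add.commute)
  obtain S where S: "0 \<le> S" "\<And>n. 0 < n \<Longrightarrow> f n \<le> ennreal (S / real n)" "\<And>n. f n \<le> ennreal S"
    using mix_cubic_upper[OF b] unfolding f_def w_def by blast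
  \<comment> \<open>The kernel shifts the weights by one, so the first term of f, with base t0, has
    no counterpart in the image. As t0 < t1, it is negligible against t1^n for large n and fits into
    the slack of the strict inequality \<open>inc\<close> at x0.\<close>
  define t0 where "t0 = 1 - 1 / real x0"
  define t1 where "t1 = 1 - 1 / (real x0 + 1)"
  have t: "0 < t0" "t0 < t1" using x0 by (auto simp: t0_def t1_def field_simps)
  have "(\<lambda>n. w x0 * (t0 / t1) ^ n + w (Suc x0)) \<longlonglongrightarrow> w x0 * 0 + w (Suc x0)"
    using t by (intro tendsto_intros LIMSEQ_realpow_zero) auto
  then have "eventually (\<lambda>n. w x0 * (t0 / t1) ^ n + w (Suc x0) < w x0 * G (1 / real x0)) sequentially"
    using inc[of x0] by (intro order_tendstoD(2)) auto
  then obtain n1 where n1: "\<And>n. n1 \<le> n \<Longrightarrow> w x0 * (t0 / t1) ^ n + w (Suc x0) < w x0 * G (1 / real x0)"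
    unfolding eventually_sequentially by blast
  define n0 where "n0 = max M n1"
  have sub: "f n \<le> (\<integral>\<^sup>+m. f m \<partial>K n)" if "n0 < n" for n
  proof -
    have n: "M < n" "n1 \<le> n" using that by (auto simp: n0_def)
    have "f n = ennreal (w x0 * t0 ^ n) + (ennreal (w (Suc x0) * t1 ^ n) + mix w (Suc (Suc x0)) n)"
      unfolding f_def by (subst mix_Suc, subst mix_Suc) (simp add: t0_def t1_def add.commute)
    also have "\<dots> = ennreal (w x0 * t0 ^ n + w (Suc x0) * t1 ^ n) + mix w (Suc (Suc x0)) n"
      using t w0[of x0] w0[of "Suc x0"] by (simp add: add.assoc)
    also have "\<dots> \<le> ennreal (w x0 * G (1 / real x0) * t1 ^ n)
        + (\<Sum>i. ennreal (w (Suc i + x0) * G (1 / real (Suc i + x0)) * (1 - 1 / real (Suc i + x0 + 1)) ^ n))"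
    proof (rule add_mono)
      have "(w x0 * (t0 / t1) ^ n + w (Suc x0)) * t1 ^ n \<le> w x0 * G (1 / real x0) * t1 ^ n"
        using n1[OF n(2)] t by (intro mult_right_mono) auto
      then show "ennreal (w x0 * t0 ^ n + w (Suc x0) * t1 ^ n) \<le> ennreal (w x0 * G (1 / real x0) * t1 ^ n)"
        using t by (intro ennreal_leI) (simp add: distrib_right power_divide)
      show "mix w (Suc (Suc x0)) n
        \<le> (\<Sum>i. ennreal (w (Suc i + x0) * G (1 / real (Suc i + x0)) * (1 - 1 / real (Suc i + x0 + 1)) ^ n))"
        unfolding mix_def
      proof (intro suminf_le ennreal_leI)
        fix i
        have "w (Suc (Suc i + x0)) * (1 - 1 / real (Suc i + x0 + 1)) ^ n
          \<le> w (Suc i + x0) * G (1 / real (Suc i + x0)) * (1 - 1 / real (Suc i + x0 + 1)) ^ n"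
          using inc[of "Suc i + x0"] by (intro mult_right_mono zero_le_power) auto
        then show "w (i + Suc (Suc x0)) * (1 - 1 / real (i + Suc (Suc x0))) ^ n
          \<le> w (Suc i + x0) * G (1 / real (Suc i + x0)) * (1 - 1 / real (Suc i + x0 + 1)) ^ n" by simp
      qed auto
    qed
    also have "\<dots> = (\<Sum>i. ennreal (w (i + x0) * G (1 / real (i + x0)) * (1 - 1 / real (i + x0 + 1)) ^ n))"
      by (subst (2) suminf_offset[of _ 1]) (auto simp: t1_def add.commute)
    also have "\<dots> = (\<integral>\<^sup>+m. f m \<partial>K n)"
      unfolding f_def using n x0 w0 by (subst nn_integral_mix) (auto intro: less_imp_le)
    finally show ?thesis .
  qed
  define p where "p = Min ((\<lambda>m. pmf (K m) 0) ` {0..n0})"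
  have p: "0 < p" unfolding p_def by (subst Min_gr_iff) (auto simp: pmf_0_pos)
  have p_le: "ennreal p \<le> extinct m" if "m \<le> n0" for m
    by (rule order_trans[OF ennreal_leI pmf_K_0_le_extinct]) (use that in \<open>auto simp: p_def intro!: Min_le\<close>)
  define c1 where "c1 = S / p"
  have c1: "0 \<le> c1" using S p by (simp add: c1_def)
  have small: "f m \<le> ennreal c1 * extinct m" if "m \<le> n0" for m
  proof -
    have "f m \<le> ennreal c1 * ennreal p" using S(3)[of m] p c1 by (simp add: c1_def flip: ennreal_mult)
    also have "\<dots> \<le> ennreal c1 * extinct m" using p_le[OF that] by (intro mult_left_mono) auto
    finally show ?thesis .
  qed
  \<comment> \<open>Optional stopping at the entry into {0..n0}, as an induction on time: stopped
    paths are paid for by \<open>extinct\<close>, the others are among the paths above n0 at time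
    k.\<close>
  have key: "f n \<le> ennreal c1 * extinct n + (\<integral>\<^sup>+m. f m * indicator {n0<..} m \<partial>iter k n)" for k n
  proof (induction k arbitrary: n)
    case 0
    show ?case using small[of n] by (cases "n \<le> n0") (auto simp: indicator_def add_increasing)
  next
    case (Suc k)
    show ?case
    proof (cases "n \<le> n0")
      case True
      then show ?thesis using small[of n] by (auto intro: order_trans add_increasing2)
    next
      case False
      have "f n \<le> (\<integral>\<^sup>+m. f m \<partial>K n)" using sub False by simp
      also have "\<dots> \<le> (\<integral>\<^sup>+m. ennreal c1 * extinct m + (\<integral>\<^sup>+j. f j * indicator {n0<..} j \<partial>iter k m) \<partial>K n)"
        by (intro nn_integral_mono Suc)
      also have "\<dots> = ennreal c1 * extinct n + (\<integral>\<^sup>+m. f m * indicator {n0<..} m \<partial>iter (Suc k) n)"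
        unfolding iter_Suc_first by (simp add: nn_integral_add nn_integral_cmult extinct_harmonic)
      finally show ?thesis .
    qed
  qed
  \<comment> \<open>The remainder vanishes: above L the function f is at most e / 2, and the mass in
    {1..L} tends to 0 because its sum over time is finite.\<close>
  have f_le: "f n \<le> ennreal c1 * extinct n" for n
  proof (rule ennreal_le_epsilon)
    fix e :: real assume e: "0 < e"
    obtain L where L: "0 < L" "S / real L \<le> e / 2"
    proof -
      obtain L :: nat where "2 * S / e < real L" using reals_Archimedean2 by blast
      moreover have "0 \<le> 2 * S / e" using S e by simp
      ultimately have "0 < real L" by linarith
      moreover have "2 * S \<le> e * real L"
        using \<open>2 * S / e < real L\<close> e by (simp add: pos_divide_less_eq mult.commute)
      ultimately show ?thesis by (intro that[of L]) (auto simp: pos_divide_le_eq)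
    qed
    have "green n (\<lambda>m. indicator {1..L} m) < \<infinity>"
      using green_finite[of L] by (metis ennreal_less_top infinity_ennreal_def le_less_trans)
    then have "(\<lambda>k. \<integral>\<^sup>+m. indicator {1..L} m \<partial>iter k n) \<longlonglongrightarrow> 0"
      unfolding green_def by (rule ennreal_suminf_tendsto_0)
    then have "(\<lambda>k. ennreal S * \<integral>\<^sup>+m. indicator {1..L} m \<partial>iter k n) \<longlonglongrightarrow> ennreal S * 0"
      by (intro tendsto_mult_ennreal tendsto_const) auto
    then have "eventually (\<lambda>k. ennreal S * (\<integral>\<^sup>+m. indicator {1..L} m \<partial>iter k n) < ennreal (e / 2)) sequentially"
      using e by (intro order_tendstoD(2)) auto
    then obtain k where k: "ennreal S * (\<integral>\<^sup>+m. indicator {1..L} m \<partial>iter k n) < ennreal (e / 2)"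
      by (auto simp: eventually_sequentially)
    have "(\<integral>\<^sup>+m. f m * indicator {n0<..} m \<partial>iter k n)
       \<le> (\<integral>\<^sup>+m. ennreal S * indicator {1..L} m + ennreal (S / real L) \<partial>iter k n)"
    proof (intro nn_integral_mono)
      fix m
      have "f m \<le> ennreal (S / real L)" if "L < m"
      proof -
        have "f m \<le> ennreal (S / real m)" using S(2)[of m] that by simp
        also have "S / real m \<le> S / real L" using that L S by (intro divide_left_mono) auto
        finally show ?thesis by (simp add: ennreal_leI)
      qed
      moreover have "f m \<le> ennreal S" by (rule S)
      ultimately show "f m * indicator {n0<..} m \<le> ennreal S * indicator {1..L} m + ennreal (S / real L)"
        by (cases "L < m") (auto simp: indicator_def add_increasing add_increasing2)
    qed
    also have "\<dots> = ennreal S * (\<integral>\<^sup>+m. indicator {1..L} m \<partial>iter k n) + ennreal (S / real L)"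
      by (simp add: nn_integral_add nn_integral_cmult)
    also have "\<dots> \<le> ennreal (e / 2) + ennreal (e / 2)"
      using k L by (intro add_mono ennreal_leI) auto
    also have "\<dots> = ennreal e" using e by (simp flip: ennreal_plus)
    finally show "f n \<le> ennreal c1 * extinct n + ennreal e"
      using key[of n k] by (meson add_left_mono order_trans)
  qed
  define c2 where "c2 = 1 / (64 * (real x0 + 1)\<^sup>2)"
  have c2: "0 < c2" by (simp add: c2_def add_nonneg_pos)
  define c where "c = c2 / (c1 + 1)"
  show ?thesis
  proof (rule that[of c])
    show "0 < c" using c1 c2 by (simp add: c_def)
    fix n
    have "ennreal (c2 / (real n + 1)\<^sup>2) \<le> f n"
      unfolding c2_def f_def w_def by (rule mix_cubic_lower[OF b])
    also have "\<dots> \<le> ennreal c1 * extinct n" by (rule f_le)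
    also have "\<dots> \<le> ennreal (c1 + 1) * extinct n" by (intro mult_right_mono ennreal_leI) auto
    finally have "ennreal (1 / (c1 + 1)) * ennreal (c2 / (real n + 1)\<^sup>2)
        \<le> ennreal (1 / (c1 + 1)) * (ennreal (c1 + 1) * extinct n)"
      by (intro mult_left_mono) auto
    also have "\<dots> = ennreal (1 / (c1 + 1) * (c1 + 1)) * extinct n"
      using c1 by (subst ennreal_mult) (auto simp: mult.assoc)
    also have "\<dots> = extinct n" using c1 by simp
    also have "ennreal (1 / (c1 + 1)) * ennreal (c2 / (real n + 1)\<^sup>2) = ennreal (c / (real n + 1)\<^sup>2)"
      using c1 c2 by (simp add: c_def flip: ennreal_mult)
    finally show "ennreal (c / (real n + 1)\<^sup>2) \<le> extinct n" .
  qed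
qed

text \<open>By concavity the chain grows at most like its time, so that the Green function of the survival
  paths integrates \<open>1 / (m + 1)\<close> to infinity; the extinction probability is at least of order
  \<open>1 / (m + 1)\<^sup>2\<close>.\<close>

lemma mean_progeny_infinite_transient:
  assumes "\<delta> \<le> 3" "M < v" "extinct v < 1"
  shows "mean_progeny 1 = \<infinity>"
proof (rule ccontr)
  assume "mean_progeny 1 \<noteq> \<infinity>"
  then have "mean_progeny 1 < \<infinity>" by (simp add: less_top)
  then have fin: "mean_progeny v < \<infinity>" by (rule mean_progeny_reach) (use assms in simp)
  obtain c where c: "0 < c" "\<And>n. ennreal (c / (real n + 1)\<^sup>2) \<le> extinct n"
    using extinct_lower[OF assms(1)] by blast
  \<comment> \<open>For m \<ge> 1 the product of m and c / (m + 1)^2 is at least (c / 2) / (m + 1),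
    so finite mean progeny makes the Green function of r finite.\<close>
  define r where "r m = ennreal (1 / (real m + 1)) * indicator {1..} m" for m :: nat
  have "ennreal (c / 2) * green v r \<le> green v (\<lambda>m. of_nat m * extinct m)"
    unfolding green_cmult[symmetric]
  proof (rule green_mono)
    fix m
    show "ennreal (c / 2) * r m \<le> of_nat m * extinct m"
    proof (cases "m = 0")
      case False
      have "(c / 2) * (1 / (real m + 1)) \<le> real m * (c / (real m + 1)\<^sup>2)"
      proof -
        have "c * (real m + 1) \<le> c * (2 * real m)" using c False by (intro mult_left_mono) auto
        then have "c * (real m + 1) / (2 * (real m + 1)\<^sup>2) \<le> c * (2 * real m) / (2 * (real m + 1)\<^sup>2)"
          by (intro divide_right_mono) auto
        then show ?thesis by (simp add: power2_eq_square mult.commute)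
      qed
      then have "ennreal ((c / 2) * (1 / (real m + 1))) \<le> of_nat m * ennreal (c / (real m + 1)\<^sup>2)"
        using c by (simp add: ennreal_of_nat_eq_real_of_nat ennreal_leI flip: ennreal_mult)
      also have "\<dots> \<le> of_nat m * extinct m" by (intro mult_left_mono c) auto
      finally show ?thesis
        unfolding r_def using c(1) False by (subst (asm) ennreal_mult) (auto simp: indicator_def)
    qed (simp add: r_def)
  qed
  also have "\<dots> < \<infinity>" using fin by (simp add: mean_progeny_eq_green)
  finally have "green v r < \<infinity>" using c by (auto simp: ennreal_mult_less_top ennreal_eq_0_iff)
  define l where "l m = ennreal (ln (1 + real m))" for m
  obtain b where b: "0 \<le> b" "\<And>m. (\<integral>\<^sup>+j. l j \<partial>K m) \<le> l m + ennreal b * r m"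
  proof -
    define D where "D = (\<Sum>m\<le>M. (\<integral>\<^sup>+j. ennreal (real j) \<partial>K m))"
    have "D < \<infinity>" unfolding D_def using mean_moment_finite by (auto simp: less_top)
    then obtain d where d: "D = ennreal d" "0 \<le> d" by (cases D) auto
    \<comment> \<open>The first entry covers the states 1..M, where the logarithm is bounded by the
      identity; the second covers the drift \<delta> / (m + 1) above M.\<close>
    define b where "b = max (d * (real M + 1)) \<bar>\<delta>\<bar>"
    have "(\<integral>\<^sup>+j. l j \<partial>K m) \<le> l m + ennreal b * r m" for m
    proof -
      consider "m = 0" | "1 \<le> m" "m \<le> M" | "M < m" by linarith
      then show ?thesis
      proof cases
        case 2
        have "(\<integral>\<^sup>+j. l j \<partial>K m) \<le> (\<integral>\<^sup>+j. ennreal (real j) \<partial>K m)"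
          unfolding l_def by (intro nn_integral_mono ennreal_leI) (simp add: ln_add_one_self_le_self)
        also have "\<dots> \<le> D"
          unfolding D_def using 2 by (intro sum_nonneg_leq_bound[OF _ _ refl]) auto
        also have "D \<le> ennreal (b * (1 / (real m + 1)))"
        proof -
          have "d * (real m + 1) \<le> d * (real M + 1)" using 2 d by (intro mult_left_mono) auto
          also have "\<dots> \<le> b" by (simp add: b_def)
          finally show ?thesis unfolding d(1) by (intro ennreal_leI) (simp add: field_simps)
        qed
        also have "\<dots> = ennreal b * r m"
          using 2 by (subst ennreal_mult) (auto simp: r_def b_def le_max_iff_disj)
        finally show ?thesis by (simp add: add_increasing)
      next
        case 3
        define n where "n = real m + 1"
        have n: "0 < n" by (simp add: n_def)
        have pos: "0 \<le> real m + \<delta>" using 3 delta_bound by linarith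
        have "(\<integral>\<^sup>+j. l j \<partial>K m) + ennreal (real m / n) = (\<integral>\<^sup>+j. l j + ennreal (real m / n) \<partial>K m)"
          by (simp add: nn_integral_add)
        also have "\<dots> \<le> (\<integral>\<^sup>+j. l m + ennreal (1 / n) * ennreal (real j) \<partial>K m)"
        proof (intro nn_integral_mono)
          fix j
          \<comment> \<open>The logarithm lies below its tangent at m. Below, m / n is added on both
            sides to stay nonnegative.\<close>
          have "ln ((1 + real j) / n) \<le> (1 + real j) / n - 1"
            using n by (intro ln_le_minus_one) auto
          then have "ln (1 + real j) - ln n \<le> (1 + real j) / n - 1"
            using n by (simp add: ln_div)
          also have "\<dots> = (1 + real j - n) / n" using n by (simp add: diff_divide_distrib)
          also have "\<dots> = real j / n - real m / n" by (simp add: n_def diff_divide_distrib)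
          finally have "ln (1 + real j) + real m / n \<le> ln (1 + real m) + 1 / n * real j"
            by (simp add: n_def add.commute)
          then have "ennreal (ln (1 + real j) + real m / n) \<le> ennreal (ln (1 + real m) + 1 / n * real j)"
            by (rule ennreal_leI)
          then show "l j + ennreal (real m / n) \<le> l m + ennreal (1 / n) * ennreal (real j)"
            using n by (simp add: l_def ennreal_mult[symmetric])
        qed
        also have "\<dots> = l m + ennreal (1 / n) * ennreal (real m + \<delta>)"
          using 3 by (simp add: nn_integral_add nn_integral_cmult mean)
        also have "\<dots> = l m + ennreal ((real m + \<delta>) / n)"
          using n pos by (simp flip: ennreal_mult)
        also have "\<dots> \<le> l m + ennreal (b * (1 / n) + real m / n)"
        proof (intro add_left_mono ennreal_leI)
          have "real m + \<delta> \<le> b + real m" by (simp add: b_def)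
          then have "(real m + \<delta>) / n \<le> (b + real m) / n" using n by (intro divide_right_mono) auto
          then show "(real m + \<delta>) / n \<le> b * (1 / n) + real m / n" by (simp add: add_divide_distrib)
        qed
        also have "\<dots> = (l m + ennreal b * r m) + ennreal (real m / n)"
        proof -
          have "0 \<le> b" by (simp add: b_def)
          then have "ennreal (b * (1 / n)) = ennreal b * r m"
            using 3 n by (subst ennreal_mult) (auto simp: r_def n_def)
          then show ?thesis using n \<open>0 \<le> b\<close> by (simp add: add.assoc)
        qed
        finally show ?thesis by (rule ennreal_add_right_cancel_leD) simp
      qed (simp add: l_def)
    qed
    then show ?thesis by (intro that[of b]) (auto simp: b_def)
  qed
  define R where "R = l v + ennreal b * green v r"
  have "R < \<infinity>" using \<open>green v r < \<infinity>\<close> by (simp add: R_def l_def ennreal_mult_less_top)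
  have R: "(\<integral>\<^sup>+m. l m \<partial>iter J v) \<le> R" for J
  proof -
    have "(\<integral>\<^sup>+m. l m \<partial>iter J v) \<le> l v + (\<Sum>k<J. \<integral>\<^sup>+m. ennreal b * r m \<partial>iter k v)"
      using lyapunov_partial[of l "\<lambda>_. 0" "\<lambda>m. ennreal b * r m" J v] b by simp
    also have "\<dots> \<le> l v + green v (\<lambda>m. ennreal b * r m)"
      unfolding green_def by (intro add_left_mono sum_le_suminf) auto
    finally show ?thesis by (simp add: R_def green_cmult)
  qed
  obtain \<rho> where \<rho>: "R = ennreal \<rho>" "0 \<le> \<rho>" using \<open>R < \<infinity>\<close> by (cases R) auto
  obtain h where h: "extinct v = ennreal h" "0 \<le> h" "h < 1"
    using assms(3) by (cases "extinct v") (auto simp: ennreal_less_iff)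
  \<comment> \<open>For late times the chain is at 0 with probability at most h and in {1..L} with
    vanishing probability. The rest lies above L, while the expected logarithm stays below
    \<open>\<rho>\<close>; as h < 1, this fails for large L.\<close>
  have ln_le: "ln (1 + real L) \<le> ln (1 + real L) * h + \<rho>" for L
  proof -
    define a where "a = ln (1 + real L)"
    have a: "0 \<le> a" by (simp add: a_def)
    have "green v (\<lambda>m. indicator {1..L} m) < \<infinity>"
      using green_finite[of L] by (metis ennreal_less_top infinity_ennreal_def le_less_trans)
    then have "(\<lambda>k. \<integral>\<^sup>+m. indicator {1..L} m \<partial>iter k v) \<longlonglongrightarrow> 0"
      unfolding green_def by (rule ennreal_suminf_tendsto_0)
    then have "(\<lambda>k. ennreal a * (\<integral>\<^sup>+m. indicator {1..L} m \<partial>iter k v) + (ennreal a * extinct v + R))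
        \<longlonglongrightarrow> ennreal a * 0 + (ennreal a * extinct v + R)"
      by (intro tendsto_add tendsto_mult_ennreal tendsto_const) auto
    then have "ennreal a \<le> ennreal a * 0 + (ennreal a * extinct v + R)"
    proof (rule LIMSEQ_le_const, intro exI allI impI)
      fix k
      have "ennreal a = (\<integral>\<^sup>+m. ennreal a \<partial>iter k v)" by simp
      also have "\<dots> \<le> (\<integral>\<^sup>+m. ennreal a * indicator {1..L} m + (ennreal a * indicator {0} m + l m) \<partial>iter k v)"
      proof (intro nn_integral_mono)
        fix m
        consider "m = 0" | "1 \<le> m" "m \<le> L" | "L < m" by linarith
        then show "ennreal a \<le> ennreal a * indicator {1..L} m + (ennreal a * indicator {0} m + l m)"
        proof cases
          case 3
          then have "ennreal a \<le> l m" unfolding a_def l_def by (intro ennreal_leI) simp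
          then show ?thesis by (simp add: add_increasing)
        qed (auto simp: add_increasing2)
      qed
      also have "\<dots> = ennreal a * (\<integral>\<^sup>+m. indicator {1..L} m \<partial>iter k v)
          + (ennreal a * emeasure (iter k v) {0} + (\<integral>\<^sup>+m. l m \<partial>iter k v))"
        by (simp add: nn_integral_add nn_integral_cmult)
      also have "\<dots> \<le> ennreal a * (\<integral>\<^sup>+m. indicator {1..L} m \<partial>iter k v) + (ennreal a * extinct v + R)"
        by (intro add_left_mono add_mono mult_left_mono iter_0_le_extinct R) auto
      finally show "ennreal a \<le> ennreal a * (\<integral>\<^sup>+m. indicator {1..L} m \<partial>iter k v) + (ennreal a * extinct v + R)" .
    qed
    also have "\<dots> = ennreal (a * h + \<rho>)"
      using a h \<rho> by (simp add: ennreal_mult)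
    finally show ?thesis unfolding a_def[symmetric] using a h \<rho> by (subst (asm) ennreal_le_iff) auto
  qed
  have "filterlim (\<lambda>L::nat. ln (1 + real L)) at_top sequentially" by real_asymp
  then have "eventually (\<lambda>L::nat. \<rho> / (1 - h) < ln (1 + real L)) sequentially"
    by (simp add: filterlim_at_top_dense)
  then obtain L :: nat where "\<rho> / (1 - h) < ln (1 + real L)" by (auto simp: eventually_sequentially)
  then have "\<rho> < ln (1 + real L) * (1 - h)" using h by (simp add: pos_divide_less_eq)
  then show False using ln_le[of L] by (simp add: algebra_simps)
qed

theorem mean_progeny_finite_iff: "mean_progeny 1 < \<infinity> \<longleftrightarrow> \<delta> < -1 \<or> 3 < \<delta>"
proof
  assume fin: "mean_progeny 1 < \<infinity>"
  show "\<delta> < -1 \<or> 3 < \<delta>"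
  proof (rule ccontr)
    assume "\<not> ?thesis"
    then have d: "-1 \<le> \<delta>" "\<delta> \<le> 3" by auto
    show False
    \<comment> \<open>Each of the two arguments covers the whole range from -1 to 3, so the
      dichotomy replaces a computation of when extinction is certain.\<close>
    proof (cases "\<forall>v>M. extinct v = 1")
      case True
      then show ?thesis using mean_progeny_infinite_recurrent[OF d(1)] fin by auto
    next
      case False
      then obtain v where "M < v" "extinct v \<noteq> 1" by auto
      then show ?thesis
        using mean_progeny_infinite_transient[OF d(2), of v] extinct_le_1[of v] fin by auto
    qed
  qed
qed (use mean_progeny_finite_low mean_progeny_finite_high in auto)

end

section \<open>Right steps before the n-th left step at a site\<close>

text \<open>\<open>left_count \<sigma> j l\<close> is the probability of \<open>l\<close> left steps among the first \<open>j\<close> departures from a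
  site with cookie stack \<open>\<sigma>\<close>, where cookies are counted from 0; \<open>stack_kernel \<sigma> n m\<close> is the
  probability of \<open>m\<close> right steps before the \<open>n\<close>-th left step.\<close>

primrec left_count :: "(nat \<Rightarrow> real) \<Rightarrow> nat \<Rightarrow> nat \<Rightarrow> real" where
  "left_count \<sigma> 0 l = of_bool (l = 0)"
| "left_count \<sigma> (Suc j) l = left_count \<sigma> j l * \<sigma> j +
     (if l = 0 then 0 else left_count \<sigma> j (l - 1) * (1 - \<sigma> j))"

fun stack_kernel :: "(nat \<Rightarrow> real) \<Rightarrow> nat \<Rightarrow> nat \<Rightarrow> real" where
  "stack_kernel \<sigma> 0 m = of_bool (m = 0)"
| "stack_kernel \<sigma> (Suc l) m = left_count \<sigma> (l + m) l * (1 - \<sigma> (l + m))"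

declare stack_kernel.simps(2) [simp del]

lemma left_count_eq_0: "j < l \<Longrightarrow> left_count \<sigma> j l = 0"
  by (induction j arbitrary: l) auto

lemma left_count_all: "left_count \<sigma> j j = (\<Prod>i<j. 1 - \<sigma> i)"
  by (induction j) (auto simp: left_count_eq_0)

lemma left_count_none: "left_count \<sigma> j 0 = (\<Prod>i<j. \<sigma> i)"
  by (induction j) auto

text \<open>With the number of left steps capped at N, the extra term on the left is the mass that
  makes left step number N + 1 just now. Exactly this mass is what \<open>stack_kernel\<close>
  records.\<close>

lemma left_count_step:
  "(\<Sum>l\<le>N. left_count \<sigma> (Suc j) l * e (Suc j) l) + left_count \<sigma> j N * (1 - \<sigma> j) * e (Suc j) (Suc N)
    = (\<Sum>l\<le>N. left_count \<sigma> j l * (\<sigma> j * e (Suc j) l + (1 - \<sigma> j) * e (Suc j) (Suc l)))"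
  by (induction N) (auto simp: algebra_simps)

locale cookie_stack =
  fixes \<sigma> :: "nat \<Rightarrow> real" and M :: nat
  assumes range01: "0 \<le> \<sigma> i" "\<sigma> i \<le> 1" and fair: "M \<le> i \<Longrightarrow> \<sigma> i = 1 / 2"
begin

lemma left_count_nonneg: "0 \<le> left_count \<sigma> j l"
  using range01 by (induction j arbitrary: l) auto

lemma stack_kernel_nonneg: "0 \<le> stack_kernel \<sigma> n m"
  using range01 by (cases n) (auto simp: stack_kernel.simps left_count_nonneg)

text \<open>The binomial counts the step sequences; each has a factor at most 1 per cookie and 1/2
  per fair step. The resulting geometric decay in j is uniform over all stacks.\<close>

lemma left_count_le_binomial:
  "left_count \<sigma> j l \<le> real (j choose l) * (\<Prod>i<j. if i < M then 1 else 1 / 2)"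
proof (induction j arbitrary: l)
  case (Suc j)
  define c where "c = (if j < M then 1 else 1 / 2 :: real)"
  define P where "P = (\<Prod>i<j. if i < M then 1 else 1 / 2 :: real)"
  have c: "\<sigma> j \<le> c" "1 - \<sigma> j \<le> c" "0 \<le> c" using range01[of j] fair[of j] by (auto simp: c_def)
  have 1: "left_count \<sigma> j i * x \<le> real (j choose i) * P * c" if "x \<le> c" "0 \<le> x" for i x
    using Suc[of i] that c left_count_nonneg[of j i] unfolding P_def[symmetric] by (intro mult_mono) auto
  show ?case
  proof (cases l)
    case 0
    then show ?thesis using 1[of "\<sigma> j" 0] c range01[of j] by (simp add: c_def P_def)
  next
    case (Suc k)
    then show ?thesis using add_mono[OF 1[of "\<sigma> j" l] 1[of "1 - \<sigma> j" k]] c range01[of j]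
      by (simp add: c_def[symmetric] P_def[symmetric] algebra_simps)
  qed
qed (auto simp: binomial_eq_0_iff)

lemma left_count_le: "left_count \<sigma> j l \<le> 2 ^ M * real (j + 1) ^ l / 2 ^ j"
proof -
  have "(\<Prod>i<j. if i < M then 1 else 1 / 2 :: real) \<le> 2 ^ M / 2 ^ j"
  proof (cases "j \<le> M")
    case True
    then have "(\<Prod>i<j. if i < M then 1 else 1 / 2 :: real) = 1" by (intro prod.neutral) auto
    then show ?thesis using True by (simp add: power_increasing)
  next
    case False
    then obtain d where d: "j = M + d" using nat_le_iff_add by (metis linorder_le_cases)
    have "(\<Prod>i<M + d. if i < M then 1 else 1 / 2 :: real) = 1 / 2 ^ d"
      by (induction d) auto
    then show ?thesis by (simp add: d power_add)
  qed
  moreover have "real (j choose l) \<le> real (j + 1) ^ l"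
  proof -
    have "j choose l \<le> (j + 1) ^ l"
    proof (cases "l \<le> j")
      case True
      have "j choose l \<le> j ^ l" using True by (rule binomial_le_pow)
      also have "\<dots> \<le> (j + 1) ^ l" by (intro power_mono) auto
      finally show ?thesis .
    qed (simp add: binomial_eq_0)
    then show ?thesis by (metis of_nat_le_iff of_nat_power)
  qed
  ultimately have "real (j choose l) * (\<Prod>i<j. if i < M then 1 else 1 / 2 :: real)
     \<le> real (j + 1) ^ l * (2 ^ M / 2 ^ j)"
    by (intro mult_mono prod_nonneg) auto
  then show ?thesis using left_count_le_binomial[of j l] by (simp add: mult.commute)
qed

lemma stack_kernel_le: "stack_kernel \<sigma> (Suc N) m \<le> 2 ^ M * real (N + m + 1) ^ N / 2 ^ (N + m)"
proof -
  have "stack_kernel \<sigma> (Suc N) m \<le> left_count \<sigma> (N + m) N * 1"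
    unfolding stack_kernel.simps using range01 left_count_nonneg by (intro mult_left_mono) auto
  then show ?thesis using left_count_le[of "N + m" N] by (simp add: add.assoc)
qed

text \<open>The stopped martingale identity behind all moment computations: \<open>e\<close> is harmonic for the fair
  two-sided count process from time \<open>J\<close> on, and the number of left steps is frozen at \<open>N + 1\<close>.\<close>

lemma stopped_sums:
  assumes "J \<le> N"
    and harm: "\<And>j l. J \<le> j \<Longrightarrow> l \<le> j \<Longrightarrow> \<sigma> j * e (Suc j) l + (1 - \<sigma> j) * e (Suc j) (Suc l) = e j l"
    and bound: "\<And>j l. l \<le> N \<Longrightarrow> l \<le> j \<Longrightarrow> \<bar>e j l\<bar> \<le> E * (real j + 1)\<^sup>2"
  shows "(\<lambda>m. stack_kernel \<sigma> (Suc N) m * e (Suc N + m) (Suc N)) sums (\<Sum>l\<le>J. left_count \<sigma> J l * e J l)"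
proof -
  define T where "T j = (\<Sum>l\<le>N. left_count \<sigma> j l * e j l)" for j
  have T_step: "T (Suc j) + left_count \<sigma> j N * (1 - \<sigma> j) * e (Suc j) (Suc N) = T j" if "J \<le> j" for j
  proof -
    have "T (Suc j) + left_count \<sigma> j N * (1 - \<sigma> j) * e (Suc j) (Suc N)
      = (\<Sum>l\<le>N. left_count \<sigma> j l * (\<sigma> j * e (Suc j) l + (1 - \<sigma> j) * e (Suc j) (Suc l)))"
      unfolding T_def by (rule left_count_step)
    also have "\<dots> = T j" unfolding T_def
    proof (intro sum.cong refl)
      fix l
      show "left_count \<sigma> j l * (\<sigma> j * e (Suc j) l + (1 - \<sigma> j) * e (Suc j) (Suc l)) = left_count \<sigma> j l * e j l"
        using harm[OF that, of l] left_count_eq_0[of j l \<sigma>] by (cases "l \<le> j") auto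
    qed
    finally show ?thesis .
  qed
  \<comment> \<open>Before departure N + 1 there cannot be N + 1 left steps, so no mass leaves the
    capped sum up to time N.\<close>
  have const: "T j = T J" if "J \<le> j" "j \<le> N" for j
    using that
  proof (induction j rule: dec_induct)
    case (step j)
    then show ?case using T_step[of j] left_count_eq_0[of j N \<sigma>] by simp
  qed simp
  have T_N: "T N = T J" by (rule const) (use assms(1) in auto)
  \<comment> \<open>From time N on, what leaves the capped sum at time N + m is the m-th term of the
    series.\<close>
  have part: "(\<Sum>m<k. stack_kernel \<sigma> (Suc N) m * e (Suc N + m) (Suc N)) + T (N + k) = T J" for k
  proof (induction k)
    case (Suc k)
    then show ?case using T_step[of "N + k"] assms(1) by (simp add: stack_kernel.simps algebra_simps)
  qed (simp add: T_N)
  \<comment> \<open>The part not yet stopped is a polynomial in j, including the quadratic growth of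
    e, divided by 2^j.\<close>
  define B where "B j = (\<Sum>l\<le>N. 2 ^ M * real (j + 1) ^ l / 2 ^ j * (real j + 1)\<^sup>2 * \<bar>E\<bar>)" for j
  have "(\<lambda>k. T (N + k)) \<longlonglongrightarrow> 0"
  proof (rule Lim_null_comparison[of _ "\<lambda>k. B (N + k)"])
    show "eventually (\<lambda>k. norm (T (N + k)) \<le> B (N + k)) sequentially"
    proof (intro always_eventually allI)
      fix k
      have "\<bar>T (N + k)\<bar> \<le> (\<Sum>l\<le>N. \<bar>left_count \<sigma> (N + k) l * e (N + k) l\<bar>)"
        unfolding T_def by (rule sum_abs)
      also have "\<dots> \<le> B (N + k)"
        unfolding B_def abs_mult mult.assoc[of _ "_\<^sup>2"]
      proof (intro sum_mono mult_mono)
        fix l assume l: "l \<in> {..N}"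
        show "\<bar>left_count \<sigma> (N + k) l\<bar> \<le> 2 ^ M * real (N + k + 1) ^ l / 2 ^ (N + k)"
          using left_count_le[of "N + k" l] left_count_nonneg[of "N + k" l] by simp
        have "\<bar>e (N + k) l\<bar> \<le> E * (real (N + k) + 1)\<^sup>2" using l by (intro bound) auto
        also have "\<dots> \<le> (real (N + k) + 1)\<^sup>2 * \<bar>E\<bar>"
          by (subst mult.commute) (intro mult_left_mono, auto)
        finally show "\<bar>e (N + k) l\<bar> \<le> (real (N + k) + 1)\<^sup>2 * \<bar>E\<bar>" .
      qed auto
      finally show "norm (T (N + k)) \<le> B (N + k)" by simp
    qed
    have "B \<longlonglongrightarrow> (\<Sum>l\<le>N. 0)" unfolding B_def
    proof (intro tendsto_sum)
      fix l
      have "(\<lambda>j. 2 ^ M * real (j + 1) ^ l / 2 ^ j * (real j + 1)\<^sup>2) \<longlonglongrightarrow> 0"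
        by real_asymp
      then show "(\<lambda>j. 2 ^ M * real (j + 1) ^ l / 2 ^ j * (real j + 1)\<^sup>2 * \<bar>E\<bar>) \<longlonglongrightarrow> 0"
        by (rule tendsto_mult_left_zero)
    qed
    then show "(\<lambda>k. B (N + k)) \<longlonglongrightarrow> 0"
      using LIMSEQ_ignore_initial_segment[of B 0 N] by (simp add: add.commute[of N])
  qed
  then have "(\<lambda>k. T J - T (N + k)) \<longlonglongrightarrow> T J - 0" by (intro tendsto_intros)
  also have "(\<lambda>k. T J - T (N + k)) = (\<lambda>k. \<Sum>m<k. stack_kernel \<sigma> (Suc N) m * e (Suc N + m) (Suc N))"
    using part by (auto simp: fun_eq_iff algebra_simps)
  finally have "(\<lambda>m. stack_kernel \<sigma> (Suc N) m * e (Suc N + m) (Suc N)) sums T J"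
    unfolding sums_def by simp
  moreover have "T J = (\<Sum>l\<le>J. left_count \<sigma> J l * e J l)"
    unfolding T_def using assms(1) left_count_eq_0[of J _ \<sigma>] by (intro sum.mono_neutral_right) auto
  ultimately show ?thesis by simp
qed

section \<open>Generating function and moments of the kernel of one stack\<close>

lemma stack_kernel_sums_1: "(stack_kernel \<sigma> n) sums 1"
proof (cases n)
  case 0
  have "(\<lambda>m. if m = 0 then 1 else 0 :: real) sums 1" using sums_single[of 0 "\<lambda>_. 1::real"] by simp
  moreover have "stack_kernel \<sigma> 0 = (\<lambda>m. if m = 0 then 1 else 0)" by (rule ext) simp
  ultimately show ?thesis using 0 by simp
next
  case (Suc N)
  have "(\<lambda>m. stack_kernel \<sigma> (Suc N) m * 1) sums (\<Sum>l\<le>0. left_count \<sigma> 0 l * 1)"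
    by (rule stopped_sums[of 0 N "\<lambda>_ _. 1" 1]) (simp_all add: one_le_power)
  then show ?thesis by (simp only: Suc mult_1_right) simp
qed

definition drift :: real where "drift = (\<Sum>i<M. 2 * \<sigma> i - 1)"

lemma left_count_sum_step:
  assumes "j < N"
  shows "(\<Sum>l\<le>N. left_count \<sigma> (Suc j) l * e (Suc j) l)
    = (\<Sum>l\<le>N. left_count \<sigma> j l * (\<sigma> j * e (Suc j) l + (1 - \<sigma> j) * e (Suc j) (Suc l)))"
  using left_count_step[of \<sigma> j e N] assms by (simp add: left_count_eq_0)

lemma left_count_sum_1: "j \<le> N \<Longrightarrow> (\<Sum>l\<le>N. left_count \<sigma> j l) = 1"
proof (induction j)
  case (Suc j)
  then show ?case using left_count_sum_step[of j N "\<lambda>_ _. 1"] by simp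
qed simp

lemma left_count_sum_linear:
  "j \<le> N \<Longrightarrow> (\<Sum>l\<le>N. left_count \<sigma> j l * (real j - 2 * real l)) = (\<Sum>i<j. 2 * \<sigma> i - 1)"
proof (induction j)
  case (Suc j)
  have "(\<Sum>l\<le>N. left_count \<sigma> (Suc j) l * (real (Suc j) - 2 * real l))
    = (\<Sum>l\<le>N. left_count \<sigma> j l * (\<sigma> j * (real (Suc j) - 2 * real l) + (1 - \<sigma> j) * (real (Suc j) - 2 * real (Suc l))))"
    using Suc.prems left_count_sum_step[of j N "\<lambda>j l. real j - 2 * real l"] by simp
  also have "\<dots> = (\<Sum>l\<le>N. left_count \<sigma> j l * (real j - 2 * real l) + (2 * \<sigma> j - 1) * left_count \<sigma> j l)"
    by (intro sum.cong) (auto simp: algebra_simps)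
  also have "\<dots> = (\<Sum>i<Suc j. 2 * \<sigma> i - 1)"
    using Suc left_count_sum_1[of j N] by (simp add: sum.distrib flip: sum_distrib_left)
  finally show ?case .
next
  case 0
  show ?case by (auto intro!: sum.neutral)
qed

text \<open>The factor t per right step and 2 - t per left step gives the exponential martingale of
  fair steps. A cookie \<sigma> multiplies its mean by \<sigma> t + (1 - \<sigma>) (2 - t) = 1 - (2
  \<sigma> - 1) (1 - t), whatever happened before; hence a product.\<close>

lemma left_count_sum_power:
  "j \<le> N \<Longrightarrow> (\<Sum>l\<le>N. left_count \<sigma> j l * (t ^ (j - l) * (2 - t) ^ l)) = (\<Prod>i<j. 1 - (2 * \<sigma> i - 1) * (1 - t))"
proof (induction j)
  case (Suc j)
  have "(\<Sum>l\<le>N. left_count \<sigma> (Suc j) l * (t ^ (Suc j - l) * (2 - t) ^ l))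
    = (\<Sum>l\<le>N. left_count \<sigma> j l * (\<sigma> j * (t ^ (Suc j - l) * (2 - t) ^ l) + (1 - \<sigma> j) * (t ^ (Suc j - Suc l) * (2 - t) ^ Suc l)))"
    using Suc.prems left_count_sum_step[of j N "\<lambda>j l. t ^ (j - l) * (2 - t) ^ l"] by simp
  also have "\<dots> = (\<Sum>l\<le>N. left_count \<sigma> j l * (t ^ (j - l) * (2 - t) ^ l) * (1 - (2 * \<sigma> j - 1) * (1 - t)))"
  proof (intro sum.cong refl)
    fix l
    show "left_count \<sigma> j l * (\<sigma> j * (t ^ (Suc j - l) * (2 - t) ^ l) + (1 - \<sigma> j) * (t ^ (Suc j - Suc l) * (2 - t) ^ Suc l))
      = left_count \<sigma> j l * (t ^ (j - l) * (2 - t) ^ l) * (1 - (2 * \<sigma> j - 1) * (1 - t))"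
      using left_count_eq_0[of j l \<sigma>] by (cases "l \<le> j") (auto simp: Suc_diff_le algebra_simps)
  qed
  also have "\<dots> = (\<Prod>i<Suc j. 1 - (2 * \<sigma> i - 1) * (1 - t))"
    using Suc by (simp flip: sum_distrib_right)
  finally show ?case .
qed simp

text \<open>At the n-th left step the exponential martingale equals t^m (2 - t)^n, and the second
  factor is deterministic. As n > M, the cookies are used up by then and enter only through the
  product.\<close>

lemma stack_kernel_pgf:
  assumes "M < n" "0 \<le> t" "t \<le> 1"
  shows "(\<lambda>m. stack_kernel \<sigma> n m * t ^ m) sums ((\<Prod>i<M. 1 - (2 * \<sigma> i - 1) * (1 - t)) / (2 - t) ^ n)"
proof -
  obtain N where N: "n = Suc N" "M \<le> N" using assms(1) by (cases n) auto
  have "(\<lambda>m. stack_kernel \<sigma> (Suc N) m * (t ^ (Suc N + m - Suc N) * (2 - t) ^ Suc N))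
     sums (\<Sum>l\<le>M. left_count \<sigma> M l * (t ^ (M - l) * (2 - t) ^ l))"
  proof (rule stopped_sums[OF N(2), of "\<lambda>j l. t ^ (j - l) * (2 - t) ^ l" "2 ^ N"])
    fix j l assume "M \<le> j" "l \<le> j"
    then show "\<sigma> j * (t ^ (Suc j - l) * (2 - t) ^ l) + (1 - \<sigma> j) * (t ^ (Suc j - Suc l) * (2 - t) ^ Suc l) = t ^ (j - l) * (2 - t) ^ l"
      by (simp add: fair Suc_diff_le algebra_simps)
  next
    fix j l :: nat assume l: "l \<le> N"
    have "t ^ (j - l) * (2 - t) ^ l \<le> 1 * 2 ^ l"
      using assms by (intro mult_mono power_le_one power_mono) auto
    also have "\<dots> \<le> 2 ^ N * 1" using l by simp
    also have "\<dots> \<le> 2 ^ N * (real j + 1)\<^sup>2" by (intro mult_left_mono one_le_power) auto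
    finally show "\<bar>t ^ (j - l) * (2 - t) ^ l\<bar> \<le> 2 ^ N * (real j + 1)\<^sup>2" using assms by simp
  qed
  then have "(\<lambda>m. (stack_kernel \<sigma> n m * t ^ m) * (2 - t) ^ n) sums (\<Prod>i<M. 1 - (2 * \<sigma> i - 1) * (1 - t))"
    using left_count_sum_power[of M M t] N by (simp add: mult.assoc)
  from sums_divide[OF this, of "(2 - t) ^ n"] show ?thesis using assms by simp
qed

lemma stack_kernel_mean:
  assumes "M < n"
  shows "(\<lambda>m. stack_kernel \<sigma> n m * real m) sums (real n + drift)"
proof -
  obtain N where N: "n = Suc N" "M \<le> N" using assms(1) by (cases n) auto
  have "(\<lambda>m. stack_kernel \<sigma> (Suc N) m * (real (Suc N + m) - 2 * real (Suc N)))
     sums (\<Sum>l\<le>M. left_count \<sigma> M l * (real M - 2 * real l))"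
  proof (rule stopped_sums[OF N(2), of "\<lambda>j l. real j - 2 * real l" 2])
    fix j l :: nat assume l: "l \<le> j"
    have "\<bar>real j - 2 * real l\<bar> \<le> 2 * (real j + 1)" unfolding abs_le_iff using l by simp
    also have "\<dots> \<le> 2 * (real j + 1)\<^sup>2" using self_le_power[of "real j + 1" 2] by simp
    finally show "\<bar>real j - 2 * real l\<bar> \<le> 2 * (real j + 1)\<^sup>2" .
  qed (simp add: fair field_simps)
  then have "(\<lambda>m. stack_kernel \<sigma> n m * (real m - real n)) sums drift"
    using left_count_sum_linear[of M M] N by (simp add: drift_def algebra_simps)
  from sums_add[OF this sums_mult[OF stack_kernel_sums_1, of "real n" n]] show ?thesis
    by (simp add: algebra_simps)
qed

text \<open>Stopping of (j - 2 l)^2 - j at j = n + m, l = n. The compensator j has mean 2 n plus the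
  drift, and the state after M departures contributes at most M^2 + M.\<close>

lemma stack_kernel_variance:
  assumes "M < n"
  obtains v where "(\<lambda>m. stack_kernel \<sigma> n m * (real m - real n)\<^sup>2) sums v"
    "v \<le> 2 * real n + drift + (real M)\<^sup>2 + real M"
proof -
  obtain N where N: "n = Suc N" "M \<le> N" using assms(1) by (cases n) auto
  define e where "e j l = (real j - 2 * real l)\<^sup>2 - real j" for j l :: nat
  have e_bound: "\<bar>e j l\<bar> \<le> (real j)\<^sup>2 + real j" if "l \<le> j" for j l
  proof -
    have "(real j - 2 * real l)\<^sup>2 \<le> (real j)\<^sup>2" using that by (intro power2_le_iff_abs_le[THEN iffD2]) auto
    then show ?thesis unfolding e_def by (intro abs_leI) auto
  qed
  have "(\<lambda>m. stack_kernel \<sigma> (Suc N) m * e (Suc N + m) (Suc N)) sums (\<Sum>l\<le>M. left_count \<sigma> M l * e M l)"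
  proof (rule stopped_sums[OF N(2), of e 1])
    fix j l :: nat assume l: "l \<le> j"
    show "\<bar>e j l\<bar> \<le> 1 * (real j + 1)\<^sup>2" using e_bound[OF l] by (simp add: power2_eq_square algebra_simps)
  qed (simp add: e_def fair field_simps power2_eq_square)
  moreover define c where "c = (\<Sum>l\<le>M. left_count \<sigma> M l * e M l)"
  ultimately have 1: "(\<lambda>m. stack_kernel \<sigma> n m * ((real m - real n)\<^sup>2 - (real m + real n))) sums c"
    using N by (simp add: e_def algebra_simps)
  have "c \<le> (\<Sum>l\<le>M. left_count \<sigma> M l * ((real M)\<^sup>2 + real M))"
    unfolding c_def using e_bound left_count_nonneg
    by (intro sum_mono mult_left_mono) (auto simp: abs_le_iff)
  also have "\<dots> = (real M)\<^sup>2 + real M" using left_count_sum_1[of M M] by (simp flip: sum_distrib_right)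
  finally have "c \<le> (real M)\<^sup>2 + real M" .
  moreover have "(\<lambda>m. stack_kernel \<sigma> n m * (real m - real n)\<^sup>2) sums (c + (real n + drift + real n * 1))"
    using sums_add[OF 1 sums_add[OF stack_kernel_mean[OF assms] sums_mult[OF stack_kernel_sums_1, of "real n" n]]]
    by (simp add: algebra_simps)
  ultimately show ?thesis by (intro that[of "c + (real n + drift + real n * 1)"]) auto
qed

lemma stack_kernel_0_pos: "(\<And>i. \<sigma> i < 1) \<Longrightarrow> 0 < stack_kernel \<sigma> n 0"
  by (cases n) (auto simp: stack_kernel.simps left_count_all intro!: mult_pos_pos prod_pos)

lemma stack_kernel_1_pos: "(\<And>i. 0 < \<sigma> i) \<Longrightarrow> M \<le> m \<Longrightarrow> 0 < stack_kernel \<sigma> 1 m"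
  using fair[of m] unfolding One_nat_def stack_kernel.simps
  by (auto simp: left_count_none intro!: mult_pos_pos prod_pos)

lemma prod_expansion:
  assumes "0 \<le> y" "y \<le> 1"
  shows "\<bar>(\<Prod>i<k. 1 - (2 * \<sigma> i - 1) * y) - (1 - (\<Sum>i<k. 2 * \<sigma> i - 1) * y)\<bar> \<le> 4 ^ k * y\<^sup>2"
proof (induction k)
  case (Suc k)
  define A where "A = (\<Prod>i<k. 1 - (2 * \<sigma> i - 1) * y)"
  define s where "s = (\<Sum>i<k. 2 * \<sigma> i - 1)"
  define d where "d = 2 * \<sigma> k - 1"
  have d: "\<bar>d\<bar> \<le> 1" using range01[of k] by (auto simp: d_def abs_le_iff)
  have "\<bar>s\<bar> \<le> (\<Sum>i<k. \<bar>2 * \<sigma> i - 1\<bar>)" unfolding s_def by (rule sum_abs)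
  also have "\<dots> \<le> (\<Sum>i<k. 1)" using range01 by (intro sum_mono) (auto simp: abs_le_iff)
  finally have s: "\<bar>s\<bar> \<le> real k" by simp
  have k4: "real k \<le> 4 ^ k" using of_nat_less_two_power[of k, where 'a = real] power_mono[of 2 "4::real" k] by simp
  have "\<bar>A * (1 - d * y) - (1 - (s + d) * y)\<bar> = \<bar>(A - (1 - s * y)) * (1 - d * y) + d * s * y\<^sup>2\<bar>"
    by (simp add: algebra_simps power2_eq_square)
  also have "\<dots> \<le> \<bar>A - (1 - s * y)\<bar> * \<bar>1 - d * y\<bar> + \<bar>d\<bar> * \<bar>s\<bar> * y\<^sup>2"
    by (rule order_trans[OF abs_triangle_ineq]) (simp add: abs_mult)
  also have "\<dots> \<le> 4 ^ k * y\<^sup>2 * 2 + 1 * real k * y\<^sup>2"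
  proof (intro add_mono mult_mono)
    have "\<bar>d * y\<bar> \<le> 1 * 1" unfolding abs_mult using d assms by (intro mult_mono) auto
    then show "\<bar>1 - d * y\<bar> \<le> 2" by (simp add: abs_le_iff)
  qed (use Suc d s assms in \<open>auto simp: A_def s_def\<close>)
  also have "\<dots> \<le> 4 ^ k * y\<^sup>2 * 2 + 4 ^ k * y\<^sup>2"
    using k4 by (intro add_left_mono mult_right_mono) auto
  also have "\<dots> \<le> 4 ^ Suc k * y\<^sup>2" by (simp add: algebra_simps)
  finally show ?case by (simp add: A_def s_def d_def algebra_simps)
qed simp

lemma prod_factors_nonneg: "0 \<le> y \<Longrightarrow> y \<le> 1 \<Longrightarrow> 0 \<le> (\<Prod>i<k. 1 - (2 * \<sigma> i - 1) * y)"
proof (intro prod_nonneg ballI)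
  fix i assume y: "0 \<le> y" "y \<le> 1"
  have "(2 * \<sigma> i - 1) * y \<le> 1 * y" using range01[of i] y by (intro mult_right_mono) auto
  then show "0 \<le> 1 - (2 * \<sigma> i - 1) * y" using y by simp
qed

lemma drift_bound: "\<bar>drift\<bar> \<le> real M"
proof -
  have "\<bar>drift\<bar> \<le> (\<Sum>i<M. \<bar>2 * \<sigma> i - 1\<bar>)" unfolding drift_def by (rule sum_abs)
  also have "\<dots> \<le> (\<Sum>i<M. 1)" using range01 by (intro sum_mono) (auto simp: abs_le_iff)
  finally show ?thesis by simp
qed

end

text \<open>The bound is uniform in the stack, as it is integrated over the environment. It covers n
  \<le> M as well, where the martingale formulas are not at hand, and so rests on the tail
  estimate.\<close>

lemma stack_kernel_moment_bound:
  obtains B where "0 \<le> B" "\<And>\<sigma>. cookie_stack \<sigma> M \<Longrightarrow> (\<Sum>m. ennreal (stack_kernel \<sigma> n m * real m ^ 2)) \<le> ennreal B"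
proof (cases n)
  case 0
  have "stack_kernel \<sigma> n m * real m ^ 2 = 0" for \<sigma> m using 0 by (cases m) auto
  then show ?thesis by (intro that[of 0]) (simp_all only: ennreal_0 suminf_zero order_refl)
next
  case (Suc N)
  define c where "c j = 2 ^ M * real (j + 1) ^ N / 2 ^ j * real j ^ 2" for j
  define b where "b m = c (m + N)" for m
  have b0: "0 \<le> b m" for m by (simp add: b_def c_def)
  have "summable c"
  proof (rule summable_comparison_test_bigo)
    show "summable (\<lambda>j. norm (1 / real j ^ 2))"
      using inverse_power_summable[of 2, where 'a = real] by (simp add: inverse_eq_divide)
    show "c \<in> O(\<lambda>j. 1 / real j ^ 2)" unfolding c_def by real_asymp
  qed
  then have "summable b" unfolding b_def by (rule summable_ignore_initial_segment)
  show ?thesis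
  proof (rule that[of "suminf b"])
    show "0 \<le> suminf b" using \<open>summable b\<close> b0 by (rule suminf_nonneg)
    fix \<sigma> assume "cookie_stack \<sigma> M"
    then interpret cookie_stack \<sigma> M .
    have "(\<Sum>m. ennreal (stack_kernel \<sigma> n m * real m ^ 2)) \<le> (\<Sum>m. ennreal (b m))"
    proof (intro suminf_le ennreal_leI)
      fix m
      show "stack_kernel \<sigma> n m * real m ^ 2 \<le> b m"
        using stack_kernel_le[of N m] unfolding b_def c_def Suc
        by (intro mult_mono power_mono) (auto simp: add.commute)
    qed auto
    also have "\<dots> = ennreal (suminf b)" using \<open>summable b\<close> b0 by (intro suminf_ennreal2)
    finally show "(\<Sum>m. ennreal (stack_kernel \<sigma> n m * real m ^ 2)) \<le> ennreal (suminf b)" .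
  qed
qed

section \<open>The kernel averaged over random stacks\<close>

abbreviation seq_space :: "(nat \<Rightarrow> real) measure" where
  "seq_space \<equiv> Pi\<^sub>M UNIV (\<lambda>_. borel)"

lemma (in cookie_stack) stack_kernel_le_1: "stack_kernel \<sigma> n m \<le> 1"
  using sum_le_suminf[of "stack_kernel \<sigma> n" "{m}"] stack_kernel_sums_1[of n] stack_kernel_nonneg
  by (simp add: sums_iff)

lemma measurable_left_count [measurable]: "(\<lambda>\<sigma>. left_count \<sigma> j l) \<in> borel_measurable seq_space"
  by (induction j arbitrary: l) auto

lemma measurable_stack_kernel [measurable]: "(\<lambda>\<sigma>. stack_kernel \<sigma> n m) \<in> borel_measurable seq_space"
  by (cases n) (auto simp: stack_kernel.simps)

text \<open>Stacks are kept abstract because this is instantiated twice, with the environment itself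
  and with its reflection.\<close>

locale random_stacks = prob_space P for P :: "'p measure" +
  fixes S :: "int \<Rightarrow> 'p \<Rightarrow> nat \<Rightarrow> real" and M :: nat
  assumes indep_stacks: "indep_vars (\<lambda>_. seq_space) S UNIV"
    and ident: "distr P seq_space (S z) = distr P seq_space (S 0)"
    and range01: "p \<in> space P \<Longrightarrow> 0 \<le> S z p i \<and> S z p i \<le> 1"
    and fair: "AE p in P. \<forall>z. \<forall>i\<ge>M. S z p i = 1 / 2"
    and right_pos: "0 < prob {p \<in> space P. \<forall>i. 0 < S 0 p i}"
    and left_pos: "0 < prob {p \<in> space P. \<forall>i. S 0 p i < 1}"
begin

lemma measurable_S [measurable]: "S z \<in> P \<rightarrow>\<^sub>M seq_space"
  using indep_stacks by (simp add: indep_vars_def)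

lemma measurable_S_component [measurable]: "(\<lambda>p. S z p i) \<in> borel_measurable P"
  using measurable_compose[OF measurable_S measurable_component_singleton[of i UNIV "\<lambda>_. borel"]] by simp

lemma measurable_kernel_S [measurable]: "(\<lambda>p. stack_kernel (S z p) n m) \<in> borel_measurable P"
  using measurable_compose[OF measurable_S measurable_stack_kernel] by simp

lemma AE_cookie_stack: "AE p in P. cookie_stack (S z p) M"
  using fair AE_space by eventually_elim (auto simp: cookie_stack_def range01)

definition kern :: "nat \<Rightarrow> nat pmf" where
  "kern n = embed_pmf (\<lambda>m. \<integral>p. stack_kernel (S 0 p) n m \<partial>P)"

definition stack_drift :: real where
  "stack_drift = (\<integral>p. (\<Sum>i<M. 2 * S 0 p i - 1) \<partial>P)"

definition drift_gf :: "real \<Rightarrow> real" where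
  "drift_gf y = (\<integral>p. (\<Prod>i<M. 1 - (2 * S 0 p i - 1) * y) \<partial>P)"

lemma ennreal_kernel_integral:
  "ennreal (\<integral>p. stack_kernel (S z p) n m \<partial>P) = (\<integral>\<^sup>+p. ennreal (stack_kernel (S z p) n m) \<partial>P)"
proof (rule nn_integral_eq_integral[symmetric])
  show "AE p in P. 0 \<le> stack_kernel (S z p) n m"
    using AE_cookie_stack[of z] by eventually_elim (rule cookie_stack.stack_kernel_nonneg)
  have "AE p in P. norm (stack_kernel (S z p) n m) \<le> 1"
    using AE_cookie_stack[of z] by eventually_elim
      (simp add: cookie_stack.stack_kernel_nonneg cookie_stack.stack_kernel_le_1)
  then show "integrable P (\<lambda>p. stack_kernel (S z p) n m)"
    by (intro integrable_const_bound[of _ 1]) auto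
qed

lemma pmf_kern: "pmf (kern n) m = (\<integral>p. stack_kernel (S 0 p) n m \<partial>P)"
  unfolding kern_def
proof (rule pmf_embed_pmf)
  show "0 \<le> (\<integral>p. stack_kernel (S 0 p) n x \<partial>P)" for x
    using AE_cookie_stack[of 0]
    by (intro integral_nonneg_AE) (auto elim!: eventually_mono simp: cookie_stack.stack_kernel_nonneg)
  have "(\<integral>\<^sup>+x. ennreal (\<integral>p. stack_kernel (S 0 p) n x \<partial>P) \<partial>count_space UNIV)
    = (\<integral>\<^sup>+p. (\<Sum>x. ennreal (stack_kernel (S 0 p) n x)) \<partial>P)"
    unfolding ennreal_kernel_integral nn_integral_count_space_nat by (rule nn_integral_suminf[symmetric]) simp
  also have "\<dots> = (\<integral>\<^sup>+p. 1 \<partial>P)"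
  proof (rule nn_integral_cong_AE)
    show "AE p in P. (\<Sum>x. ennreal (stack_kernel (S 0 p) n x)) = 1"
      using AE_cookie_stack[of 0]
    proof eventually_elim
      case (elim p)
      then interpret cookie_stack "S 0 p" M .
      show ?case using stack_kernel_sums_1[of n] stack_kernel_nonneg[of n]
        by (subst suminf_ennreal2) (auto simp: sums_iff)
    qed
  qed
  finally show "(\<integral>\<^sup>+x. ennreal (\<integral>p. stack_kernel (S 0 p) n x \<partial>P) \<partial>count_space UNIV) = 1"
    by (simp add: emeasure_space_1)
qed

lemma nn_integral_kern:
  "(\<integral>\<^sup>+m. f m \<partial>kern n) = (\<integral>\<^sup>+p. (\<Sum>m. ennreal (stack_kernel (S 0 p) n m) * f m) \<partial>P)"
  unfolding nn_integral_measure_pmf nn_integral_count_space_nat pmf_kern ennreal_kernel_integral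
  by (subst nn_integral_suminf) (auto simp: nn_integral_multc)

lemma nn_integral_kern_sums:
  assumes "\<And>m. 0 \<le> f m"
    and "\<And>p. cookie_stack (S 0 p) M \<Longrightarrow> (\<lambda>m. stack_kernel (S 0 p) n m * f m) sums g p"
  shows "(\<integral>\<^sup>+m. ennreal (f m) \<partial>kern n) = (\<integral>\<^sup>+p. ennreal (g p) \<partial>P)"
  unfolding nn_integral_kern
proof (rule nn_integral_cong_AE)
  show "AE p in P. (\<Sum>m. ennreal (stack_kernel (S 0 p) n m) * ennreal (f m)) = ennreal (g p)"
    using AE_cookie_stack[of 0]
  proof eventually_elim
    case (elim p)
    then interpret cookie_stack "S 0 p" M .
    show ?case using assms(2)[OF elim] assms(1) stack_kernel_nonneg
      by (subst ennreal_mult[symmetric]) (auto simp: suminf_ennreal2 sums_iff)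
  qed
qed

lemma integral_bounds:
  fixes f :: "'p \<Rightarrow> real"
  assumes [measurable]: "f \<in> borel_measurable P" and "\<And>p. cookie_stack (S 0 p) M \<Longrightarrow> a \<le> f p \<and> f p \<le> b"
  shows "integrable P f" "a \<le> (\<integral>p. f p \<partial>P)" "(\<integral>p. f p \<partial>P) \<le> b"
proof -
  have AE: "AE p in P. a \<le> f p \<and> f p \<le> b"
    using AE_cookie_stack[of 0] by eventually_elim (rule assms(2))
  show int: "integrable P f"
  proof (rule integrable_const_bound[of _ "\<bar>a\<bar> + \<bar>b\<bar>"])
    show "AE p in P. norm (f p) \<le> \<bar>a\<bar> + \<bar>b\<bar>" using AE by eventually_elim auto
  qed simp
  have "(\<integral>p. a \<partial>P) \<le> (\<integral>p. f p \<partial>P)" using AE int by (intro integral_mono_AE) (auto elim!: eventually_mono)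
  then show "a \<le> (\<integral>p. f p \<partial>P)" by (simp add: prob_space)
  have "(\<integral>p. f p \<partial>P) \<le> (\<integral>p. b \<partial>P)" using AE int by (intro integral_mono_AE) (auto elim!: eventually_mono)
  then show "(\<integral>p. f p \<partial>P) \<le> b" by (simp add: prob_space)
qed

lemma drift_integral:
  "integrable P (\<lambda>p. \<Sum>i<M. 2 * S 0 p i - 1)" "\<bar>stack_drift\<bar> \<le> real M"
proof -
  have b: "- real M \<le> (\<Sum>i<M. 2 * S 0 p i - 1) \<and> (\<Sum>i<M. 2 * S 0 p i - 1) \<le> real M"
    if "cookie_stack (S 0 p) M" for p
    using cookie_stack.drift_bound[OF that] by (simp add: cookie_stack.drift_def[OF that] abs_le_iff)
  show "integrable P (\<lambda>p. \<Sum>i<M. 2 * S 0 p i - 1)" "\<bar>stack_drift\<bar> \<le> real M"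
    using integral_bounds[of "\<lambda>p. \<Sum>i<M. 2 * S 0 p i - 1", OF _ b] unfolding stack_drift_def by auto
qed

lemma integral_pos_of_prob_pos:
  fixes f :: "'p \<Rightarrow> real"
  assumes int: "integrable P f" and nonneg: "AE p in P. 0 \<le> f p"
    and A: "{p \<in> space P. Q p} \<in> events" "0 < prob {p \<in> space P. Q p}" and pos: "AE p in P. Q p \<longrightarrow> 0 < f p"
  shows "0 < (\<integral>p. f p \<partial>P)"
proof -
  have "\<not> (AE p in P. f p = 0)"
  proof
    assume "AE p in P. f p = 0"
    then have "AE p in P. \<not> Q p" using pos by eventually_elim auto
    then have "prob {p \<in> space P. Q p} = 0" using A(1) by (subst (asm) AE_iff_measurable[OF _ refl]) (auto simp: emeasure_eq_measure)
    then show False using A(2) by simp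
  qed
  then have "(\<integral>p. f p \<partial>P) \<noteq> 0" using integral_nonneg_eq_0_iff_AE[OF int nonneg] by simp
  moreover have "0 \<le> (\<integral>p. f p \<partial>P)" using nonneg by (rule integral_nonneg_AE)
  ultimately show ?thesis by simp
qed

lemma integrable_kernel: "integrable P (\<lambda>p. stack_kernel (S 0 p) n m)"
  by (rule integral_bounds(1)[of _ 0 1])
     (auto simp: cookie_stack.stack_kernel_nonneg cookie_stack.stack_kernel_le_1)

text \<open>The constant serves two bounds: 4^M comes from \<open>prod_expansion\<close>, M^2 + M
  from the variance. In the latter the drift, at most M, is absorbed by 4^M.\<close>

lemma excursion_chain_kern:
  "excursion_chain kern M stack_drift (4 ^ M + (real M)\<^sup>2 + real M) drift_gf"
proof
  show "kern 0 = return_pmf 0"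
    by (rule pmf_eqI) (auto simp: pmf_kern pmf_return indicator_def prob_space)
next
  fix n
  have nonneg: "AE p in P. 0 \<le> stack_kernel (S 0 p) n m" for n m
    using AE_cookie_stack[of 0] by eventually_elim (rule cookie_stack.stack_kernel_nonneg)
  show "0 < pmf (kern n) 0" unfolding pmf_kern
    by (rule integral_pos_of_prob_pos[OF integrable_kernel nonneg _ left_pos])
       (use AE_cookie_stack[of 0] in \<open>auto elim!: eventually_mono intro: cookie_stack.stack_kernel_0_pos\<close>)
  show "0 < pmf (kern 1) m" if "M \<le> m" for m unfolding pmf_kern
    by (rule integral_pos_of_prob_pos[OF integrable_kernel nonneg _ right_pos])
       (use AE_cookie_stack[of 0] that in \<open>auto elim!: eventually_mono intro: cookie_stack.stack_kernel_1_pos[unfolded One_nat_def]\<close>)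
  obtain B where B: "0 \<le> B" "\<And>\<sigma>. cookie_stack \<sigma> M \<Longrightarrow> (\<Sum>m. ennreal (stack_kernel \<sigma> n m * real m ^ 2)) \<le> ennreal B"
    using stack_kernel_moment_bound[of M n] by blast
  have "(\<integral>\<^sup>+m. ennreal (real m ^ 2) \<partial>kern n) \<le> (\<integral>\<^sup>+p. ennreal B \<partial>P)"
    unfolding nn_integral_kern
  proof (rule nn_integral_mono_AE)
    show "AE p in P. (\<Sum>m. ennreal (stack_kernel (S 0 p) n m) * ennreal (real m ^ 2)) \<le> ennreal B"
      using AE_cookie_stack[of 0]
    proof eventually_elim
      case (elim p)
      then show ?case using B(2)[OF elim] cookie_stack.stack_kernel_nonneg[OF elim]
        by (simp add: ennreal_mult)
    qed
  qed
  then show "(\<integral>\<^sup>+m. ennreal (real m ^ 2) \<partial>kern n) < \<infinity>"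
    by (auto simp: emeasure_space_1 intro: le_less_trans)
next
  fix n and t :: real assume n: "M < n" and t: "0 \<le> t" "t \<le> 1"
  have "(\<integral>\<^sup>+m. ennreal (t ^ m) \<partial>kern n) = (\<integral>\<^sup>+p. ennreal ((\<Prod>i<M. 1 - (2 * S 0 p i - 1) * (1 - t)) / (2 - t) ^ n) \<partial>P)"
    using n t by (intro nn_integral_kern_sums cookie_stack.stack_kernel_pgf) auto
  also have "\<dots> = ennreal (\<integral>p. (\<Prod>i<M. 1 - (2 * S 0 p i - 1) * (1 - t)) / (2 - t) ^ n \<partial>P)"
  proof (rule nn_integral_eq_integral)
    have b: "0 \<le> (\<Prod>i<M. 1 - (2 * S 0 p i - 1) * (1 - t)) \<and> (\<Prod>i<M. 1 - (2 * S 0 p i - 1) * (1 - t)) \<le> 1 + real M + 4 ^ M"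
      if "cookie_stack (S 0 p) M" for p
    proof -
      interpret cookie_stack "S 0 p" M by fact
      have "\<bar>drift * (1 - t)\<bar> \<le> real M * 1" unfolding abs_mult using drift_bound t by (intro mult_mono) auto
      moreover have "4 ^ M * (1 - t)\<^sup>2 \<le> 4 ^ M * (1 :: real)" using t by (intro mult_left_mono power_le_one) auto
      ultimately show ?thesis
        using prod_factors_nonneg[of "1 - t" M] prod_expansion[of "1 - t" M] t
        unfolding drift_def[symmetric] abs_le_iff by linarith
    qed
    show "integrable P (\<lambda>p. (\<Prod>i<M. 1 - (2 * S 0 p i - 1) * (1 - t)) / (2 - t) ^ n)"
      by (intro integrable_divide integral_bounds(1)[OF _ b]) auto
    show "AE p in P. 0 \<le> (\<Prod>i<M. 1 - (2 * S 0 p i - 1) * (1 - t)) / (2 - t) ^ n"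
      using AE_cookie_stack[of 0] by eventually_elim (use b t in auto)
  qed
  finally show "(\<integral>\<^sup>+m. ennreal (t ^ m) \<partial>kern n) = ennreal (drift_gf (1 - t) / (2 - t) ^ n)"
    by (simp add: drift_gf_def)
next
  fix n assume n: "M < n"
  have pos: "0 \<le> real n + (\<Sum>i<M. 2 * S 0 p i - 1)" if "cookie_stack (S 0 p) M" for p
    using cookie_stack.drift_bound[OF that] n by (simp add: cookie_stack.drift_def[OF that] abs_le_iff)
  have "(\<integral>\<^sup>+m. ennreal (real m) \<partial>kern n) = (\<integral>\<^sup>+p. ennreal (real n + (\<Sum>i<M. 2 * S 0 p i - 1)) \<partial>P)"
    using cookie_stack.stack_kernel_mean[OF _ n] by (intro nn_integral_kern_sums) (auto simp: cookie_stack.drift_def)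
  also have "\<dots> = ennreal (\<integral>p. real n + (\<Sum>i<M. 2 * S 0 p i - 1) \<partial>P)"
    using drift_integral AE_cookie_stack[of 0] pos
    by (intro nn_integral_eq_integral) (auto elim!: eventually_mono)
  also have "(\<integral>p. real n + (\<Sum>i<M. 2 * S 0 p i - 1) \<partial>P) = real n + stack_drift"
    using drift_integral unfolding stack_drift_def by (subst Bochner_Integration.integral_add) (auto simp: prob_space)
  finally show "(\<integral>\<^sup>+m. ennreal (real m) \<partial>kern n) = ennreal (real n + stack_drift)" .
  have "(\<integral>\<^sup>+m. ennreal ((real m - real n)\<^sup>2) \<partial>kern n) \<le> (\<integral>\<^sup>+p. ennreal (2 * real n + (4 ^ M + (real M)\<^sup>2 + real M)) \<partial>P)"
    unfolding nn_integral_kern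
  proof (rule nn_integral_mono_AE)
    show "AE p in P. (\<Sum>m. ennreal (stack_kernel (S 0 p) n m) * ennreal ((real m - real n)\<^sup>2))
        \<le> ennreal (2 * real n + (4 ^ M + (real M)\<^sup>2 + real M))"
      using AE_cookie_stack[of 0]
    proof eventually_elim
      case (elim p)
      then interpret cookie_stack "S 0 p" M .
      obtain v where v: "(\<lambda>m. stack_kernel (S 0 p) n m * (real m - real n)\<^sup>2) sums v"
        "v \<le> 2 * real n + drift + (real M)\<^sup>2 + real M" using stack_kernel_variance[OF n] .
      have "real M \<le> 4 ^ M"
        using of_nat_less_two_power[of M, where 'a = real] power_mono[of 2 "4::real" M] by simp
      then have "v \<le> 2 * real n + (4 ^ M + (real M)\<^sup>2 + real M)"
        using v(2) drift_bound unfolding abs_le_iff by linarith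
      moreover have "(\<Sum>m. ennreal (stack_kernel (S 0 p) n m) * ennreal ((real m - real n)\<^sup>2)) = ennreal v"
        using v(1) stack_kernel_nonneg by (subst ennreal_mult[symmetric]) (auto simp: suminf_ennreal2 sums_iff)
      ultimately show ?case by (simp only: ennreal_leI)
    qed
  qed
  then show "(\<integral>\<^sup>+m. ennreal ((real m - real n)\<^sup>2) \<partial>kern n) \<le> ennreal (2 * real n + (4 ^ M + (real M)\<^sup>2 + real M))"
    by (simp add: emeasure_space_1)
next
  show "\<bar>stack_drift\<bar> \<le> real M" by (rule drift_integral)
next
  fix y :: real assume y: "0 \<le> y" "y \<le> 1"
  show "0 \<le> drift_gf y" unfolding drift_gf_def
    using AE_cookie_stack[of 0] y
    by (intro integral_nonneg_AE) (auto elim!: eventually_mono intro: cookie_stack.prod_factors_nonneg)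
  define f where "f p = (\<Prod>i<M. 1 - (2 * S 0 p i - 1) * y) - (1 - (\<Sum>i<M. 2 * S 0 p i - 1) * y)" for p
  have f: "- (4 ^ M * y\<^sup>2) \<le> f p \<and> f p \<le> 4 ^ M * y\<^sup>2" if "cookie_stack (S 0 p) M" for p
    using cookie_stack.prod_expansion[OF that y, of M] unfolding f_def by (simp add: abs_le_iff)
  have [measurable]: "f \<in> borel_measurable P" unfolding f_def by measurable
  note fb = integral_bounds[of f, OF _ f]
  have "drift_gf y = (\<integral>p. f p + (1 - (\<Sum>i<M. 2 * S 0 p i - 1) * y) \<partial>P)"
    unfolding drift_gf_def f_def by simp
  also have "\<dots> = (\<integral>p. f p \<partial>P) + (1 - stack_drift * y)"
    using fb(1) drift_integral(1) by (simp add: stack_drift_def prob_space)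
  finally have "\<bar>drift_gf y - (1 - stack_drift * y)\<bar> \<le> 4 ^ M * y\<^sup>2"
    using fb(2,3) by (simp add: abs_le_iff)
  also have "\<dots> \<le> (4 ^ M + (real M)\<^sup>2 + real M) * y\<^sup>2" by (intro mult_right_mono) auto
  finally show "\<bar>drift_gf y - (1 - stack_drift * y)\<bar> \<le> (4 ^ M + (real M)\<^sup>2 + real M) * y\<^sup>2" .
qed auto

end

section \<open>Walks driven by stacks of arrows\<close>

type_synonym arrows = "int \<times> nat \<Rightarrow> bool"

text \<open>The walk started at 0 uses the first unused arrow at its current position; \<open>True\<close> points to the
  right. The second component of the state counts the used arrows.\<close>

primrec walk :: "arrows \<Rightarrow> nat \<Rightarrow> int \<times> (int \<Rightarrow> nat)" where
  "walk a 0 = (0, \<lambda>_. 0)"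
| "walk a (Suc n) = (let (x, c) = walk a n in
     (if a (x, c x) then x + 1 else x - 1, c(x := Suc (c x))))"

definition pos :: "arrows \<Rightarrow> nat \<Rightarrow> int" where "pos a n = fst (walk a n)"
definition used :: "arrows \<Rightarrow> nat \<Rightarrow> int \<Rightarrow> nat" where "used a n = snd (walk a n)"

lemma pos_0 [simp]: "pos a 0 = 0" and used_0 [simp]: "used a 0 z = 0"
  by (simp_all add: pos_def used_def)

lemma pos_Suc: "pos a (Suc n) = (if a (pos a n, used a n (pos a n)) then pos a n + 1 else pos a n - 1)"
  and used_Suc: "used a (Suc n) = (used a n)(pos a n := Suc (used a n (pos a n)))"
  by (simp_all add: pos_def used_def Let_def split_beta)

lemma used_eq_card: "used a n z = card {i. i < n \<and> pos a i = z}"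
proof (induction n)
  case (Suc n)
  have "{i. i < Suc n \<and> pos a i = z} = {i. i < n \<and> pos a i = z} \<union> (if pos a n = z then {n} else {})"
    by (auto simp: less_Suc_eq)
  then show ?case using Suc by (auto simp: used_Suc)
qed simp

lemma abs_pos_le: "\<bar>pos a n\<bar> \<le> int n"
  by (induction n) (auto simp: pos_Suc)

section \<open>Excursions as total progeny, for a fixed arrow configuration\<close>

primrec lefts :: "(nat \<Rightarrow> bool) \<Rightarrow> nat \<Rightarrow> nat" where
  "lefts b 0 = 0"
| "lefts b (Suc j) = lefts b j + (if b j then 0 else 1)"

lemma lefts_le: "lefts b j \<le> j"
  by (induction j) auto

lemma lefts_cong: "(\<And>i. i < j \<Longrightarrow> b i = b' i) \<Longrightarrow> lefts b j = lefts b' j"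
  by (induction j) auto

lemma lefts_mono: "i \<le> j \<Longrightarrow> lefts b i \<le> lefts b j"
  by (induction j rule: dec_induct) auto

lemma rights_mono: "i \<le> j \<Longrightarrow> i - lefts b i \<le> j - lefts b j"
proof (induction j rule: dec_induct)
  case (step j)
  then show ?case using lefts_le[of b j] by auto
qed simp

text \<open>There are m right arrows before the n-th left one, which has index n + m - 1 since
  arrows are counted from 0. For n = 0 the site is never entered, whence m = 0.\<close>

definition left_stop :: "(nat \<Rightarrow> bool) \<Rightarrow> nat \<Rightarrow> nat \<Rightarrow> bool" where
  "left_stop b n m \<longleftrightarrow> (if n = 0 then m = 0
     else lefts b (n + m - 1) = n - 1 \<and> \<not> b (n + m - 1))"

lemma left_stop_lefts: "left_stop b n m \<Longrightarrow> lefts b (n + m) = n"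
  by (cases "n + m") (auto simp: left_stop_def split: if_splits)

lemma left_stop_unique: "left_stop b n m \<Longrightarrow> left_stop b n m' \<Longrightarrow> m = m'"
proof (induction m m' rule: linorder_wlog)
  case (le m m')
  show ?case
  proof (rule ccontr)
    assume "m \<noteq> m'"
    then have "n + m \<le> n + m' - 1" using le by auto
    from lefts_mono[OF this, of b] le show False
      using left_stop_lefts[OF le(2)] \<open>m \<noteq> m'\<close> by (auto simp: left_stop_def split: if_splits)
  qed
qed auto

text \<open>Pathwise counterpart of \<open>progeny\<close>: n is the number of steps from z to z +
  1, and only arrows to the right of z are read. It is a relation, as the stack at z + 1 may contain
  fewer than n left arrows.\<close>

fun total_progeny :: "arrows \<Rightarrow> int \<Rightarrow> nat \<Rightarrow> nat \<Rightarrow> bool" where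
  "total_progeny a z n l \<longleftrightarrow> (if n = 0 then l = 0 else if l < n then False
     else (\<exists>m. left_stop (\<lambda>i. a (z + 1, i)) n m \<and> total_progeny a (z + 1) m (l - n)))"

declare total_progeny.simps [simp del]

lemma total_progeny_0: "total_progeny a z 0 l \<longleftrightarrow> l = 0"
  by (simp add: total_progeny.simps)

lemma total_progeny_pos: "0 < n \<Longrightarrow> total_progeny a z n l \<longleftrightarrow>
    n \<le> l \<and> (\<exists>m. left_stop (\<lambda>i. a (z + 1, i)) n m \<and> total_progeny a (z + 1) m (l - n))"
  by (subst total_progeny.simps) auto

lemma total_progeny_unique: "total_progeny a z n l \<Longrightarrow> total_progeny a z n l' \<Longrightarrow> l = l'"
proof (induction l arbitrary: z n l' rule: less_induct)
  case (less l)
  show ?case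
  proof (cases "n = 0")
    case False
    obtain m m' where m: "left_stop (\<lambda>i. a (z + 1, i)) n m" "total_progeny a (z + 1) m (l - n)" "n \<le> l"
      and m': "left_stop (\<lambda>i. a (z + 1, i)) n m'" "total_progeny a (z + 1) m' (l' - n)" "n \<le> l'"
      using less(2,3) False by (auto simp: total_progeny_pos)
    have "m' = m" using left_stop_unique[OF m'(1) m(1)] .
    then have "l - n = l' - n" using less(1)[of "l - n" "z + 1" m "l' - n"] m m' False by auto
    then show ?thesis using m m' by simp
  qed (use less in \<open>simp add: total_progeny_0\<close>)
qed

lemma total_progenyI:
  assumes "\<And>k. left_stop (\<lambda>i. a (z + 1 + int k, i)) (v k) (v (Suc k))" "v K = 0"
  shows "total_progeny a z (v 0) (\<Sum>k<K. v k)"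
  using assms
proof (induction K arbitrary: z v)
  case (Suc K)
  have "total_progeny a (z + 1) (v (Suc 0)) (\<Sum>k<K. v (Suc k))"
    using Suc.prems(1)[of "Suc _"] Suc.prems(2) by (intro Suc.IH) (auto simp: add.assoc)
  moreover have "left_stop (\<lambda>i. a (z + 1, i)) (v 0) (v (Suc 0))" using Suc.prems(1)[of 0] by simp
  moreover have "(\<Sum>k<Suc K. v k) = v 0 + (\<Sum>k<K. v (Suc k))" by (rule sum.lessThan_Suc_shift)
  moreover have "(\<Sum>k<Suc K. v k) = 0" if "v 0 = 0"
  proof -
    note stop = Suc.prems(1)
    have "v k = 0" for k
    proof (induction k)
      case (Suc k)
      then show ?case using stop[of k] by (simp add: left_stop_def)
    qed (rule that)
    then show ?thesis by simp
  qed
  ultimately show ?case by (cases "v 0 = 0") (auto simp: total_progeny_0 total_progeny_pos)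
qed (simp add: total_progeny_0)

lemma total_progenyE:
  assumes "total_progeny a z n l"
  obtains v K where "v 0 = n" "\<And>k. left_stop (\<lambda>i. a (z + 1 + int k, i)) (v k) (v (Suc k))"
    "\<And>k. K \<le> k \<Longrightarrow> v k = 0" "(\<Sum>k<K. v k) = l"
proof -
  have "\<exists>v K. v 0 = n \<and> (\<forall>k. left_stop (\<lambda>i. a (z + 1 + int k, i)) (v k) (v (Suc k))) \<and>
     (\<forall>k\<ge>K. v k = 0) \<and> (\<Sum>k<K. v k) = l"
    using assms
  proof (induction l arbitrary: z n rule: less_induct)
    case (less l)
    show ?case
    proof (cases "n = 0")
      case True
      then show ?thesis using less(2)
        by (intro exI[of _ "\<lambda>_. 0"] exI[of _ 0]) (auto simp: total_progeny_0 left_stop_def)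
    next
      case False
      then obtain m where m: "left_stop (\<lambda>i. a (z + 1, i)) n m" "total_progeny a (z + 1) m (l - n)" "n \<le> l"
        using less(2) by (auto simp: total_progeny_pos)
      obtain v K where v: "v 0 = m" "\<And>k. left_stop (\<lambda>i. a (z + 1 + 1 + int k, i)) (v k) (v (Suc k))"
        "\<And>k. K \<le> k \<Longrightarrow> v k = 0" "(\<Sum>k<K. v k) = l - n"
        using less(1)[of "l - n" "z + 1" m] m False by auto
      have "left_stop (\<lambda>i. a (z + 1 + int k, i)) (case_nat n v k) (case_nat n v (Suc k))" for k
        using m(1) v(1) v(2)[of "k - 1"] by (cases k) (auto simp: add.assoc)
      moreover have "case_nat n v k = 0" if "Suc K \<le> k" for k using v(3) that by (cases k) auto
      moreover have "(\<Sum>k<Suc K. case_nat n v k) = l"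
        unfolding sum.lessThan_Suc_shift using v(4) m(3) by simp
      ultimately show ?thesis by (intro exI[of _ "case_nat n v"] exI[of _ "Suc K"]) auto
    qed
  qed
  then show ?thesis using that by blast
qed

definition first_return :: "(nat \<Rightarrow> int) \<Rightarrow> nat \<Rightarrow> bool" where
  "first_return x n \<longleftrightarrow> 0 < n \<and> x n = 0 \<and> (\<forall>i. 0 < i \<and> i < n \<longrightarrow> x i \<noteq> 0)"

text \<open>Crossings of the edge between k and k + 1 alternate in direction, starting upwards
  because the walk starts at 0 \<le> k.\<close>

lemma edge_flow:
  "0 \<le> k \<Longrightarrow> used a n k - lefts (\<lambda>i. a (k, i)) (used a n k)
    = lefts (\<lambda>i. a (k + 1, i)) (used a n (k + 1)) + of_bool (k < pos a n)"
proof (induction n)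
  case (Suc n)
  then show ?case
    using lefts_le[of "\<lambda>i. a (k, i)" "used a n k"]
    by (cases "pos a n = k"; cases "pos a n = k + 1") (auto simp: used_Suc pos_Suc)
qed simp

text \<open>After its last departure from z the walk stays on the side to which it left.\<close>

lemma last_arrow:
  "used a n z \<noteq> 0 \<Longrightarrow> pos a n \<noteq> z \<Longrightarrow> a (z, used a n z - 1) \<longleftrightarrow> z < pos a n"
proof (induction n)
  case (Suc n)
  then show ?case by (cases "pos a n = z") (auto simp: used_Suc pos_Suc split: if_splits)
qed simp

lemma pos_positive:
  assumes "a (0, 0)" "\<And>i. 0 < i \<Longrightarrow> i < n \<Longrightarrow> pos a i \<noteq> 0" "0 < i" "i < n"
  shows "0 < pos a i"
  using assms(3,4)
proof (induction i)
  case (Suc i)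
  show ?case
  proof (cases "i = 0")
    case True
    then show ?thesis using assms(1) by (simp add: pos_Suc)
  next
    case False
    then have "0 < pos a i" "pos a (Suc i) \<noteq> 0" using Suc assms(2) by auto
    then show ?thesis by (auto simp: pos_Suc split: if_splits)
  qed
qed simp

lemma sum_used:
  assumes "\<And>i. i < n \<Longrightarrow> 0 \<le> pos a i \<and> pos a i \<le> int K"
  shows "(\<Sum>k\<le>K. used a n (int k)) = n"
  using assms
proof (induction n)
  case (Suc n)
  have "(\<Sum>k\<le>K. used a (Suc n) (int k)) = (\<Sum>k\<le>K. used a n (int k) + of_bool (k = nat (pos a n)))"
    using Suc.prems[of n] by (intro sum.cong) (auto simp: used_Suc)
  also have "\<dots> = Suc n"
  proof -
    have "nat (pos a n) \<le> K" using Suc.prems[of n] by auto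
    moreover have "(\<Sum>k\<le>K. used a n (int k)) = n" by (rule Suc.IH) (use Suc.prems in simp)
    ultimately show ?thesis by (simp add: sum.distrib of_bool_def sum.delta)
  qed
  finally show ?case .
qed simp

text \<open>Let v k be the number of steps from k to k + 1 up to T. The walk ends at 0, so v k is
  also the number of left steps from k + 1 and the last departure from k + 1 is to the left: this is
  \<open>left_stop\<close>. Every edge is crossed equally often both ways, so T is twice the
  sum.\<close>

lemma excursion_total_progeny:
  assumes a0: "a (0, 0)" and ret: "first_return (pos a) T"
  shows "\<exists>l. T = 2 * l \<and> total_progeny a 0 1 l"
proof -
  have T: "0 < T" "pos a T = 0" "\<And>i. 0 < i \<Longrightarrow> i < T \<Longrightarrow> pos a i \<noteq> 0"
    using ret by (auto simp: first_return_def)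
  have posi: "0 < pos a i" if "0 < i" "i < T" for i using pos_positive[of a T i] a0 T(3) that by blast
  have nonneg: "0 \<le> pos a i" if "i < T" for i using posi[of i] that by (cases i) auto
  define v where "v k = used a T (int k) - lefts (\<lambda>i. a (int k, i)) (used a T (int k))" for k
  have v_lefts: "v k = lefts (\<lambda>i. a (int k + 1, i)) (used a T (int k + 1))" for k
    unfolding v_def using edge_flow[of "int k" a T] T(2) by simp
  have used_v: "used a T (int k + 1) = v k + v (Suc k)" for k
  proof -
    have "v (Suc k) = used a T (int k + 1) - lefts (\<lambda>i. a (int k + 1, i)) (used a T (int k + 1))"
      by (simp add: v_def add.commute)
    then show ?thesis
      using lefts_le[of "\<lambda>i. a (int k + 1, i)" "used a T (int k + 1)"] by (simp add: v_lefts[of k])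
  qed
  have used0: "used a T 0 = 1"
  proof -
    have "{i. i < T \<and> pos a i = 0} = {0}" using T by (auto simp: not_less)
    then show ?thesis by (simp add: used_eq_card)
  qed
  have v0: "v 0 = 1" using a0 by (simp add: v_def used0)
  have stop: "left_stop (\<lambda>i. a (0 + 1 + int k, i)) (v k) (v (Suc k))" for k
  proof -
    define c where "c = used a T (int k + 1)"
    have c: "c = v k + v (Suc k)" "v k = lefts (\<lambda>i. a (int k + 1, i)) c"
      unfolding c_def by (rule used_v, rule v_lefts)
    show ?thesis
    proof (cases "c = 0")
      case False
      have na: "\<not> a (int k + 1, c - 1)"
        using last_arrow[of a T "int k + 1"] False T(2) by (simp add: c_def)
      have "lefts (\<lambda>i. a (int k + 1, i)) (Suc (c - 1)) = lefts (\<lambda>i. a (int k + 1, i)) (c - 1) + 1"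
        using na by simp
      then have "lefts (\<lambda>i. a (int k + 1, i)) (c - 1) = v k - 1" "v k \<noteq> 0" using False c(2) by simp_all
      then show ?thesis using na c(1) by (simp add: left_stop_def add.commute)
    next
      case True
      then have "v k = 0" "v (Suc k) = 0" using c(1) by linarith+
      then show ?thesis by (simp add: left_stop_def)
    qed
  qed
  have used_0_far: "used a T (int k) = 0" if "T \<le> k" for k
  proof -
    have "{i. i < T \<and> pos a i = int k} = {}"
    proof (intro equals0I)
      fix i assume "i \<in> {i. i < T \<and> pos a i = int k}"
      then show False using abs_pos_le[of a i] that by auto
    qed
    then show ?thesis by (simp add: used_eq_card)
  qed
  have vT: "v T = 0" by (simp add: v_def used_0_far)
  have "T = (\<Sum>k\<le>T. used a T (int k))"
  proof (rule sum_used[symmetric])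
    fix i assume "i < T"
    then show "0 \<le> pos a i \<and> pos a i \<le> int T" using nonneg[of i] abs_pos_le[of a i] by linarith
  qed
  also have "\<dots> = used a T 0 + (\<Sum>k<T. used a T (int k + 1))"
    by (subst sum.atMost_shift) (simp add: add.commute)
  also have "\<dots> = 1 + (\<Sum>k<T. v k) + (\<Sum>k<T. v (Suc k))"
    by (simp add: used0 used_v sum.distrib)
  also have "(\<Sum>k<T. v k) + v T = v 0 + (\<Sum>k<T. v (Suc k))"
    using sum.lessThan_Suc_shift[of v T] by simp
  then have "1 + (\<Sum>k<T. v k) + (\<Sum>k<T. v (Suc k)) = 2 * (\<Sum>k<T. v k)"
    using v0 vT by simp
  finally have "T = 2 * (\<Sum>k<T. v k)" .
  moreover have "total_progeny a 0 (v 0) (\<Sum>k<T. v k)"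
    using stop vT by (rule total_progenyI)
  ultimately show ?thesis using v0 by auto
qed

text \<open>The difficulty is that a return must be shown to exist. Before returning, the walk never
  uses more than v k + v (k + 1) arrows at k + 1 and one at 0, which bounds the time by 2 l. The
  value of T then follows from the converse and uniqueness.\<close>

lemma total_progeny_excursion:
  assumes a0: "a (0, 0)" and tot: "total_progeny a 0 1 l"
  shows "first_return (pos a) (2 * l)"
proof -
  obtain v K where v: "v 0 = 1" "\<And>k. left_stop (\<lambda>i. a (0 + 1 + int k, i)) (v k) (v (Suc k))"
    "\<And>k. K \<le> k \<Longrightarrow> v k = 0" "(\<Sum>k<K. v k) = l"
    using total_progenyE[OF tot] by blast
  have lefts_v: "lefts (\<lambda>i. a (int k + 1, i)) (v k + v (Suc k)) = v k" for k
    using left_stop_lefts[OF v(2)[of k]] by (simp add: add.commute)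
  have bound: "used a n 0 \<le> 1 \<and> (\<forall>k. used a n (int k + 1) \<le> v k + v (Suc k))"
    if "\<And>i. 0 < i \<Longrightarrow> i < n \<Longrightarrow> pos a i \<noteq> 0" for n
    using that
  proof (induction n)
    case (Suc n)
    then have IH: "used a n 0 \<le> 1" "\<And>k. used a n (int k + 1) \<le> v k + v (Suc k)" by auto
    show ?case
    proof (cases "n = 0")
      case True
      then show ?thesis by (auto simp: used_Suc)
    next
      case False
      have "0 < pos a n" using pos_positive[of a "Suc n" n] a0 Suc.prems False by auto
      then obtain p where p: "pos a n = int p + 1" by (metis add.commute zero_less_imp_eq_int add_diff_cancel_left' diff_add_cancel of_nat_Suc gr0_implies_Suc)
      have "used a n (int p + 1) \<noteq> v p + v (Suc p)"
      proof
        assume eq: "used a n (int p + 1) = v p + v (Suc p)"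
        \<comment> \<open>If the walk stood at p + 1 with its whole supply used, it would have made
          v p + 1 right steps from p, but the supply at p holds only v p right arrows.\<close>
        have 1: "used a n (int p) - lefts (\<lambda>i. a (int p, i)) (used a n (int p)) = v p + 1"
          using edge_flow[of "int p" a n] p by (simp add: eq lefts_v)
        show False
        proof (cases p)
          case 0
          then show False using 1 IH(1) v(1) by simp
        next
          case (Suc r)
          have "used a n (int p) - lefts (\<lambda>i. a (int p, i)) (used a n (int p))
            \<le> (v r + v p) - lefts (\<lambda>i. a (int p, i)) (v r + v p)"
            using IH(2)[of r] by (intro rights_mono) (simp add: Suc add.commute)
          also have "\<dots> = v p" using lefts_v[of r] by (simp add: Suc add.commute)
          finally show False using 1 by simp
        qed
      qed
      then have "used a n (int p + 1) < v p + v (Suc p)" using IH(2)[of p] by simp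
      then show ?thesis using IH p by (auto simp: used_Suc)
    qed
  qed simp
  have "\<exists>T. first_return (pos a) T"
  proof (rule ccontr)
    assume none: "\<nexists>T. first_return (pos a) T"
    have nz: "pos a i \<noteq> 0" if "0 < i" for i
      using that
    proof (induction i rule: less_induct)
      case (less i)
      then show ?case using none by (auto simp: first_return_def)
    qed
    \<comment> \<open>One step more than the total supply of arrows.\<close>
    define n where "n = 2 * l + 1"
    define L where "L = max n K"
    have "n = (\<Sum>k\<le>L. used a n (int k))"
    proof (rule sum_used[symmetric])
      fix i assume "i < n"
      moreover have "0 \<le> pos a i" using pos_positive[of a "Suc i" i] a0 nz by (cases i) (auto simp: less_imp_le)
      ultimately show "0 \<le> pos a i \<and> pos a i \<le> int L" using abs_pos_le[of a i] by (auto simp: L_def)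
    qed
    also have "\<dots> = used a n 0 + (\<Sum>k<L. used a n (int k + 1))"
      by (subst sum.atMost_shift) (simp add: add.commute)
    also have "\<dots> \<le> 1 + (\<Sum>k<L. v k + v (Suc k))"
      using bound[of n] nz by (intro add_mono sum_mono) auto
    also have "\<dots> = 2 * (\<Sum>k<L. v k)"
    proof -
      have "(\<Sum>k<L. v k) + v L = v 0 + (\<Sum>k<L. v (Suc k))" using sum.lessThan_Suc_shift[of v L] by simp
      moreover have "v L = 0" using v(3) by (simp add: L_def)
      ultimately show ?thesis using v(1) by (simp add: sum.distrib)
    qed
    also have "(\<Sum>k<L. v k) = l"
      unfolding v(4)[symmetric] using v(3) by (intro sum.mono_neutral_right) (auto simp: L_def)
    finally show False by (simp add: n_def)
  qed
  then obtain T where T: "first_return (pos a) T" ..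
  obtain l' where "T = 2 * l'" "total_progeny a 0 1 l'" using excursion_total_progeny[OF a0 T] by blast
  then show ?thesis using T total_progeny_unique[OF tot] by auto
qed

lemma first_return_iff:
  "pos a 1 = 1 \<and> first_return (pos a) n \<longleftrightarrow> a (0, 0) \<and> even n \<and> total_progeny a 0 1 (n div 2)"
  using excursion_total_progeny[of a n] total_progeny_excursion[of a "n div 2"]
  by (auto simp: pos_Suc split: if_splits)

section \<open>Random arrows\<close>

lemma (in prob_space) nn_integral_indep_disjoint:
  fixes f g :: "('i \<Rightarrow> 'b) \<Rightarrow> ennreal"
  assumes ind: "indep_vars M' X UNIV"
    and [measurable]: "f \<in> borel_measurable (PiM UNIV M')" "g \<in> borel_measurable (PiM UNIV M')"
    and disj: "J \<inter> J' = {}"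
    and dep_f: "\<And>x y. (\<And>j. j \<in> J \<Longrightarrow> x j = y j) \<Longrightarrow> f x = f y"
    and dep_g: "\<And>x y. (\<And>j. j \<in> J' \<Longrightarrow> x j = y j) \<Longrightarrow> g x = g y"
  shows "(\<integral>\<^sup>+\<omega>. f (\<lambda>i. X i \<omega>) * g (\<lambda>i. X i \<omega>) \<partial>M)
    = (\<integral>\<^sup>+\<omega>. f (\<lambda>i. X i \<omega>) \<partial>M) * (\<integral>\<^sup>+\<omega>. g (\<lambda>i. X i \<omega>) \<partial>M)"
proof -
  \<comment> \<open>The values of the variables at one outcome are admissible defaults. Filling the
    coordinates outside J with them turns f and g into functions of the restricted families, whose
    independence is known.\<close>
  obtain \<omega>0 where \<omega>0: "\<omega>0 \<in> space M" using not_empty by blast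
  define d where "d i = X i \<omega>0" for i
  have rv: "random_variable (M' i) (X i)" for i using ind by (simp add: indep_vars_def)
  have d: "d i \<in> space (M' i)" for i unfolding d_def using measurable_space[OF rv \<omega>0] .
  define e where "e J x i = (if i \<in> J then x i else d i)" for J and x :: "'i \<Rightarrow> 'b" and i
  have e [measurable]: "e J \<in> PiM J M' \<rightarrow>\<^sub>M PiM UNIV M'" for J
    unfolding e_def[abs_def]
  proof (rule measurable_abs_UNIV)
    fix i
    show "(\<lambda>x. if i \<in> J then x i else d i) \<in> PiM J M' \<rightarrow>\<^sub>M M' i"
      using d[of i] by (cases "i \<in> J") auto
  qed
  have "indep_var borel ((\<lambda>x. f (e J x)) \<circ> (\<lambda>\<omega>. restrict (\<lambda>i. X i \<omega>) J))
      borel ((\<lambda>x. g (e J' x)) \<circ> (\<lambda>\<omega>. restrict (\<lambda>i. X i \<omega>) J'))"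
    by (rule indep_var_compose[OF indep_var_restrict[OF ind disj]]) auto
  moreover have "(\<lambda>x. f (e J x)) \<circ> (\<lambda>\<omega>. restrict (\<lambda>i. X i \<omega>) J) = (\<lambda>\<omega>. f (\<lambda>i. X i \<omega>))"
    by (auto simp: e_def fun_eq_iff intro!: dep_f)
  moreover have "(\<lambda>x. g (e J' x)) \<circ> (\<lambda>\<omega>. restrict (\<lambda>i. X i \<omega>) J') = (\<lambda>\<omega>. g (\<lambda>i. X i \<omega>))"
    by (auto simp: e_def fun_eq_iff intro!: dep_g)
  ultimately have *: "indep_var borel (\<lambda>\<omega>. f (\<lambda>i. X i \<omega>)) borel (\<lambda>\<omega>. g (\<lambda>i. X i \<omega>))" by simp
  have "case_bool borel borel = (\<lambda>_. borel :: ennreal measure)" by (auto split: bool.split)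
  then have "indep_vars (\<lambda>_. borel) (case_bool (\<lambda>\<omega>. f (\<lambda>i. X i \<omega>)) (\<lambda>\<omega>. g (\<lambda>i. X i \<omega>))) UNIV"
    using * by (simp add: indep_var_def)
  from indep_vars_nn_integral[OF _ this] show ?thesis by (simp add: UNIV_bool ac_simps)
qed

abbreviation arrow_space :: "arrows measure" where
  "arrow_space \<equiv> Pi\<^sub>M UNIV (\<lambda>_. count_space UNIV)"

lemma measurable_arrow [measurable]: "(\<lambda>a. a j) \<in> arrow_space \<rightarrow>\<^sub>M count_space UNIV"
  by (rule measurable_component_singleton) simp

lemma measurable_lefts [measurable]:
  "(\<lambda>a. lefts (\<lambda>i. a (z, i)) j) \<in> arrow_space \<rightarrow>\<^sub>M count_space UNIV"
  by (induction j) auto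

lemma pred_left_stop [measurable]: "Measurable.pred arrow_space (\<lambda>a. left_stop (\<lambda>i. a (z, i)) n m)"
  unfolding left_stop_def by (cases "n = 0") auto

lemma pred_total_progeny [measurable]: "Measurable.pred arrow_space (\<lambda>a. total_progeny a z n l)"
proof (induction l arbitrary: z n rule: less_induct)
  case (less l)
  show ?case
  proof (cases "n = 0 \<or> l < n")
    case True
    then show ?thesis by (cases "n = 0") (auto simp: total_progeny_0 total_progeny_pos)
  next
    case False
    then have [measurable]: "Measurable.pred arrow_space (\<lambda>a. total_progeny a (z + 1) m (l - n))" for m
      by (intro less) auto
    show ?thesis using False by (simp add: total_progeny_pos)
  qed
qed

lemma total_progeny_cong:
  "(\<And>z' i. z < z' \<Longrightarrow> a (z', i) = b (z', i)) \<Longrightarrow> total_progeny a z n l = total_progeny b z n l"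
proof (induction l arbitrary: z n rule: less_induct)
  case (less l)
  show ?case
  proof (cases "n = 0 \<or> l < n")
    case False
    then have "total_progeny a (z + 1) m (l - n) = total_progeny b (z + 1) m (l - n)" for m
      using less by auto
    moreover have "(\<lambda>i. a (z + 1, i)) = (\<lambda>i. b (z + 1, i))" using less(2) by auto
    ultimately show ?thesis using False by (simp add: total_progeny_pos)
  qed (auto simp: total_progeny_0 total_progeny_pos)
qed

text \<open>The present visit is not counted, so the value is one less than \<open>visits\<close>,
  matching arrows that are indexed from 0.\<close>

definition visits_before :: "(nat \<Rightarrow> int) \<Rightarrow> nat \<Rightarrow> nat" where
  "visits_before x n = card {i. i < n \<and> x i = x n}"

text \<open>Following a prescribed path fixes finitely many arrows at indices known in advance,
  which is what makes independence applicable.\<close>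

lemma pos_path_iff:
  "(\<forall>i\<le>n. pos a i = x i) \<longleftrightarrow>
    x 0 = 0 \<and> (\<forall>i<n. x (Suc i) = (if a (x i, visits_before x i) then x i + 1 else x i - 1))"
proof (induction n)
  case (Suc n)
  define t where "t i = (if a (x i, visits_before x i) then x i + 1 else x i - 1)" for i
  have t: "pos a (Suc n) = t n" if "\<forall>i\<le>n. pos a i = x i"
  proof -
    have "{i. i < n \<and> pos a i = x n} = {i. i < n \<and> x i = x n}" using that by auto
    moreover have "pos a n = x n" using that by simp
    ultimately show ?thesis by (simp add: pos_Suc used_eq_card visits_before_def t_def)
  qed
  have "(\<forall>i\<le>Suc n. pos a i = x i) \<longleftrightarrow> (\<forall>i\<le>n. pos a i = x i) \<and> pos a (Suc n) = x (Suc n)"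
    by (metis le_Suc_eq)
  also have "\<dots> \<longleftrightarrow> (\<forall>i\<le>n. pos a i = x i) \<and> x (Suc n) = t n"
    using t by metis
  also have "\<dots> \<longleftrightarrow> x 0 = 0 \<and> (\<forall>i<n. x (Suc i) = t i) \<and> x (Suc n) = t n"
    using Suc.IH unfolding t_def by blast
  also have "(\<forall>i<n. x (Suc i) = t i) \<and> x (Suc n) = t n \<longleftrightarrow> (\<forall>i<Suc n. x (Suc i) = t i)"
    by (metis less_Suc_eq)
  finally show ?case unfolding t_def .
qed auto

section \<open>Path and progeny probabilities in a fixed environment\<close>

primrec path_prob :: "(int \<Rightarrow> nat \<Rightarrow> real) \<Rightarrow> (nat \<Rightarrow> int) \<Rightarrow> nat \<Rightarrow> real" where
  "path_prob q x 0 = of_bool (x 0 = 0)"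
| "path_prob q x (Suc n) = path_prob q x n *
     (if x (Suc n) = x n + 1 then q (x n) (visits_before x n)
      else if x (Suc n) = x n - 1 then 1 - q (x n) (visits_before x n) else 0)"

lemma path_prob_reflect: "path_prob q (\<lambda>i. - x i) n = path_prob (\<lambda>z i. 1 - q (- z) i) x n"
  by (induction n) (auto simp: visits_before_def)

function quenched_progeny :: "(int \<Rightarrow> nat \<Rightarrow> real) \<Rightarrow> int \<Rightarrow> nat \<Rightarrow> nat \<Rightarrow> ennreal" where
  "quenched_progeny q z n l = (if n = 0 then of_bool (l = 0) else if l < n then 0
     else (\<Sum>m. ennreal (stack_kernel (q (z + 1)) n m) * quenched_progeny q (z + 1) m (l - n)))"
  by auto
termination by (relation "Wellfounded.measure (\<lambda>(q, z, n, l). l)") auto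

declare quenched_progeny.simps [simp del]

lemma quenched_progeny_0: "quenched_progeny q z 0 l = of_bool (l = 0)"
  by (subst quenched_progeny.simps) simp

lemma quenched_progeny_less: "l < n \<Longrightarrow> quenched_progeny q z n l = 0"
  by (subst quenched_progeny.simps) simp

lemma quenched_progeny_pos: "0 < n \<Longrightarrow> n \<le> l \<Longrightarrow> quenched_progeny q z n l
    = (\<Sum>m. ennreal (stack_kernel (q (z + 1)) n m) * quenched_progeny q (z + 1) m (l - n))"
  by (subst quenched_progeny.simps) simp

lemma quenched_progeny_cong:
  "(\<And>z'. z < z' \<Longrightarrow> q z' = q' z') \<Longrightarrow> quenched_progeny q z n l = quenched_progeny q' z n l"
proof (induction l arbitrary: z n rule: less_induct)
  case (less l)
  show ?case
  proof (cases "n = 0 \<or> l < n")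
    case False
    then have "quenched_progeny q (z + 1) m (l - n) = quenched_progeny q' (z + 1) m (l - n)" for m
      using less by auto
    moreover have "q (z + 1) = q' (z + 1)" using less(2) by auto
    ultimately show ?thesis using False by (simp add: quenched_progeny_pos)
  next
    case True
    then show ?thesis by (cases "n = 0") (simp_all add: quenched_progeny_0 quenched_progeny_less)
  qed
qed

lemma measurable_quenched_progeny [measurable]:
  "(\<lambda>q. quenched_progeny q z n l) \<in> borel_measurable (PiM UNIV (\<lambda>_. seq_space))"
proof (induction l arbitrary: z n rule: less_induct)
  case (less l)
  show ?case
  proof (cases "n = 0 \<or> l < n")
    case False
    then have [measurable]: "(\<lambda>q. quenched_progeny q (z + 1) m (l - n)) \<in> borel_measurable (PiM UNIV (\<lambda>_. seq_space))" for m
      by (intro less) auto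
    have "(\<lambda>q. q (z + 1)) \<in> PiM UNIV (\<lambda>_. seq_space) \<rightarrow>\<^sub>M seq_space"
      by (rule measurable_component_singleton) simp
    from measurable_compose[OF this measurable_stack_kernel]
    have [measurable]: "(\<lambda>q. stack_kernel (q (z + 1)) n m) \<in> borel_measurable (PiM UNIV (\<lambda>_. seq_space))" for m .
    show ?thesis using False by (simp add: quenched_progeny_pos)
  next
    case True
    then show ?thesis by (cases "n = 0") (simp_all add: quenched_progeny_0 quenched_progeny_less)
  qed
qed

text \<open>Independent Bernoulli arrows realise the quenched walk in such a way that each site
  carries its own randomness. Crossing numbers can then be computed site by site.\<close>

locale arrow_law =
  fixes q :: "int \<Rightarrow> nat \<Rightarrow> real"
  assumes q01: "0 \<le> q z i" "q z i \<le> 1"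
begin

definition arrow_pmf :: "int \<times> nat \<Rightarrow> bool measure" where
  "arrow_pmf = (\<lambda>(z, i). measure_pmf (bernoulli_pmf (q z i)))"

definition arrow_measure :: "arrows measure" where
  "arrow_measure = Pi\<^sub>M UNIV arrow_pmf"

sublocale product_prob_space arrow_pmf UNIV
  by (rule product_prob_spaceI) (auto simp: arrow_pmf_def measure_pmf.prob_space_axioms)

lemma sets_arrow_pmf: "sets (arrow_pmf j) = sets (count_space UNIV)" "space (arrow_pmf j) = UNIV"
  by (auto simp: arrow_pmf_def split: prod.split)

lemma sets_arrow_measure [measurable_cong]: "sets arrow_measure = sets arrow_space"
  unfolding arrow_measure_def by (intro sets_PiM_cong) (simp_all add: sets_arrow_pmf)

lemma space_arrow_measure [simp]: "space arrow_measure = UNIV"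
  by (simp add: arrow_measure_def space_PiM sets_arrow_pmf)

sublocale A: prob_space arrow_measure
  unfolding arrow_measure_def by (rule P.prob_space_axioms)

lemma indep_arrows: "A.indep_vars arrow_pmf (\<lambda>j a. a j) UNIV"
proof (subst A.indep_vars_iff_distr_eq_PiM')
  show "(\<lambda>a. a j) \<in> arrow_measure \<rightarrow>\<^sub>M arrow_pmf j" for j
    unfolding arrow_measure_def by simp
  have "distr arrow_measure (arrow_pmf j) (\<lambda>a. a j) = arrow_pmf j" for j
    unfolding arrow_measure_def by (rule PiM_component) simp
  then have "Pi\<^sub>M UNIV (\<lambda>i. distr arrow_measure (arrow_pmf i) (\<lambda>a. a i)) = arrow_measure"
    by (simp add: arrow_measure_def)
  moreover have "distr arrow_measure (Pi\<^sub>M UNIV arrow_pmf) (\<lambda>x. restrict x UNIV) = arrow_measure"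
  proof -
    have "(\<lambda>x. restrict x UNIV) = (\<lambda>x :: arrows. x)" by (auto simp: fun_eq_iff)
    then show ?thesis unfolding arrow_measure_def by (simp add: distr_id)
  qed
  ultimately show "distr arrow_measure (Pi\<^sub>M UNIV arrow_pmf) (\<lambda>x. \<lambda>i\<in>UNIV. x i)
      = (\<Pi>\<^sub>M i\<in>UNIV. distr arrow_measure (arrow_pmf i) (\<lambda>a. a i))" by simp
qed simp

lemma pred_sets: "Measurable.pred arrow_space F \<Longrightarrow> {a. F a} \<in> sets arrow_measure"
  by (simp add: pred_def space_PiM sets_arrow_measure)

lemma emeasure_indep:
  assumes meas: "Measurable.pred arrow_space F" "Measurable.pred arrow_space H"
    and disj: "J \<inter> J' = {}"
    and dep: "\<And>x y. (\<And>j. j \<in> J \<Longrightarrow> x j = y j) \<Longrightarrow> F x = F y"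
      "\<And>x y. (\<And>j. j \<in> J' \<Longrightarrow> x j = y j) \<Longrightarrow> H x = H y"
  shows "emeasure arrow_measure {a. F a \<and> H a} = emeasure arrow_measure {a. F a} * emeasure arrow_measure {a. H a}"
proof -
  note sets = pred_sets[OF meas(1)] pred_sets[OF meas(2)]
  have borel: "indicator {a. F a} \<in> borel_measurable (Pi\<^sub>M UNIV arrow_pmf)"
    "indicator {a. H a} \<in> borel_measurable (Pi\<^sub>M UNIV arrow_pmf)"
    using sets unfolding arrow_measure_def by (auto intro: borel_measurable_indicator)
  have "(\<integral>\<^sup>+a. indicator {a. F a} (\<lambda>i. a i) * indicator {a. H a} (\<lambda>i. a i) \<partial>arrow_measure)
    = (\<integral>\<^sup>+a. indicator {a. F a} (\<lambda>i. a i) \<partial>arrow_measure) * (\<integral>\<^sup>+a. indicator {a. H a} (\<lambda>i. a i) \<partial>arrow_measure)"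
  proof (rule A.nn_integral_indep_disjoint[OF indep_arrows borel disj])
    fix x y :: arrows
    show "indicator {a. F a} x = (indicator {a. F a} y :: ennreal)" if "\<And>j. j \<in> J \<Longrightarrow> x j = y j"
      using dep(1)[OF that] by (simp add: indicator_def)
    show "indicator {a. H a} x = (indicator {a. H a} y :: ennreal)" if "\<And>j. j \<in> J' \<Longrightarrow> x j = y j"
      using dep(2)[OF that] by (simp add: indicator_def)
  qed
  moreover have "indicator {a. F a} a * indicator {a. H a} a = (indicator ({a. F a} \<inter> {a. H a}) a :: ennreal)" for a
    by (simp add: indicator_inter_arith)
  moreover have "{a. F a \<and> H a} = {a. F a} \<inter> {a. H a}" by auto
  ultimately show ?thesis using sets by (simp add: sets.Int)
qed

lemma emeasure_arrow:
  "emeasure arrow_measure {a. a (z, i)} = ennreal (q z i)"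
  "emeasure arrow_measure {a. \<not> a (z, i)} = ennreal (1 - q z i)"
proof -
  have *: "emeasure arrow_measure {a. a (z, i) \<in> E} = emeasure (bernoulli_pmf (q z i)) E" for E
    using emeasure_PiM_Collect_single[of "(z, i)" E]
    by (simp add: arrow_measure_def space_PiM sets_arrow_pmf) (simp add: arrow_pmf_def)
  show "emeasure arrow_measure {a. a (z, i)} = ennreal (q z i)"
    using *[of "{True}"] q01[of z i] by (simp add: emeasure_pmf_single)
  show "emeasure arrow_measure {a. \<not> a (z, i)} = ennreal (1 - q z i)"
    using *[of "{False}"] q01[of z i] by (simp add: emeasure_pmf_single)
qed

lemma path_prob_nonneg: "0 \<le> path_prob q x n"
  using q01 by (induction n) auto

lemma emeasure_arrow_path: "emeasure arrow_measure {a. \<forall>i\<le>n. pos a i = x i} = ennreal (path_prob q x n)"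
proof (induction n)
  case 0
  show ?case using A.emeasure_space_1 by auto
next
  case (Suc n)
  define F where "F a \<longleftrightarrow> (\<forall>i\<le>n. pos a i = x i)" for a
  define H where "H a \<longleftrightarrow> x (Suc n) = (if a (x n, visits_before x n) then x n + 1 else x n - 1)" for a :: arrows
  have F_eq: "F a \<longleftrightarrow> x 0 = 0 \<and> (\<forall>i<n. x (Suc i) = (if a (x i, visits_before x i) then x i + 1 else x i - 1))" for a
    unfolding F_def by (rule pos_path_iff)
  have "{a. \<forall>i\<le>Suc n. pos a i = x i} = {a. F a \<and> H a}"
    unfolding pos_path_iff[of "Suc n"] F_eq H_def All_less_Suc by blast
  also have "emeasure arrow_measure \<dots> = emeasure arrow_measure {a. F a} * emeasure arrow_measure {a. H a}"
  proof (rule emeasure_indep)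
    show "Measurable.pred arrow_space F" unfolding F_eq by measurable
    show "Measurable.pred arrow_space H" unfolding H_def by measurable
    \<comment> \<open>Successive visits to a site use different arrows, because
      \<open>visits_before\<close> increases strictly along them.\<close>
    show "{(x i, visits_before x i) |i. i < n} \<inter> {(x n, visits_before x n)} = {}"
    proof -
      have "visits_before x i < visits_before x n" if "i < n" "x i = x n" for i
        unfolding visits_before_def using that by (intro psubset_card_mono) auto
      then show ?thesis by fastforce
    qed
  qed (auto simp: F_eq H_def)
  also have "emeasure arrow_measure {a. H a} = ennreal (if x (Suc n) = x n + 1 then q (x n) (visits_before x n)
      else if x (Suc n) = x n - 1 then 1 - q (x n) (visits_before x n) else 0)"
    using emeasure_arrow[of "x n" "visits_before x n"] by (auto simp: H_def if_distrib)
  finally show ?case using Suc q01 path_prob_nonneg[of x n] by (simp add: F_def flip: ennreal_mult)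
qed

lemma emeasure_lefts_next:
  "emeasure arrow_measure {a. lefts (\<lambda>i. a (z, i)) j = l \<and> a (z, j)}
    = emeasure arrow_measure {a. lefts (\<lambda>i. a (z, i)) j = l} * ennreal (q z j)"
  "emeasure arrow_measure {a. lefts (\<lambda>i. a (z, i)) j = l \<and> \<not> a (z, j)}
    = emeasure arrow_measure {a. lefts (\<lambda>i. a (z, i)) j = l} * ennreal (1 - q z j)"
proof -
  have disj: "{z} \<times> {..<j} \<inter> {(z, j)} = {}" by auto
  have dep: "(lefts (\<lambda>i. x (z, i)) j = l) = (lefts (\<lambda>i. y (z, i)) j = l)"
    if "\<And>i. i \<in> {z} \<times> {..<j} \<Longrightarrow> x i = y i" for x y :: arrows
    using lefts_cong[of j "\<lambda>i. x (z, i)" "\<lambda>i. y (z, i)"] that by simp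
  show "emeasure arrow_measure {a. lefts (\<lambda>i. a (z, i)) j = l \<and> a (z, j)}
    = emeasure arrow_measure {a. lefts (\<lambda>i. a (z, i)) j = l} * ennreal (q z j)"
    unfolding emeasure_arrow(1)[symmetric] by (rule emeasure_indep[OF _ _ disj dep]) simp_all
  show "emeasure arrow_measure {a. lefts (\<lambda>i. a (z, i)) j = l \<and> \<not> a (z, j)}
    = emeasure arrow_measure {a. lefts (\<lambda>i. a (z, i)) j = l} * ennreal (1 - q z j)"
    unfolding emeasure_arrow(2)[symmetric] by (rule emeasure_indep[OF _ _ disj dep]) simp_all
qed

lemma left_count_q_nonneg: "0 \<le> left_count (q z) j l"
  using q01 by (induction j arbitrary: l) auto

lemma emeasure_lefts: "emeasure arrow_measure {a. lefts (\<lambda>i. a (z, i)) j = l} = ennreal (left_count (q z) j l)"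
proof (induction j arbitrary: l)
  case 0
  show ?case using A.emeasure_space_1 by auto
next
  case (Suc j)
  define R where "R = {a. lefts (\<lambda>i. a (z, i)) j = l \<and> a (z, j)}"
  define L where "L = (if l = 0 then {} else {a. lefts (\<lambda>i. a (z, i)) j = l - 1 \<and> \<not> a (z, j)})"
  have sets: "R \<in> sets arrow_measure" "L \<in> sets arrow_measure"
    unfolding R_def L_def by (auto intro!: pred_sets)
  have "{a. lefts (\<lambda>i. a (z, i)) (Suc j) = l} = R \<union> L"
    unfolding R_def L_def by auto
  also have "emeasure arrow_measure \<dots> = emeasure arrow_measure R + emeasure arrow_measure L"
    by (rule plus_emeasure[symmetric, OF sets]) (auto simp: R_def L_def)
  also have "\<dots> = ennreal (left_count (q z) (Suc j) l)"
    using q01 left_count_q_nonneg unfolding R_def L_def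
    by (simp add: emeasure_lefts_next Suc ennreal_mult)
  finally show ?case .
qed

lemma emeasure_left_stop: "emeasure arrow_measure {a. left_stop (\<lambda>i. a (z, i)) n m} = ennreal (stack_kernel (q z) n m)"
proof (cases n)
  case 0
  then show ?thesis using A.emeasure_space_1 by (auto simp: left_stop_def)
next
  case (Suc l)
  have "{a. left_stop (\<lambda>i. a (z, i)) n m} = {a. lefts (\<lambda>i. a (z, i)) (l + m) = l \<and> \<not> a (z, l + m)}"
    by (simp add: left_stop_def Suc)
  then show ?thesis
    using q01 left_count_q_nonneg
    by (simp add: Suc emeasure_lefts_next emeasure_lefts stack_kernel.simps ennreal_mult)
qed

lemma emeasure_total_progeny:
  "emeasure arrow_measure {a. total_progeny a z n l} = quenched_progeny q z n l"
proof (induction l arbitrary: z n rule: less_induct)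
  case (less l)
  consider "n = 0" | "0 < n" "l < n" | "0 < n" "n \<le> l" by linarith
  then show ?case
  proof cases
    case 1
    then show ?thesis using A.emeasure_space_1 by (auto simp: total_progeny_0 quenched_progeny_0)
  next
    case 2
    then show ?thesis by (simp add: total_progeny_pos quenched_progeny_less)
  next
    case 3
    define E where "E m = {a. left_stop (\<lambda>i. a (z + 1, i)) n m \<and> total_progeny a (z + 1) m (l - n)}" for m
    have "{a. total_progeny a z n l} = (\<Union>m. E m)"
      using 3 by (auto simp: E_def total_progeny_pos)
    also have "emeasure arrow_measure (\<Union>m. E m) = (\<Sum>m. emeasure arrow_measure (E m))"
    proof (rule suminf_emeasure[symmetric])
      have "E m \<in> sets arrow_measure" for m unfolding E_def by (rule pred_sets) measurable
      then show "range E \<subseteq> sets arrow_measure" by auto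
      show "disjoint_family E"
        using left_stop_unique by (fastforce simp: disjoint_family_on_def E_def)
    qed
    also have "\<dots> = (\<Sum>m. ennreal (stack_kernel (q (z + 1)) n m) * quenched_progeny q (z + 1) m (l - n))"
    proof (intro suminf_cong)
      fix m
      have "emeasure arrow_measure (E m) = emeasure arrow_measure {a. left_stop (\<lambda>i. a (z + 1, i)) n m}
          * emeasure arrow_measure {a. total_progeny a (z + 1) m (l - n)}"
        unfolding E_def
      proof (rule emeasure_indep[of _ _ "{z + 1} \<times> UNIV" "{z + 1<..} \<times> UNIV"])
        show "total_progeny x (z + 1) m (l - n) = total_progeny y (z + 1) m (l - n)"
          if "\<And>j. j \<in> {z + 1<..} \<times> UNIV \<Longrightarrow> x j = y j" for x y
          using that by (intro total_progeny_cong) auto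
        show "left_stop (\<lambda>i. x (z + 1, i)) n m = left_stop (\<lambda>i. y (z + 1, i)) n m"
          if "\<And>j. j \<in> {z + 1} \<times> UNIV \<Longrightarrow> x j = y j" for x y :: arrows
          using that by simp
      qed auto
      then show "emeasure arrow_measure (E m)
          = ennreal (stack_kernel (q (z + 1)) n m) * quenched_progeny q (z + 1) m (l - n)"
        using less[of "l - n" "z + 1" m] 3 by (simp add: emeasure_left_stop)
    qed
    also have "\<dots> = quenched_progeny q z n l" using 3 by (simp add: quenched_progeny_pos)
    finally show ?thesis .
  qed
qed

end

definition right_return :: "(int \<Rightarrow> nat \<Rightarrow> real) \<Rightarrow> nat \<Rightarrow> ennreal" where
  "right_return q n = (if even n then ennreal (q 0 0) * quenched_progeny q 0 1 (n div 2) else 0)"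

lemma (in arrow_law) emeasure_first_return:
  "emeasure arrow_measure {a. pos a 1 = 1 \<and> first_return (pos a) n} = right_return q n"
proof (cases "even n")
  case True
  have "{a. pos a 1 = 1 \<and> first_return (pos a) n} = {a. a (0, 0) \<and> total_progeny a 0 1 (n div 2)}"
    using True by (simp only: first_return_iff) simp
  also have "emeasure arrow_measure \<dots>
      = emeasure arrow_measure {a. a (0, 0)} * emeasure arrow_measure {a. total_progeny a 0 1 (n div 2)}"
  proof (rule emeasure_indep[of _ _ "{(0, 0)}" "{0<..} \<times> UNIV"])
    show "total_progeny x 0 1 (n div 2) = total_progeny y 0 1 (n div 2)"
      if "\<And>j. j \<in> {0<..} \<times> UNIV \<Longrightarrow> x j = y j" for x y
      using that by (intro total_progeny_cong) auto
  qed auto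
  finally show ?thesis using True by (simp add: right_return_def emeasure_total_progeny emeasure_arrow)
next
  case False
  then show ?thesis by (simp only: first_return_iff right_return_def) simp
qed

text \<open>The event depends on the first n + 1 positions only. Read as a list they take values in
  a countable type, so path probabilities determine their law, and the result for the arrow walk
  carries over to any process.\<close>

lemma (in arrow_law) emeasure_first_return_process:
  fixes Z :: "nat \<Rightarrow> 's \<Rightarrow> int"
  assumes sets: "\<And>n x. {s \<in> space N. \<forall>i\<le>n. Z i s = x i} \<in> sets N"
    and law: "\<And>n x. emeasure N {s \<in> space N. \<forall>i\<le>n. Z i s = x i} = ennreal (path_prob q x n)"
  shows "{s \<in> space N. Z 1 s = 1 \<and> first_return (\<lambda>i. Z i s) n} \<in> sets N"
    and "emeasure N {s \<in> space N. Z 1 s = 1 \<and> first_return (\<lambda>i. Z i s) n} = right_return q n"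
proof -
  define F where "F s = map (\<lambda>i. Z i s) [0..<Suc n]" for s
  define F' where "F' a = map (pos a) [0..<Suc n]" for a
  have F_iff: "F s = xs \<longleftrightarrow> length xs = Suc n \<and> (\<forall>i\<le>n. Z i s = xs ! i)" for s xs
    unfolding F_def by (auto simp: list_eq_iff_nth_eq less_Suc_eq_le simp del: upt_Suc)
  have F'_iff: "F' a = xs \<longleftrightarrow> length xs = Suc n \<and> (\<forall>i\<le>n. pos a i = xs ! i)" for a xs
    unfolding F'_def by (auto simp: list_eq_iff_nth_eq less_Suc_eq_le simp del: upt_Suc)
  have meas_F: "F \<in> N \<rightarrow>\<^sub>M count_space UNIV"
  proof (subst measurable_count_space_eq_countable)
    have "F -` {xs} \<inter> space N \<in> sets N" for xs
    proof (cases "length xs = Suc n")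
      case True
      then have "F -` {xs} \<inter> space N = {s \<in> space N. \<forall>i\<le>n. Z i s = xs ! i}"
        by (intro set_eqI) (simp add: F_iff conj_commute)
      then show ?thesis by (simp only: sets)
    next
      case False
      then have "F -` {xs} \<inter> space N = {}" by (intro set_eqI) (simp add: F_iff)
      then show ?thesis by simp
    qed
    then show "F \<in> space N \<rightarrow> UNIV \<and> (\<forall>xs\<in>UNIV. F -` {xs} \<inter> space N \<in> sets N)" by simp
  qed simp
  have meas_path: "{a. \<forall>i\<le>n. pos a i = x i} \<in> sets arrow_measure" for x
    unfolding pos_path_iff by (rule pred_sets) measurable
  have meas_F': "F' \<in> arrow_measure \<rightarrow>\<^sub>M count_space UNIV"
  proof (subst measurable_count_space_eq_countable)
    have "F' -` {xs} \<inter> space arrow_measure \<in> sets arrow_measure" for xs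
    proof (cases "length xs = Suc n")
      case True
      then have "F' -` {xs} \<inter> space arrow_measure = {a. \<forall>i\<le>n. pos a i = xs ! i}"
        by (intro set_eqI) (simp add: F'_iff)
      then show ?thesis by (simp only: meas_path)
    next
      case False
      then have "F' -` {xs} \<inter> space arrow_measure = {}" by (intro set_eqI) (simp add: F'_iff)
      then show ?thesis by simp
    qed
    then show "F' \<in> space arrow_measure \<rightarrow> UNIV \<and> (\<forall>xs\<in>UNIV. F' -` {xs} \<inter> space arrow_measure \<in> sets arrow_measure)"
      by simp
  qed simp
  have eq: "distr N (count_space UNIV) F = distr arrow_measure (count_space UNIV) F'"
  proof (rule measure_eqI_countable)
    fix xs
    have "emeasure (distr N (count_space UNIV) F) {xs}
      = (if length xs = Suc n then ennreal (path_prob q ((!) xs) n) else 0)"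
    proof -
      have "emeasure (distr N (count_space UNIV) F) {xs} = emeasure N (F -` {xs} \<inter> space N)"
        using meas_F by (simp add: emeasure_distr)
      also have "F -` {xs} \<inter> space N = (if length xs = Suc n then {s \<in> space N. \<forall>i\<le>n. Z i s = xs ! i} else {})"
        by (intro set_eqI) (simp add: F_iff conj_commute)
      finally show ?thesis by (simp only: law if_distrib[of "emeasure N"] emeasure_empty)
    qed
    moreover have "emeasure (distr arrow_measure (count_space UNIV) F') {xs}
      = (if length xs = Suc n then ennreal (path_prob q ((!) xs) n) else 0)"
    proof -
      have "emeasure (distr arrow_measure (count_space UNIV) F') {xs} = emeasure arrow_measure (F' -` {xs} \<inter> space arrow_measure)"
        using meas_F' by (simp add: emeasure_distr)
      also have "F' -` {xs} \<inter> space arrow_measure = (if length xs = Suc n then {a. \<forall>i\<le>n. pos a i = xs ! i} else {})"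
        by (intro set_eqI) (simp add: F'_iff)
      finally show ?thesis by (simp only: emeasure_arrow_path if_distrib[of "emeasure arrow_measure"] emeasure_empty)
    qed
    ultimately show "emeasure (distr N (count_space UNIV) F) {xs} = emeasure (distr arrow_measure (count_space UNIV) F') {xs}"
      by simp
  qed auto
  define R where "R = {xs :: int list. 0 < n \<and> xs ! 1 = 1 \<and> first_return ((!) xs) n}"
  have nth: "F s ! i = Z i s" "F' a ! i = pos a i" if "i \<le> n" for s a i
    using that by (simp_all add: F_def F'_def del: upt_Suc)
  have R: "(Z 1 s = 1 \<and> first_return (\<lambda>i. Z i s) n) \<longleftrightarrow> F s \<in> R" for s
    by (cases n) (auto simp: R_def first_return_def nth)
  have R': "(pos a 1 = 1 \<and> first_return (pos a) n) \<longleftrightarrow> F' a \<in> R" for a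
    by (cases n) (auto simp: R_def first_return_def nth)
  have set_eq: "{s \<in> space N. Z 1 s = 1 \<and> first_return (\<lambda>i. Z i s) n} = F -` R \<inter> space N"
    using R by auto
  show "{s \<in> space N. Z 1 s = 1 \<and> first_return (\<lambda>i. Z i s) n} \<in> sets N"
    unfolding set_eq by (rule measurable_sets[OF meas_F]) simp
  have "emeasure N (F -` R \<inter> space N) = emeasure (distr N (count_space UNIV) F) R"
    using meas_F by (simp add: emeasure_distr)
  also have "\<dots> = emeasure arrow_measure {a. pos a 1 = 1 \<and> first_return (pos a) n}"
    unfolding eq R' using meas_F' by (simp add: emeasure_distr vimage_def)
  finally show "emeasure N {s \<in> space N. Z 1 s = 1 \<and> first_return (\<lambda>i. Z i s) n} = right_return q n"
    unfolding set_eq emeasure_first_return .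
qed

declare measurable_arrow [measurable del] measurable_lefts [measurable del]

section \<open>Averaging over the environment\<close>

context random_stacks
begin

sublocale C: excursion_chain kern M stack_drift "4 ^ M + (real M)\<^sup>2 + real M" drift_gf
  by (rule excursion_chain_kern)

lemma measurable_stacks [measurable]: "(\<lambda>p z. S z p) \<in> P \<rightarrow>\<^sub>M PiM UNIV (\<lambda>_. seq_space)"
  by (rule measurable_abs_UNIV) (rule measurable_S)

lemma measurable_quenched_progeny_S [measurable]:
  "(\<lambda>p. quenched_progeny (\<lambda>z. S z p) z n l) \<in> borel_measurable P"
  by (rule measurable_compose[OF measurable_stacks measurable_quenched_progeny])

lemma nn_integral_kernel_S:
  "(\<integral>\<^sup>+p. ennreal (stack_kernel (S z p) n m) \<partial>P) = ennreal (pmf (kern n) m)"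
proof -
  have "(\<integral>\<^sup>+p. ennreal (stack_kernel (S z p) n m) \<partial>P)
      = (\<integral>\<^sup>+\<sigma>. ennreal (stack_kernel \<sigma> n m) \<partial>distr P seq_space (S z))"
    by (rule nn_integral_distr[symmetric]) auto
  also have "\<dots> = (\<integral>\<^sup>+\<sigma>. ennreal (stack_kernel \<sigma> n m) \<partial>distr P seq_space (S 0))"
    by (subst ident) (rule refl)
  also have "\<dots> = (\<integral>\<^sup>+p. ennreal (stack_kernel (S 0 p) n m) \<partial>P)"
    by (rule nn_integral_distr) auto
  finally show ?thesis by (simp add: pmf_kern ennreal_kernel_integral)
qed

text \<open>Each stack serves one generation only, so at every level of the recursion the stack at z
  + 1 is independent of all that follows. This factorisation, with identical laws, is what makes the
  averaged process a homogeneous Markov chain.\<close>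

lemma nn_integral_quenched_progeny:
  "(\<integral>\<^sup>+p. quenched_progeny (\<lambda>z. S z p) z n l \<partial>P) = C.progeny n l"
proof (induction l arbitrary: z n rule: less_induct)
  case (less l)
  consider "n = 0" | "0 < n" "l < n" | "0 < n" "n \<le> l" by linarith
  then show ?case
  proof cases
    case 1
    then show ?thesis by (simp add: quenched_progeny_0 C.progeny_0 emeasure_space_1)
  next
    case 2
    then show ?thesis by (simp add: quenched_progeny_less C.progeny_less)
  next
    case 3
    have [measurable]: "(\<lambda>x. ennreal (stack_kernel (x (z + 1)) n m)) \<in> borel_measurable (PiM UNIV (\<lambda>_. seq_space))" for m
    proof -
      have "(\<lambda>x. x (z + 1)) \<in> PiM UNIV (\<lambda>_. seq_space) \<rightarrow>\<^sub>M seq_space"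
        by (rule measurable_component_singleton) simp
      from measurable_compose[OF this measurable_stack_kernel] show ?thesis by simp
    qed
    have "(\<integral>\<^sup>+p. quenched_progeny (\<lambda>z. S z p) z n l \<partial>P)
        = (\<Sum>m. \<integral>\<^sup>+p. ennreal (stack_kernel (S (z + 1) p) n m) * quenched_progeny (\<lambda>z. S z p) (z + 1) m (l - n) \<partial>P)"
      using 3 by (simp add: quenched_progeny_pos nn_integral_suminf)
    also have "\<dots> = (\<Sum>m. ennreal (pmf (kern n) m) * C.progeny m (l - n))"
    proof (intro suminf_cong)
      fix m
      have "(\<integral>\<^sup>+p. ennreal (stack_kernel (S (z + 1) p) n m) * quenched_progeny (\<lambda>z. S z p) (z + 1) m (l - n) \<partial>P)
        = (\<integral>\<^sup>+p. ennreal (stack_kernel (S (z + 1) p) n m) \<partial>P) * (\<integral>\<^sup>+p. quenched_progeny (\<lambda>z. S z p) (z + 1) m (l - n) \<partial>P)"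
      proof (rule nn_integral_indep_disjoint[OF indep_stacks, of "\<lambda>x. ennreal (stack_kernel (x (z + 1)) n m)"
            "\<lambda>x. quenched_progeny x (z + 1) m (l - n)" "{z + 1}" "{z + 1<..}"])
        show "ennreal (stack_kernel (x (z + 1)) n m) = ennreal (stack_kernel (y (z + 1)) n m)"
          if "\<And>j. j \<in> {z + 1} \<Longrightarrow> x j = y j" for x y :: "int \<Rightarrow> nat \<Rightarrow> real"
          using that by simp
        show "quenched_progeny x (z + 1) m (l - n) = quenched_progeny y (z + 1) m (l - n)"
          if "\<And>j. j \<in> {z + 1<..} \<Longrightarrow> x j = y j" for x y
          using that by (intro quenched_progeny_cong) simp
      qed simp_all
      then show "(\<integral>\<^sup>+p. ennreal (stack_kernel (S (z + 1) p) n m) * quenched_progeny (\<lambda>z. S z p) (z + 1) m (l - n) \<partial>P)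
        = ennreal (pmf (kern n) m) * C.progeny m (l - n)"
        using less[of "l - n" "z + 1" m] 3 by (simp add: nn_integral_kernel_S)
    qed
    also have "\<dots> = (\<integral>\<^sup>+m. C.progeny m (l - n) \<partial>kern n)"
      by (simp add: nn_integral_measure_pmf nn_integral_count_space_nat)
    also have "\<dots> = C.progeny n l" using C.progeny_add[of n "l - n"] 3 by simp
    finally show ?thesis .
  qed
qed

definition right_prob :: ennreal where
  "right_prob = (\<integral>\<^sup>+p. ennreal (S 0 p 0) \<partial>P)"

lemma right_prob_bounds: "0 < right_prob" "right_prob < \<infinity>"
proof -
  have "right_prob \<le> (\<integral>\<^sup>+p. 1 \<partial>P)"
    unfolding right_prob_def using range01 by (intro nn_integral_mono) (simp add: ennreal_leI[of _ 1, simplified])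
  then show "right_prob < \<infinity>" by (auto simp: emeasure_space_1 intro: le_less_trans)
  have "right_prob \<noteq> 0"
  proof
    assume "right_prob = 0"
    then have "AE p in P. ennreal (S 0 p 0) = 0" unfolding right_prob_def by (subst (asm) nn_integral_0_iff_AE) auto
    then have "AE p in P. \<not> (\<forall>i. 0 < S 0 p i)"
      by eventually_elim (metis ennreal_eq_0_iff not_le)
    then have "prob {p \<in> space P. \<forall>i. 0 < S 0 p i} = 0"
      by (subst (asm) AE_iff_measurable[OF _ refl]) (auto simp: emeasure_eq_measure)
    then show False using right_pos by simp
  qed
  then show "0 < right_prob" by (simp add: zero_less_iff_neq_zero)
qed

lemma measurable_right_return [measurable]: "(\<lambda>p. right_return (\<lambda>z. S z p) n) \<in> borel_measurable P"
  unfolding right_return_def by simp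

lemma nn_integral_right_return:
  "(\<integral>\<^sup>+p. right_return (\<lambda>z. S z p) n \<partial>P) = (if even n then right_prob * C.progeny 1 (n div 2) else 0)"
proof (cases "even n")
  case True
  have [measurable]: "(\<lambda>x. ennreal (x 0 0)) \<in> borel_measurable (PiM UNIV (\<lambda>_::int. seq_space))"
  proof -
    have "(\<lambda>x. x 0) \<in> PiM UNIV (\<lambda>_::int. seq_space) \<rightarrow>\<^sub>M seq_space"
      by (rule measurable_component_singleton) simp
    moreover have "(\<lambda>\<sigma>. \<sigma> 0) \<in> borel_measurable seq_space"
      by (rule measurable_component_singleton) simp
    ultimately have "(\<lambda>x. x 0 0) \<in> borel_measurable (PiM UNIV (\<lambda>_::int. seq_space))"
      by (rule measurable_compose)
    then show ?thesis by simp
  qed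
  have "(\<integral>\<^sup>+p. ennreal (S 0 p 0) * quenched_progeny (\<lambda>z. S z p) 0 1 (n div 2) \<partial>P)
    = (\<integral>\<^sup>+p. ennreal (S 0 p 0) \<partial>P) * (\<integral>\<^sup>+p. quenched_progeny (\<lambda>z. S z p) 0 1 (n div 2) \<partial>P)"
  proof (rule nn_integral_indep_disjoint[OF indep_stacks, of "\<lambda>x. ennreal (x 0 0)"
        "\<lambda>x. quenched_progeny x 0 1 (n div 2)" "{0}" "{0<..}"])
    show "ennreal (x 0 0) = ennreal (y 0 0)"
      if "\<And>j. j \<in> {0} \<Longrightarrow> x j = y j" for x y :: "int \<Rightarrow> nat \<Rightarrow> real"
      using that by simp
    show "quenched_progeny x 0 1 (n div 2) = quenched_progeny y 0 1 (n div 2)"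
      if "\<And>j. j \<in> {0<..} \<Longrightarrow> x j = y j" for x y
      using that by (intro quenched_progeny_cong) simp
  qed simp_all
  then show ?thesis using True by (simp add: right_return_def right_prob_def nn_integral_quenched_progeny)
qed (simp add: right_return_def)

lemma sum_right_return_finite_iff:
  "(\<Sum>n. of_nat n * (\<integral>\<^sup>+p. right_return (\<lambda>z. S z p) n \<partial>P)) < \<infinity> \<longleftrightarrow> stack_drift < -1 \<or> 3 < stack_drift"
proof -
  define f where "f n = of_nat n * (\<integral>\<^sup>+p. right_return (\<lambda>z. S z p) n \<partial>P)" for n
  have f: "f n = (if even n then 2 * right_prob * (of_nat (n div 2) * C.progeny 1 (n div 2)) else 0)" for n
  proof (cases "even n")
    case True
    then have "(of_nat n :: ennreal) = 2 * of_nat (n div 2)"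
      by (metis dvd_mult_div_cancel of_nat_mult of_nat_numeral)
    then show ?thesis using True by (simp add: f_def nn_integral_right_return ac_simps)
  qed (simp add: f_def nn_integral_right_return)
  have "(\<Sum>n. f n) = (\<integral>\<^sup>+n. f n * indicator (range ((*) 2)) n \<partial>count_space UNIV)"
    unfolding nn_integral_count_space_nat by (intro suminf_cong) (auto simp: f indicator_def elim!: evenE)
  also have "\<dots> = (\<integral>\<^sup>+n. f n \<partial>count_space (range ((*) 2)))"
    by (simp add: nn_integral_count_space_indicator)
  also have "\<dots> = (\<integral>\<^sup>+l. f (2 * l) \<partial>count_space UNIV)"
    by (rule nn_integral_bij_count_space[symmetric]) (auto simp: bij_betw_def inj_on_def)
  also have "\<dots> = 2 * right_prob * C.mean_progeny 1"
    unfolding nn_integral_count_space_nat C.mean_progeny_def by (simp add: f)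
  finally have "(\<Sum>n. f n) = 2 * right_prob * C.mean_progeny 1" .
  \<comment> \<open>The probability of a first step to the right is positive and finite, so the
    factor does not affect finiteness.\<close>
  moreover have "2 * right_prob * C.mean_progeny 1 < \<infinity> \<longleftrightarrow> C.mean_progeny 1 < \<infinity>"
    using right_prob_bounds by (auto simp: ennreal_mult_less_top ennreal_mult_eq_top_iff less_top)
  ultimately show ?thesis using C.mean_progeny_finite_iff by (simp add: f_def)
qed

end

section \<open>Excited random walks\<close>

text \<open>The event of a given path up to n lies in the past, and on it the number of visits,
  hence the cookie, is constant. Integrating the conditional probability over this event gives one
  factor per step.\<close>

lemma quenched_ERW_path:
  assumes "quenched_ERW 0 \<omega> N X"
  shows "{s \<in> space N. \<forall>i\<le>n. X i s = x i} \<in> sets N"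
    and "emeasure N {s \<in> space N. \<forall>i\<le>n. X i s = x i} = ennreal (path_prob (\<lambda>z i. \<omega> (z, Suc i)) x n)"
proof -
  interpret prob_space N using assms by (simp add: quenched_ERW_def)
  have X [measurable]: "X n \<in> N \<rightarrow>\<^sub>M count_space UNIV" for n
    using assms by (simp add: quenched_ERW_def)
  have X0: "AE s in N. X 0 s = 0" using assms by (simp add: quenched_ERW_def)
  define A where "A n = {s \<in> space N. \<forall>i\<le>n. X i s = x i}" for n
  define D where "D d n = {s \<in> space N. X (Suc n) s = X n s + d}" for d n
  define q where "q n = \<omega> (x n, Suc (visits_before x n))" for n
  have cond: "AE s in N. real_cond_exp N (past N X n) (indicator (D 1 n)) s = \<omega> (X n s, visits X n s)"
    "AE s in N. real_cond_exp N (past N X n) (indicator (D (- 1) n)) s = 1 - \<omega> (X n s, visits X n s)" for n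
    using assms by (simp_all add: quenched_ERW_def D_def)
  have A_sets [measurable]: "A n \<in> sets N" for n unfolding A_def by measurable
  have D_sets [measurable]: "D d n \<in> sets N" for d n unfolding D_def by measurable
  show "{s \<in> space N. \<forall>i\<le>n. X i s = x i} \<in> sets N" using A_sets[of n] by (simp add: A_def)
  have visits: "X n s = x n" "visits X n s = Suc (visits_before x n)" if "s \<in> A n" for s n
  proof -
    have "{i. i \<le> n \<and> X i s = X n s} = insert n {i. i < n \<and> x i = x n}"
      using that by (auto simp: A_def le_less)
    then show "visits X n s = Suc (visits_before x n)" by (simp add: visits_def visits_before_def)
    show "X n s = x n" using that by (simp add: A_def)
  qed
  have paths: "(\<lambda>s. \<lambda>i\<in>{..n}. X i s) \<in> N \<rightarrow>\<^sub>M (\<Pi>\<^sub>M _ \<in> {..n}. count_space UNIV)" for n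
    by (rule measurable_restrict) simp
  have sub: "subalgebra N (past N X n)" for n
    unfolding subalgebra_def past_def using sets_image_in_sets[OF refl paths[of n]] by simp
  have A_past: "A n \<in> sets (past N X n)" for n
  proof -
    have "(\<Pi>\<^sub>E i\<in>{..n}. {x i}) \<in> sets (\<Pi>\<^sub>M _ \<in> {..n}. count_space UNIV)"
      by (rule sets_PiM_I_finite) auto
    from in_vimage_algebra[OF this, of "\<lambda>s. \<lambda>i\<in>{..n}. X i s" "space N"]
    have "(\<lambda>s. \<lambda>i\<in>{..n}. X i s) -` (\<Pi>\<^sub>E i\<in>{..n}. {x i}) \<inter> space N \<in> sets (past N X n)"
      by (simp add: past_def)
    also have "(\<lambda>s. \<lambda>i\<in>{..n}. X i s) -` (\<Pi>\<^sub>E i\<in>{..n}. {x i}) \<inter> space N = A n"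
      by (auto simp: A_def PiE_iff)
    finally show ?thesis .
  qed
  have step: "prob (A n \<inter> D d n) = prob (A n) * c"
    if "AE s in N. s \<in> A n \<longrightarrow> real_cond_exp N (past N X n) (indicator (D d n)) s = c" for d c n
  proof -
    interpret F: finite_measure_subalgebra N "past N X n" by unfold_locales (rule sub)
    have "prob (A n \<inter> D d n) = (\<integral>s. indicator (A n) s *\<^sub>R (indicator (D d n) s :: real) \<partial>N)"
      by (simp add: indicator_inter_arith[symmetric] Int_commute)
    also have "\<dots> = (\<integral>s. indicator (A n) s *\<^sub>R real_cond_exp N (past N X n) (indicator (D d n)) s \<partial>N)"
    proof -
      have "integrable N (indicator (D d n) :: _ \<Rightarrow> real)"
        using D_sets[of d n] by (intro integrable_real_indicator) (simp_all add: emeasure_eq_measure)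
      from F.real_cond_exp_intA[OF this A_past] show ?thesis by (simp add: set_lebesgue_integral_def)
    qed
    also have "\<dots> = (\<integral>s. indicator (A n) s *\<^sub>R c \<partial>N)"
      using that by (intro integral_cong_AE) (auto elim!: eventually_mono simp: indicator_def)
    finally show ?thesis by simp
  qed
  have up: "prob (A n \<inter> D 1 n) = prob (A n) * q n" for n
    using cond(1)[of n] by (intro step) (auto elim!: eventually_mono simp: visits q_def)
  have down: "prob (A n \<inter> D (- 1) n) = prob (A n) * (1 - q n)" for n
    using cond(2)[of n] by (intro step) (auto elim!: eventually_mono simp: visits q_def)
  have "prob (A n) = path_prob (\<lambda>z i. \<omega> (z, Suc i)) x n"
  proof (induction n)
    case 0
    show ?case
    proof (cases "x 0 = 0")
      case True
      then have "prob (A 0) = 1" using X0 A_sets[of 0] by (subst prob_eq_1) (auto simp: A_def elim!: eventually_mono)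
      then show ?thesis using True by simp
    next
      case False
      then have "AE s in N. s \<notin> A 0" using X0 by (auto simp: A_def elim!: eventually_mono)
      then have "prob (A 0) = 0" using A_sets[of 0] by (subst prob_eq_0) auto
      then show ?thesis using False by simp
    qed
  next
    case (Suc n)
    have A_Suc: "A (Suc n) = A n \<inter> D (x (Suc n) - x n) n"
      by (auto simp: A_def D_def le_Suc_eq)
    show ?case
    proof (cases "x (Suc n) = x n + 1 \<or> x (Suc n) = x n - 1")
      case True
      then show ?thesis using Suc up[of n] down[of n] by (auto simp: A_Suc q_def)
    next
      case False
      \<comment> \<open>The conditional probabilities of the steps +1 and -1 add up to 1, so every
        other jump is a null event.\<close>
      have "prob ((A n \<inter> D 1 n) \<union> (A n \<inter> D (- 1) n)) = prob (A n \<inter> D 1 n) + prob (A n \<inter> D (- 1) n)"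
        by (rule finite_measure_Union) (simp_all, auto simp: D_def)
      also have "\<dots> = prob (A n)" using up[of n] down[of n] by (simp add: algebra_simps)
      finally have "prob ((A n \<inter> D 1 n) \<union> (A n \<inter> D (- 1) n)) = prob (A n)" .
      moreover have "prob (A (Suc n) \<union> ((A n \<inter> D 1 n) \<union> (A n \<inter> D (- 1) n)))
          = prob (A (Suc n)) + prob ((A n \<inter> D 1 n) \<union> (A n \<inter> D (- 1) n))"
      proof (rule finite_measure_Union)
        show "A (Suc n) \<inter> ((A n \<inter> D 1 n) \<union> (A n \<inter> D (- 1) n)) = {}"
          using False by (auto simp: A_Suc D_def)
      qed simp_all
      moreover have "prob (A (Suc n) \<union> ((A n \<inter> D 1 n) \<union> (A n \<inter> D (- 1) n))) \<le> prob (A n)"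
        by (rule finite_measure_mono) (auto simp: A_Suc)
      ultimately have "prob (A (Suc n)) = 0" using measure_nonneg[of N "A (Suc n)"] by linarith
      then show ?thesis using False by simp
    qed
  qed
  then show "emeasure N {s \<in> space N. \<forall>i\<le>n. X i s = x i} = ennreal (path_prob (\<lambda>z i. \<omega> (z, Suc i)) x n)"
    by (simp add: A_def emeasure_eq_measure)
qed

text \<open>At most one term of the series is nonzero, and none on R = \<infinity>. In this form R
  can be integrated term by term.\<close>

lemma return_time_sum:
  "ennreal_of_enat (return_time X s) * indicator {s. return_time X s < \<infinity>} s
    = (\<Sum>n. of_nat n * (if first_return (\<lambda>i. X i s - X 0 s) n then 1 else 0))"
proof (cases "\<exists>n\<ge>1. X n s = X 0 s")
  case False
  then have "{enat n | n. n \<ge> 1 \<and> X n s = X 0 s} = {}" by blast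
  then have "return_time X s = \<infinity>" by (simp only: return_time_def Inf_empty top_enat_def)
  moreover have "\<not> first_return (\<lambda>i. X i s - X 0 s) n" for n
    using False by (auto simp: first_return_def)
  ultimately show ?thesis by simp
next
  case True
  define n0 where "n0 = (LEAST n. 1 \<le> n \<and> X n s = X 0 s)"
  have n0: "1 \<le> n0" "X n0 s = X 0 s"
    unfolding n0_def using LeastI_ex[of "\<lambda>n. 1 \<le> n \<and> X n s = X 0 s"] True by blast+
  have least: "n0 \<le> n" if "1 \<le> n" "X n s = X 0 s" for n
    unfolding n0_def using Least_le[of "\<lambda>n. 1 \<le> n \<and> X n s = X 0 s" n] that by blast
  have "return_time X s = enat n0" unfolding return_time_def
  proof (rule antisym)
    show "Inf {enat n |n. 1 \<le> n \<and> X n s = X 0 s} \<le> enat n0"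
      by (rule Inf_lower) (use n0 in blast)
    show "enat n0 \<le> Inf {enat n |n. 1 \<le> n \<and> X n s = X 0 s}"
    proof (rule Inf_greatest)
      fix e assume "e \<in> {enat n |n. 1 \<le> n \<and> X n s = X 0 s}"
      then obtain n where "e = enat n" "1 \<le> n" "X n s = X 0 s" by blast
      then show "enat n0 \<le> e" using least[of n] by simp
    qed
  qed
  moreover have "first_return (\<lambda>i. X i s - X 0 s) n \<longleftrightarrow> n = n0" for n
  proof
    assume f: "first_return (\<lambda>i. X i s - X 0 s) n"
    have "n0 \<le> n" by (rule least) (use f in \<open>simp_all add: first_return_def\<close>)
    moreover have "\<not> n0 < n"
    proof
      assume "n0 < n"
      then have "X n0 s - X 0 s \<noteq> 0" using f n0(1) unfolding first_return_def by simp
      then show False using n0(2) by simp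
    qed
    ultimately show "n = n0" by simp
  next
    assume n: "n = n0"
    have "X i s - X 0 s \<noteq> 0" if "0 < i" "i < n0" for i
    proof
      assume "X i s - X 0 s = 0"
      then have "n0 \<le> i" by (intro least) (use that in simp_all)
      then show False using that by simp
    qed
    then show "first_return (\<lambda>i. X i s - X 0 s) n"
      using n0 unfolding n first_return_def by simp
  qed
  moreover have "(\<Sum>n. of_nat n * (if n = n0 then 1 else 0 :: ennreal)) = (\<Sum>n\<in>{n0}. of_nat n * (if n = n0 then 1 else 0))"
    by (rule suminf_finite) auto
  ultimately show ?thesis by simp
qed

text \<open>Stacks are indexed from 0. Excursions to the left are excursions to the right of the
  reflected walk, whose stacks are \<open>left_stacks\<close>.\<close>

definition right_stacks :: "int \<Rightarrow> cookie_env \<Rightarrow> nat \<Rightarrow> real" where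
  "right_stacks z \<omega> i = \<omega> (z, Suc i)"

definition left_stacks :: "int \<Rightarrow> cookie_env \<Rightarrow> nat \<Rightarrow> real" where
  "left_stacks z \<omega> i = 1 - \<omega> (- z, Suc i)"

lemma cookie_space_range:
  assumes "\<omega> \<in> space cookie_space"
  shows "0 \<le> \<omega> (z, Suc i)" "\<omega> (z, Suc i) \<le> 1"
proof -
  have "\<omega> (z, Suc i) \<in> space unit_borel"
    using assms by (auto simp: cookie_space_def space_PiM PiE_iff)
  then show "0 \<le> \<omega> (z, Suc i)" "\<omega> (z, Suc i) \<le> 1" by (auto simp: unit_borel_def space_restrict_space)
qed

text \<open>Almost surely the first step is +1 or -1. An excursion to the left is one to the right
  of -X, which is the walk in the reflected environment.\<close>

lemma quenched_first_return:
  assumes ERW: "quenched_ERW 0 \<omega> N X" and \<omega>: "\<omega> \<in> space cookie_space"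
  shows "(\<integral>\<^sup>+s. ennreal_of_enat (return_time X s) * indicator {s. return_time X s < \<infinity>} s \<partial>N)
    = (\<Sum>n. of_nat n * (right_return (\<lambda>z. right_stacks z \<omega>) n + right_return (\<lambda>z. left_stacks z \<omega>) n))"
proof -
  interpret prob_space N using ERW by (simp add: quenched_ERW_def)
  have X0: "AE s in N. X 0 s = 0" using ERW by (simp add: quenched_ERW_def)
  define q where "q = (\<lambda>z i. \<omega> (z, Suc i))"
  have q01: "0 \<le> q z i" "q z i \<le> 1" for z i using cookie_space_range[OF \<omega>] by (auto simp: q_def)
  have q_right: "q = (\<lambda>z. right_stacks z \<omega>)"
    by (rule ext)+ (simp add: q_def right_stacks_def)
  have q_left: "(\<lambda>z i. 1 - q (- z) i) = (\<lambda>z. left_stacks z \<omega>)"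
    by (rule ext)+ (simp add: q_def left_stacks_def)
  have R: "arrow_law (\<lambda>z. right_stacks z \<omega>)" and L: "arrow_law (\<lambda>z. left_stacks z \<omega>)"
    using cookie_space_range[OF \<omega>] by (simp_all add: arrow_law_def right_stacks_def left_stacks_def)
  have path_sets: "{s \<in> space N. \<forall>i\<le>n. X i s = x i} \<in> sets N" for n x
    by (rule quenched_ERW_path[OF ERW])
  have path: "emeasure N {s \<in> space N. \<forall>i\<le>n. X i s = x i} = ennreal (path_prob q x n)" for n x
    unfolding q_def by (rule quenched_ERW_path[OF ERW])
  have neg: "{s \<in> space N. \<forall>i\<le>n. - X i s = x i} = {s \<in> space N. \<forall>i\<le>n. X i s = - x i}" for n and x :: "nat \<Rightarrow> int"
  proof -
    have "- X i s = x i \<longleftrightarrow> X i s = - x i" for i s by auto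
    then show ?thesis by (simp only:)
  qed
  define A where "A n = {s \<in> space N. X 1 s = 1 \<and> first_return (\<lambda>i. X i s) n}" for n
  define B where "B n = {s \<in> space N. - X 1 s = 1 \<and> first_return (\<lambda>i. - X i s) n}" for n
  have A: "A n \<in> sets N" "emeasure N (A n) = right_return (\<lambda>z. right_stacks z \<omega>) n" for n
    unfolding A_def by (rule arrow_law.emeasure_first_return_process[OF R path_sets path[unfolded q_right]])+
  have B: "B n \<in> sets N" "emeasure N (B n) = right_return (\<lambda>z. left_stacks z \<omega>) n" for n
  proof -
    have path': "emeasure N {s \<in> space N. \<forall>i\<le>n. - X i s = x i} = ennreal (path_prob (\<lambda>z. left_stacks z \<omega>) x n)" for n x
      unfolding neg path path_prob_reflect q_left ..
    have path_sets': "{s \<in> space N. \<forall>i\<le>n. - X i s = x i} \<in> sets N" for n x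
      unfolding neg by (rule path_sets)
    show "B n \<in> sets N" "emeasure N (B n) = right_return (\<lambda>z. left_stacks z \<omega>) n"
      unfolding B_def by (rule arrow_law.emeasure_first_return_process[OF L path_sets' path'])+
  qed
  have first_step: "AE s in N. X 1 s = 1 \<or> X 1 s = - 1"
  proof -
    define U where "U d = {s \<in> space N. \<forall>i\<le>1. X i s = (if i = 0 then 0 else d)}" for d
    have sets: "U d \<in> sets N" for d unfolding U_def by (rule path_sets)
    have "emeasure N (U 1) = ennreal (q 0 0)" "emeasure N (U (- 1)) = ennreal (1 - q 0 0)"
      unfolding U_def path One_nat_def by (simp_all add: visits_before_def)
    then have "prob (U 1) = q 0 0" "prob (U (- 1)) = 1 - q 0 0"
      using q01[of 0 0] by (simp_all add: measure_def)
    moreover have X1: "X 1 s = d" if "s \<in> U d" for s d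
    proof -
      have "X 1 s = (if (1 :: nat) = 0 then 0 else d)" using that unfolding U_def by blast
      then show ?thesis by simp
    qed
    then have "U 1 \<inter> U (- 1) = {}" by (metis disjoint_iff one_neq_neg_one)
    ultimately have "prob (U 1 \<union> U (- 1)) = 1"
      using finite_measure_Union[OF sets sets] by simp
    then have "AE s in N. s \<in> U 1 \<union> U (- 1)" using sets by (subst (asm) prob_eq_1) auto
    then show ?thesis by eventually_elim (use X1 in blast)
  qed
  have neg_return: "first_return (\<lambda>i. - x i) n = first_return x n" for x :: "nat \<Rightarrow> int" and n
    by (simp add: first_return_def)
  have "(\<integral>\<^sup>+s. ennreal_of_enat (return_time X s) * indicator {s. return_time X s < \<infinity>} s \<partial>N)
    = (\<integral>\<^sup>+s. (\<Sum>n. of_nat n * (indicator (A n) s + indicator (B n) s)) \<partial>N)"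
  proof (rule nn_integral_cong_AE)
    show "AE s in N. ennreal_of_enat (return_time X s) * indicator {s. return_time X s < \<infinity>} s
        = (\<Sum>n. of_nat n * (indicator (A n) s + indicator (B n) s))"
      using X0 first_step AE_space
    proof eventually_elim
      case (elim s)
      have "indicator (A n) s + indicator (B n) s = (if first_return (\<lambda>i. X i s - X 0 s) n then 1 else 0 :: ennreal)" for n
        using elim(2) by (elim disjE) (simp_all add: elim(1,3) A_def B_def neg_return indicator_def)
      then show ?case unfolding return_time_sum by simp
    qed
  qed
  also have "\<dots> = (\<Sum>n. of_nat n * (emeasure N (A n) + emeasure N (B n)))"
    using A(1) B(1) by (simp add: nn_integral_suminf nn_integral_cmult nn_integral_add)
  finally show ?thesis by (simp add: A B)
qed

section \<open>From cookie environments to random stacks\<close>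

context
  fixes P :: "cookie_env measure" and M :: nat
  assumes env: "env_law P" and iid: "IID P" and wel: "WEL P" and bd: "BD M P"
begin

interpretation prob_space P using env by (simp add: env_law_def)

lemma space_P: "space P = space cookie_space"
  using env unfolding env_law_def by (intro sets_eq_imp_space_eq) simp

lemma measurable_shift_stack: "(\<lambda>\<sigma> i. \<sigma> (Suc i)) \<in> stack_space \<rightarrow>\<^sub>M seq_space"
  and measurable_reflect_stack: "(\<lambda>\<sigma> i. 1 - \<sigma> (Suc i)) \<in> stack_space \<rightarrow>\<^sub>M seq_space"
proof -
  have *: "(\<lambda>\<sigma>. \<sigma> (Suc i)) \<in> borel_measurable stack_space" for i
  proof -
    have "(\<lambda>\<sigma>. \<sigma> (Suc i)) \<in> stack_space \<rightarrow>\<^sub>M unit_borel"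
      unfolding stack_space_def by (rule measurable_component_singleton) simp
    then show ?thesis unfolding unit_borel_def by (rule measurable_restrict_space2_iff[THEN iffD1, THEN conjunct1])
  qed
  show "(\<lambda>\<sigma> i. \<sigma> (Suc i)) \<in> stack_space \<rightarrow>\<^sub>M seq_space" by (intro measurable_abs_UNIV *)
  show "(\<lambda>\<sigma> i. 1 - \<sigma> (Suc i)) \<in> stack_space \<rightarrow>\<^sub>M seq_space"
    by (intro measurable_abs_UNIV borel_measurable_diff borel_measurable_const *)
qed

lemma right_stacks_eq: "right_stacks z \<omega> = (\<lambda>i. stack z \<omega> (Suc i))"
  by (simp add: right_stacks_def stack_def fun_eq_iff)

lemma left_stacks_eq: "left_stacks z \<omega> = (\<lambda>i. 1 - stack (- z) \<omega> (Suc i))"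
  by (simp add: left_stacks_def stack_def fun_eq_iff)

lemma indep_stack: "indep_vars (\<lambda>_. stack_space) stack UNIV"
  using iid by (simp add: IID_def)

lemma measurable_stack: "stack z \<in> P \<rightarrow>\<^sub>M stack_space"
  using indep_stack by (simp add: indep_vars_def)

lemma distr_stack: "distr P stack_space (stack z) = distr P stack_space (stack z')"
  using iid by (simp add: IID_def)

lemma random_right_stacks: "random_stacks P right_stacks M"
proof
  show "indep_vars (\<lambda>_. seq_space) right_stacks UNIV"
    using indep_vars_compose2[OF indep_stack measurable_shift_stack]
    by (simp add: right_stacks_eq[abs_def])
  show "distr P seq_space (right_stacks z) = distr P seq_space (right_stacks 0)" for z
  proof -
    have "distr P seq_space (right_stacks z) = distr (distr P stack_space (stack z)) seq_space (\<lambda>\<sigma> i. \<sigma> (Suc i))" for z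
      by (subst distr_distr[OF measurable_shift_stack measurable_stack]) (simp add: right_stacks_eq[abs_def] comp_def)
    then show ?thesis using distr_stack[of z 0] by simp
  qed
  show "0 \<le> right_stacks z \<omega> i \<and> right_stacks z \<omega> i \<le> 1" if "\<omega> \<in> space P" for z \<omega> i
    using cookie_space_range[of \<omega> z i] that by (simp add: space_P right_stacks_def)
  show "AE \<omega> in P. \<forall>z. \<forall>i\<ge>M. right_stacks z \<omega> i = 1 / 2"
    using bd unfolding BD_def by eventually_elim (simp add: right_stacks_def)
  have *: "(\<forall>i. Q (\<omega> (0, Suc i))) \<longleftrightarrow> (\<forall>i\<ge>1. Q (\<omega> (0, i)))" for Q and \<omega> :: cookie_env
    by (metis Suc_le_eq Suc_pred' One_nat_def le0 le_SucI not_less_eq_eq zero_less_Suc)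
  show "0 < prob {\<omega> \<in> space P. \<forall>i. 0 < right_stacks 0 \<omega> i}"
    "0 < prob {\<omega> \<in> space P. \<forall>i. right_stacks 0 \<omega> i < 1}"
    using wel *[of "\<lambda>x. 0 < x"] *[of "\<lambda>x. x < 1"] by (simp_all add: WEL_def right_stacks_def)
qed

text \<open>Reflection exchanges the two conditions of \<open>WEL\<close>. The relabelling of sites
  by -z keeps independence because it amounts to grouping the stacks into the disjoint singletons {-
  j}.\<close>

lemma random_left_stacks: "random_stacks P left_stacks M"
proof
  have "indep_vars (\<lambda>j. PiM {- j} (\<lambda>_. stack_space)) (\<lambda>j \<omega>. restrict (\<lambda>i. stack i \<omega>) {- j}) (UNIV :: int set)"
    by (rule indep_vars_restrict[OF indep_stack]) (auto simp: disjoint_family_on_def)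
  then have "indep_vars (\<lambda>_. seq_space) (\<lambda>j \<omega>. (\<lambda>x i. 1 - x (- j) (Suc i)) (restrict (\<lambda>i. stack i \<omega>) {- j})) (UNIV :: int set)"
  proof (rule indep_vars_compose2)
    fix j :: int
    have "(\<lambda>x. x (- j)) \<in> PiM {- j} (\<lambda>_. stack_space) \<rightarrow>\<^sub>M stack_space"
      by (rule measurable_component_singleton) simp
    from measurable_compose[OF this measurable_reflect_stack]
    show "(\<lambda>x i. 1 - x (- j) (Suc i)) \<in> PiM {- j} (\<lambda>_. stack_space) \<rightarrow>\<^sub>M seq_space" .
  qed
  then show "indep_vars (\<lambda>_. seq_space) left_stacks UNIV"
    by (simp add: left_stacks_eq[abs_def])
  show "distr P seq_space (left_stacks z) = distr P seq_space (left_stacks 0)" for z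
  proof -
    have "distr P seq_space (left_stacks z) = distr (distr P stack_space (stack (- z))) seq_space (\<lambda>\<sigma> i. 1 - \<sigma> (Suc i))" for z
      by (subst distr_distr[OF measurable_reflect_stack measurable_stack]) (simp add: left_stacks_eq[abs_def] comp_def)
    then show ?thesis using distr_stack[of "- z" 0] by simp
  qed
  show "0 \<le> left_stacks z \<omega> i \<and> left_stacks z \<omega> i \<le> 1" if "\<omega> \<in> space P" for z \<omega> i
    using cookie_space_range[of \<omega> "- z" i] that by (simp add: space_P left_stacks_def)
  show "AE \<omega> in P. \<forall>z. \<forall>i\<ge>M. left_stacks z \<omega> i = 1 / 2"
    using bd unfolding BD_def by eventually_elim (simp add: left_stacks_def)
  have *: "(\<forall>i. Q (\<omega> (0, Suc i))) \<longleftrightarrow> (\<forall>i\<ge>1. Q (\<omega> (0, i)))" for Q and \<omega> :: cookie_env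
    by (metis Suc_le_eq Suc_pred' One_nat_def le0 le_SucI not_less_eq_eq zero_less_Suc)
  show "0 < prob {\<omega> \<in> space P. \<forall>i. 0 < left_stacks 0 \<omega> i}"
    "0 < prob {\<omega> \<in> space P. \<forall>i. left_stacks 0 \<omega> i < 1}"
    using wel *[of "\<lambda>x. 0 < x"] *[of "\<lambda>x. x < 1"] by (simp_all add: WEL_def left_stacks_def)
qed

lemma drift_right_stacks: "random_stacks.stack_drift P right_stacks M = mean_drift M P"
  unfolding random_stacks.stack_drift_def[OF random_right_stacks] mean_drift_def
  by (simp add: right_stacks_def sum.atLeast1_atMost_eq)

lemma drift_left_stacks: "random_stacks.stack_drift P left_stacks M = - mean_drift M P"
proof -
  have "(\<Sum>i<M. 2 * left_stacks 0 \<omega> i - 1) = - (\<Sum>i = 1..M. 2 * \<omega> (0, i) - 1)" for \<omega>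
    by (simp add: left_stacks_def sum.atLeast1_atMost_eq sum_negf[symmetric])
  then show ?thesis
    unfolding random_stacks.stack_drift_def[OF random_left_stacks] mean_drift_def by simp
qed

lemma mean_return_finite_iff:
  fixes S :: "'s measure" and X :: "nat \<Rightarrow> 's \<Rightarrow> int"
  assumes erw: "ERW 0 S Q X"
  shows "(\<integral>\<^sup>+s. ennreal_of_enat (return_time X s) * indicator {s. return_time X s < \<infinity>} s \<partial>(P \<bind> Q)) < \<infinity>
    \<longleftrightarrow> 3 < \<bar>mean_drift M P\<bar>"
proof -
  interpret R: random_stacks P right_stacks M by (rule random_right_stacks)
  interpret L: random_stacks P left_stacks M by (rule random_left_stacks)
  define f where "f s = ennreal_of_enat (return_time X s) * indicator {s. return_time X s < \<infinity>} s" for s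
  have Q: "Q \<in> P \<rightarrow>\<^sub>M prob_algebra S"
    using erw env unfolding ERW_def env_law_def by (simp cong: measurable_cong_sets)
  have quenched: "quenched_ERW 0 \<omega> (Q \<omega>) X" if "\<omega> \<in> space P" for \<omega>
    using erw that by (simp add: ERW_def space_P)
  obtain \<omega>0 where \<omega>0: "\<omega>0 \<in> space P" using not_empty by blast
  \<comment> \<open>All quenched measures share the sigma-algebra of S, so the measurability of X on
    S can be read off from a single environment.\<close>
  have "sets (Q \<omega>0) = sets S" using measurable_space[OF Q \<omega>0] by (simp add: space_prob_algebra)
  then have [measurable]: "X n \<in> S \<rightarrow>\<^sub>M count_space UNIV" for n
  proof -
    assume eq: "sets (Q \<omega>0) = sets S"
    have "X n \<in> Q \<omega>0 \<rightarrow>\<^sub>M count_space UNIV" using quenched[OF \<omega>0] by (simp add: quenched_ERW_def)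
    then show ?thesis by (simp only: measurable_cong_sets[OF eq refl])
  qed
  have f_meas: "f \<in> borel_measurable S"
  proof -
    have eq: "{s \<in> space S. X n s = X 0 s} \<in> sets S" for n
      by measurable
    have "Measurable.pred S (\<lambda>s. X n s = X 0 s)" for n using eq[of n] by (simp add: pred_def)
    note [measurable] = this
    have "Measurable.pred S (\<lambda>s. first_return (\<lambda>i. X i s - X 0 s) n)" for n
      unfolding first_return_def right_minus_eq by measurable
    note [measurable] = this
    show ?thesis unfolding f_def[abs_def] return_time_sum by measurable
  qed
  have "(\<integral>\<^sup>+s. f s \<partial>(P \<bind> Q)) = (\<integral>\<^sup>+\<omega>. \<integral>\<^sup>+s. f s \<partial>Q \<omega> \<partial>P)"
    by (rule nn_integral_bind[OF f_meas measurable_prob_algebraD[OF Q]])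
  also have "\<dots> = (\<integral>\<^sup>+\<omega>. (\<Sum>n. of_nat n * (right_return (\<lambda>z. right_stacks z \<omega>) n + right_return (\<lambda>z. left_stacks z \<omega>) n)) \<partial>P)"
    unfolding f_def by (intro nn_integral_cong quenched_first_return quenched) (auto simp: space_P)
  also have "\<dots> = (\<Sum>n. of_nat n * (\<integral>\<^sup>+\<omega>. right_return (\<lambda>z. right_stacks z \<omega>) n \<partial>P))
      + (\<Sum>n. of_nat n * (\<integral>\<^sup>+\<omega>. right_return (\<lambda>z. left_stacks z \<omega>) n \<partial>P))"
    by (simp add: nn_integral_suminf nn_integral_cmult nn_integral_add suminf_add distrib_left)
  finally have "(\<integral>\<^sup>+s. f s \<partial>(P \<bind> Q)) < \<infinity> \<longleftrightarrow>
      (mean_drift M P < -1 \<or> 3 < mean_drift M P) \<and> (- mean_drift M P < -1 \<or> 3 < - mean_drift M P)"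
    using R.sum_right_return_finite_iff L.sum_right_return_finite_iff
    by (simp add: drift_right_stacks drift_left_stacks)
  \<comment> \<open>Of the four combinations two are contradictory; the others reduce to a drift
    below -3 or above 3.\<close>
  also have "\<dots> \<longleftrightarrow> 3 < \<bar>mean_drift M P\<bar>" by linarith
  finally show ?thesis by (simp add: f_def)
qed

end

theorem corollary2:
  fixes P :: "cookie_env measure" and M :: nat
    and S :: "'s measure" and Q :: "cookie_env \<Rightarrow> 's measure" and X :: "nat \<Rightarrow> 's \<Rightarrow> int"
  assumes "env_law P" and "IID P" and "WEL P" and "BD M P"
    and "ERW 0 S Q X"
  shows "(\<integral>\<^sup>+ s. ennreal_of_enat (return_time X s)
                  * indicator {s. return_time X s < \<infinity>} s \<partial>(P \<bind> Q)) < \<infinity>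
         \<longleftrightarrow> \<bar>mean_drift M P\<bar> > 3"
  by (rule mean_return_finite_iff[OF assms])

end
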